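(* Let $G$ be a nilpotent group of nilpotency class $c>2$ and let $n=\lceil \log_2(\frac{c+1}{3})\rceil$. If $\exp(G)$ is odd, then $\exp(G\wedge G)$ divides $(\exp(G))^n$. In particular, $\exp(M(G))$ divides $(\exp(G))^n$.
   Context: Conventions: ${}^g h = ghg^{-1}$, $[g,h]=ghg^{-1}h^{-1}$. The nonabelian tensor square $G\otimes G$ is generated by symbols $g\otimes h$ subject to $gg'\otimes h=({}^g g'\otimes {}^g h)(g\otimes h)$ and $g\otimes hh'=(g\otimes h)({}^h g\otimes {}^h h')$; the exterior square $G\wedge G$ is its quotient by the subgroup generated by all $x\otimes x$. $M(G)$ is the kernel of the homomorphism $G\wedge G\to[G,G]$, $g\wedge h\mapsto[g,h]$, and is isomorphic to $H_2(G,\mathbb{Z})$. *)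

theory Defs
  imports "HOL-Algebra.Algebra" Complex_Main
begin

definition group_exponent :: "('a, 'b) monoid_scheme \<Rightarrow> nat" where
  "group_exponent H =
     (if \<exists>n::nat>0. \<forall>x\<in>carrier H. x [^]\<^bsub>H\<^esub> n = \<one>\<^bsub>H\<^esub>
      then (LEAST n. n > 0 \<and> (\<forall>x\<in>carrier H. x [^]\<^bsub>H\<^esub> n = \<one>\<^bsub>H\<^esub>))
      else 0)"

text \<open>Convention [x,y] = x y x^-1 y^-1. lcs G k is gamma_(k+1)(G).\<close>
definition grp_comm :: "('a, 'b) monoid_scheme \<Rightarrow> 'a \<Rightarrow> 'a \<Rightarrow> 'a" where
  "grp_comm G x y = x \<otimes>\<^bsub>G\<^esub> y \<otimes>\<^bsub>G\<^esub> inv\<^bsub>G\<^esub> x \<otimes>\<^bsub>G\<^esub> inv\<^bsub>G\<^esub> y"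

fun lcs :: "('a, 'b) monoid_scheme \<Rightarrow> nat \<Rightarrow> 'a set" where
  "lcs G 0 = carrier G"
| "lcs G (Suc i) = generate G {grp_comm G x y | x y. x \<in> lcs G i \<and> y \<in> carrier G}"

definition nilpotent_class :: "('a, 'b) monoid_scheme \<Rightarrow> nat \<Rightarrow> bool" where
  "nilpotent_class G c \<longleftrightarrow> lcs G c = {\<one>\<^bsub>G\<^esub>} \<and> (c = 0 \<or> lcs G (c - 1) \<noteq> {\<one>\<^bsub>G\<^esub>})"

text \<open>Words in the free group on symbols (g,h), g,h in G; a letter (s,True) is s, (s,False) is s^-1.\<close>
type_synonym 'a ext_word = "(('a \<times> 'a) \<times> bool) list"

definition conj_el :: "('a, 'b) monoid_scheme \<Rightarrow> 'a \<Rightarrow> 'a \<Rightarrow> 'a" where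
  "conj_el G g h = g \<otimes>\<^bsub>G\<^esub> h \<otimes>\<^bsub>G\<^esub> inv\<^bsub>G\<^esub> g"

definition ext_words :: "('a, 'b) monoid_scheme \<Rightarrow> 'a ext_word set" where
  "ext_words G = {w. \<forall>((g, h), b) \<in> set w. g \<in> carrier G \<and> h \<in> carrier G}"

text \<open>The congruence on words generated by free cancellation and the defining relations
  of G \<wedge> G (the two tensor relations and x \<otimes> x = 1).\<close>
inductive ext_rel :: "('a, 'b) monoid_scheme \<Rightarrow> 'a ext_word \<Rightarrow> 'a ext_word \<Rightarrow> bool"
  for G where
  refl: "ext_rel G w w"
| sym: "ext_rel G u v \<Longrightarrow> ext_rel G v u"
| trans: "ext_rel G u v \<Longrightarrow> ext_rel G v w \<Longrightarrow> ext_rel G u w"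
| cong: "ext_rel G u v \<Longrightarrow> ext_rel G (a @ u @ b) (a @ v @ b)"
| cancel: "g \<in> carrier G \<Longrightarrow> h \<in> carrier G \<Longrightarrow>
     ext_rel G [((g, h), b), ((g, h), \<not> b)] []"
| rel_left: "g \<in> carrier G \<Longrightarrow> g' \<in> carrier G \<Longrightarrow> h \<in> carrier G \<Longrightarrow>
     ext_rel G [((g \<otimes>\<^bsub>G\<^esub> g', h), True)]
               [((conj_el G g g', conj_el G g h), True), ((g, h), True)]"
| rel_right: "g \<in> carrier G \<Longrightarrow> h \<in> carrier G \<Longrightarrow> h' \<in> carrier G \<Longrightarrow>
     ext_rel G [((g, h \<otimes>\<^bsub>G\<^esub> h'), True)]
               [((g, h), True), ((conj_el G h g, conj_el G h h'), True)]"
| rel_diag: "g \<in> carrier G \<Longrightarrow> ext_rel G [((g, g), True)] []"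

definition ext_class :: "('a, 'b) monoid_scheme \<Rightarrow> 'a ext_word \<Rightarrow> 'a ext_word set" where
  "ext_class G w = {v \<in> ext_words G. ext_rel G w v}"

definition ext_square :: "('a, 'b) monoid_scheme \<Rightarrow> 'a ext_word set monoid" where
  "ext_square G =
    \<lparr> carrier = ext_class G ` ext_words G,
      monoid.mult = (\<lambda>A B. ext_class G ((SOME a. a \<in> A) @ (SOME b. b \<in> B))),
      one = ext_class G [] \<rparr>"

fun ext_eval :: "('a, 'b) monoid_scheme \<Rightarrow> 'a ext_word \<Rightarrow> 'a" where
  "ext_eval G [] = \<one>\<^bsub>G\<^esub>"
| "ext_eval G (((g, h), b) # w) =
     (if b then grp_comm G g h else inv\<^bsub>G\<^esub> (grp_comm G g h)) \<otimes>\<^bsub>G\<^esub> ext_eval G w"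

definition ext_comm_map :: "('a, 'b) monoid_scheme \<Rightarrow> 'a ext_word set \<Rightarrow> 'a" where
  "ext_comm_map G C = ext_eval G (SOME w. w \<in> C)"

definition schur_mult :: "('a, 'b) monoid_scheme \<Rightarrow> 'a ext_word set monoid" where
  "schur_mult G = (ext_square G)\<lparr> carrier := kernel (ext_square G) G (ext_comm_map G) \<rparr>"

end

theory Submission
  imports Defs
begin

text \<open>
  Every element of \<open>G \<and> G\<close> lies in the commutator subgroup of a group \<open>E\<close> that contains \<open>G \<and> G\<close>, is a
  central extension of a subgroup of \<open>G\<close>, and in which \<open>[z, z']\<close> is the wedge of the images of \<open>z\<close> and
  \<open>z'\<close>. Then \<open>E\<close> has class at most \<open>c + 1\<close> and all \<open>e\<close>-th powers are central in \<open>E\<close>, where \<open>e = exp G\<close>,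
  and it suffices to bound the exponent of \<open>\<Gamma>\<^sub>2(E)\<close>.

  Expanding \<open>[x\<^sup>e, y] = 1\<close> for \<open>x \<in> \<Gamma>\<^sub>m\<close> gives \<open>\<Gamma>\<^sub>m\<^sub>+\<^sub>1\<^sup>e \<subseteq> \<Gamma>\<^sub>2\<^sub>m\<^sub>+\<^sub>1\<close>, so each doubling of the class
  costs one factor \<open>e\<close>. The chain starts with \<open>\<Gamma>\<^sub>2\<^sup>e \<subseteq> \<Gamma>\<^sub>7\<close>, that is, with class six. There the expansion
  leaves \<open>[x, y]\<^sup>e\<close> equal to a product of weight-four terms with exponent \<open>e choose 3\<close> and of
  \<open>[x, x, x, x, x, y]\<close> with exponent \<open>e choose 5\<close>. As \<open>e\<close> divides \<open>3 * (e choose 3)\<close> and \<open>5 * (e choose 5)\<close>,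
  these are values of multilinear maps into groups of exponent 3 and 5. Comparing
  the expansion at \<open>(x, y)\<close> with those at other arguments yields linearised Engel identities, which in
  characteristic 3 and 5 force both parts to vanish.
\<close>

section \<open>The lower central series\<close>

text \<open>The index is the weight: \<open>lower_central G 1\<close> is \<open>G\<close>, and so is \<open>lower_central G 0\<close>.\<close>

definition lower_central :: "('a, 'b) monoid_scheme \<Rightarrow> nat \<Rightarrow> 'a set" where
  "lower_central G k = lcs G (k - 1)"

context group
begin

abbreviation cm :: "'a \<Rightarrow> 'a \<Rightarrow> 'a" where "cm \<equiv> grp_comm G"
abbreviation gam :: "nat \<Rightarrow> 'a set" where "gam \<equiv> lower_central G"

lemma mult_inv_cancel [simp]:
  assumes "x \<in> carrier G" "y \<in> carrier G"
  shows "x \<otimes> (inv x \<otimes> y) = y" "inv x \<otimes> (x \<otimes> y) = y"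
  using assms by (simp_all flip: m_assoc)

section \<open>Identities for conjugation and commutators\<close>

lemma comm_closed [simp, intro]:
  "x \<in> carrier G \<Longrightarrow> y \<in> carrier G \<Longrightarrow> cm x y \<in> carrier G"
  by (simp add: grp_comm_def)

lemma conj_closed [simp, intro]:
  "x \<in> carrier G \<Longrightarrow> y \<in> carrier G \<Longrightarrow> conj_el G x y \<in> carrier G"
  by (simp add: conj_el_def)

lemmas word_simps = grp_comm_def conj_el_def m_assoc inv_mult_group

lemma conj_mult:
  "\<lbrakk>x \<in> carrier G; y \<in> carrier G; z \<in> carrier G\<rbrakk>
    \<Longrightarrow> conj_el G x (y \<otimes> z) = conj_el G x y \<otimes> conj_el G x z"
  by (simp add: word_simps)

lemma conj_conj:
  "\<lbrakk>x \<in> carrier G; y \<in> carrier G; z \<in> carrier G\<rbrakk>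
    \<Longrightarrow> conj_el G (x \<otimes> y) z = conj_el G x (conj_el G y z)"
  by (simp add: word_simps)

lemma conj_inv:
  "\<lbrakk>x \<in> carrier G; y \<in> carrier G\<rbrakk> \<Longrightarrow> conj_el G x (inv y) = inv (conj_el G x y)"
  by (simp add: word_simps)

lemma conj_comm:
  "\<lbrakk>x \<in> carrier G; y \<in> carrier G; z \<in> carrier G\<rbrakk>
    \<Longrightarrow> conj_el G x (cm y z) = cm (conj_el G x y) (conj_el G x z)"
  by (simp add: word_simps)

lemma conj_pow:
  assumes "x \<in> carrier G" "y \<in> carrier G"
  shows "conj_el G x (y [^] (n::nat)) = conj_el G x y [^] n"
proof (induction n)
  case 0 then show ?case using assms by (simp add: conj_el_def)
next
  case (Suc n) then show ?case using assms by (simp add: conj_mult)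
qed

lemma conj_eq_comm:
  "\<lbrakk>x \<in> carrier G; y \<in> carrier G\<rbrakk> \<Longrightarrow> conj_el G x y = cm x y \<otimes> y"
  by (simp add: word_simps)

lemma comm_mult_left:
  "\<lbrakk>x \<in> carrier G; y \<in> carrier G; z \<in> carrier G\<rbrakk>
    \<Longrightarrow> cm (x \<otimes> y) z = conj_el G x (cm y z) \<otimes> cm x z"
  by (simp add: word_simps)

lemma comm_mult_right:
  "\<lbrakk>x \<in> carrier G; y \<in> carrier G; z \<in> carrier G\<rbrakk>
    \<Longrightarrow> cm x (y \<otimes> z) = cm x y \<otimes> conj_el G y (cm x z)"
  by (simp add: word_simps)

lemma inv_comm:
  "\<lbrakk>x \<in> carrier G; y \<in> carrier G\<rbrakk> \<Longrightarrow> inv (cm x y) = cm y x"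
  by (simp add: word_simps)

lemma comm_one [simp]:
  "x \<in> carrier G \<Longrightarrow> cm \<one> x = \<one>" "x \<in> carrier G \<Longrightarrow> cm x \<one> = \<one>"
  "x \<in> carrier G \<Longrightarrow> cm x x = \<one>"
  by (simp_all add: word_simps)

lemma comm_eq_one_iff:
  assumes "x \<in> carrier G" "y \<in> carrier G"
  shows "cm x y = \<one> \<longleftrightarrow> x \<otimes> y = y \<otimes> x"
proof
  assume "cm x y = \<one>"
  then have "cm x y \<otimes> (y \<otimes> x) = y \<otimes> x" using assms by simp
  then show "x \<otimes> y = y \<otimes> x" using assms by (simp add: word_simps)
next
  assume e: "x \<otimes> y = y \<otimes> x"
  have "cm x y = (x \<otimes> y) \<otimes> (inv x \<otimes> inv y)" using assms by (simp add: word_simps)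
  also have "\<dots> = \<one>" unfolding e using assms by (simp add: m_assoc)
  finally show "cm x y = \<one>" .
qed

lemma comm_swap:
  "\<lbrakk>x \<in> carrier G; y \<in> carrier G\<rbrakk> \<Longrightarrow> x \<otimes> y = cm x y \<otimes> (y \<otimes> x)"
  by (simp add: word_simps)

lemma comm_inv_left:
  "\<lbrakk>x \<in> carrier G; y \<in> carrier G\<rbrakk> \<Longrightarrow> cm (inv x) y = conj_el G (inv x) (inv (cm x y))"
  by (simp add: word_simps)

text \<open>Everything cancels freely. This is the group form of the Jacobi identity; it gives
  \<open>comm_gam\<close> and, once conjugations become invisible,
  \<open>graded_hom_Jacobi\<close>.\<close>

lemma Hall_Witt:
  "\<lbrakk>a \<in> carrier G; b \<in> carrier G; c \<in> carrier G\<rbrakk>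
    \<Longrightarrow> cm (cm a b) (conj_el G b c) \<otimes> cm (cm b c) (conj_el G c a) \<otimes> cm (cm c a) (conj_el G a b) = \<one>"
  by (simp add: word_simps)

section \<open>Lower central subgroups and weights of commutators\<close>

lemma gam_Suc: "k > 0 \<Longrightarrow> gam (Suc k) = generate G {cm x y | x y. x \<in> gam k \<and> y \<in> carrier G}"
  by (cases k) (auto simp: lower_central_def)

lemma gam_0 [simp]: "gam 0 = carrier G" and gam_1 [simp]: "gam 1 = carrier G" "gam (Suc 0) = carrier G"
  by (simp_all add: lower_central_def)

lemma gam_in_carrier': "gam k \<subseteq> carrier G"
proof (induction k)
  case (Suc k)
  show ?case
  proof (cases "k = 0")
    case False
    have "{cm x y | x y. x \<in> gam k \<and> y \<in> carrier G} \<subseteq> carrier G" using Suc by blast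
    then show ?thesis using False generate_incl by (simp add: gam_Suc)
  qed simp
qed simp

lemma gam_carrier: "x \<in> gam k \<Longrightarrow> x \<in> carrier G"
  using gam_in_carrier' by blast

lemma gam_subgroup: "subgroup (gam k) G"
proof (cases k)
  case (Suc j)
  show ?thesis
  proof (cases "j = 0")
    case False
    then show ?thesis unfolding Suc gam_Suc[OF False[unfolded neq0_conv]]
      by (intro generate_is_subgroup) (use gam_carrier comm_closed in blast)
  qed (simp add: Suc subgroup_self)
qed (simp add: subgroup_self)

lemma gam_one [simp]: "\<one> \<in> gam k"
  and gam_mult [simp]: "x \<in> gam k \<Longrightarrow> y \<in> gam k \<Longrightarrow> x \<otimes> y \<in> gam k"
  and gam_inv [simp]: "x \<in> gam k \<Longrightarrow> inv x \<in> gam k"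
  using gam_subgroup[of k] by (auto dest: subgroup.one_closed subgroup.m_closed subgroup.m_inv_closed)

lemma gam_pow [simp]: "x \<in> gam k \<Longrightarrow> x [^] (n::nat) \<in> gam k"
  by (induction n) auto

lemma comm_gam_carrier: "x \<in> gam k \<Longrightarrow> y \<in> carrier G \<Longrightarrow> cm x y \<in> gam (Suc k)"
  by (cases "k = 0") (auto simp: gam_Suc intro: generate.incl)

lemma gam_induct [consumes 2, case_names comm one mult inv]:
  assumes "x \<in> gam (Suc k)" "k > 0"
    and "\<And>a h. a \<in> gam k \<Longrightarrow> h \<in> carrier G \<Longrightarrow> P (cm a h)" "P \<one>"
    and "\<And>x y. x \<in> gam (Suc k) \<Longrightarrow> y \<in> gam (Suc k) \<Longrightarrow> P x \<Longrightarrow> P y \<Longrightarrow> P (x \<otimes> y)"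
    and "\<And>x. x \<in> gam (Suc k) \<Longrightarrow> P x \<Longrightarrow> P (inv x)"
  shows "P x"
proof -
  have "x \<in> generate G {cm x y | x y. x \<in> gam k \<and> y \<in> carrier G}" using assms(1,2) gam_Suc by blast
  then have "x \<in> gam (Suc k) \<and> P x"
  proof (induction rule: generate.induct)
    case (eng h1 h2) then show ?case using assms by auto
  next
    case (incl h) then show ?case using assms(3) comm_gam_carrier by auto
  next
    case (inv h) then show ?case using assms(3,6) comm_gam_carrier by auto
  qed (use assms in auto)
  then show ?thesis by blast
qed

lemma conj_gam [simp]: "x \<in> carrier G \<Longrightarrow> y \<in> gam k \<Longrightarrow> conj_el G x y \<in> gam k"
proof (induction k arbitrary: x y)
  case 0 then show ?case by simp
next
  case (Suc k)
  show ?case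
  proof (cases "k = 0")
    case False
    from Suc.prems(2) False[unfolded neq0_conv] show ?thesis
    proof (induction rule: gam_induct)
      case (comm a h)
      then show ?case using Suc.prems(1) Suc.IH gam_carrier[OF comm(1)]
        by (simp add: conj_comm comm_gam_carrier)
    next
      case one then show ?case using Suc.prems(1) by (simp add: conj_el_def)
    next
      case (mult a b) then show ?case using Suc.prems(1) gam_carrier by (simp add: conj_mult)
    next
      case (inv a) then show ?case using Suc.prems(1) gam_carrier by (simp add: conj_inv)
    qed
  qed (use Suc.prems in simp)
qed

lemma gam_normal: "gam k \<lhd> G"
  unfolding normal_inv_iff using gam_subgroup conj_gam unfolding conj_el_def by blast

lemma gam_Suc_subset: "gam (Suc k) \<subseteq> gam k"
proof (cases "k = 0")
  case False
  show ?thesis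
  proof
    fix x assume "x \<in> gam (Suc k)"
    from this False[unfolded neq0_conv] show "x \<in> gam k"
    proof (induction rule: gam_induct)
      case (comm a h)
      have "cm a h = a \<otimes> conj_el G h (inv a)"
        using comm(2) gam_carrier[OF comm(1)] by (simp add: word_simps)
      then show ?case using comm by simp
    qed auto
  qed
qed simp

lemma gam_antimono: "i \<le> j \<Longrightarrow> gam j \<subseteq> gam i"
  by (rule lift_Suc_antimono_le[of gam]) (rule gam_Suc_subset)

lemma gam_mono: "x \<in> gam j \<Longrightarrow> i \<le> j \<Longrightarrow> x \<in> gam i"
  using gam_antimono by blast

lemma comm_gam_sym: "cm x y \<in> gam k \<Longrightarrow> x \<in> carrier G \<Longrightarrow> y \<in> carrier G \<Longrightarrow> cm y x \<in> gam k"
  using gam_inv[of "cm x y" k] by (simp only: inv_comm)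

text \<open>Induction on \<open>i\<close> with \<open>j\<close> arbitrary: the Hall-Witt identity
  trades \<open>[[a, b], y]\<close>, with \<open>a\<close> in \<open>gam i\<close>, for commutators
  to which the hypothesis for \<open>a\<close> applies.\<close>

lemma comm_gam: "x \<in> gam i \<Longrightarrow> y \<in> gam j \<Longrightarrow> cm x y \<in> gam (i + j)"
proof (induction i arbitrary: x y j)
  case 0
  have "cm y x \<in> gam (Suc j)" using 0 comm_gam_carrier by simp
  then have "cm x y \<in> gam (Suc j)" using 0 comm_gam_sym gam_carrier by blast
  then show ?case using gam_mono[of _ "Suc j" j] by simp
next
  case (Suc i)
  show ?case
  proof (cases "i = 0")
    case True
    then show ?thesis
      using Suc.prems comm_gam_carrier[OF Suc.prems(2)] comm_gam_sym[of y x] gam_carrier by simp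
  next
    case False
    from Suc.prems(1) False[unfolded neq0_conv] show ?thesis
    proof (induction rule: gam_induct)
      case (comm a b)
      have [simp]: "a \<in> carrier G" "b \<in> carrier G" "y \<in> carrier G" using comm Suc.prems gam_carrier by blast+
      \<comment> \<open>Moving \<open>y\<close> back by \<open>b\<close> beforehand makes the first
        factor of the Hall-Witt identity exactly \<open>[[a, b], y]\<close>.\<close>
      define c where "c = conj_el G (inv b) y"
      have [simp]: "c \<in> carrier G" by (simp add: c_def)
      have c: "c \<in> gam j" "conj_el G b c = y"
        using Suc.prems(2) by (simp_all add: c_def) (simp add: word_simps)
      have 1: "cm (cm b c) (conj_el G c a) \<in> gam (Suc i + j)"
      proof -
        have "cm b c \<in> gam (Suc j)" using c comm_gam_carrier comm_gam_sym by simp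
        moreover have "conj_el G c a \<in> gam i" using comm by simp
        ultimately have "cm (conj_el G c a) (cm b c) \<in> gam (i + Suc j)" by (rule Suc.IH[rotated])
        then show ?thesis using comm_gam_sym by simp
      qed
      have 2: "cm (cm c a) (conj_el G a b) \<in> gam (Suc i + j)"
      proof -
        have "cm a c \<in> gam (i + j)" using Suc.IH comm c by blast
        then have "cm c a \<in> gam (i + j)" using comm_gam_sym by simp
        then show ?thesis using comm_gam_carrier by simp
      qed
      let ?p = "cm (cm b c) (conj_el G c a) \<otimes> cm (cm c a) (conj_el G a b)"
      have "cm (cm a b) y \<otimes> ?p = \<one>"
        using Hall_Witt[of a b c] c by (simp add: m_assoc)
      then have "cm (cm a b) y = inv ?p" by (intro inv_equality[symmetric]) simp_all
      then show ?case using 1 2 by (metis gam_inv gam_mult)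
    next
      case one then show ?case using Suc.prems gam_carrier by simp
    next
      case (mult a b)
      then show ?case using Suc.prems gam_carrier comm_mult_left by simp
    next
      case (inv a)
      then show ?case using Suc.prems gam_carrier comm_inv_left by simp
    qed
  qed
qed

lemma comm_gam_le: "x \<in> gam i \<Longrightarrow> y \<in> gam j \<Longrightarrow> k \<le> i + j \<Longrightarrow> cm x y \<in> gam k"
  using comm_gam gam_mono by blast

end

section \<open>Powers of products and the doubling step\<close>

context group
begin

lemma pow_commute_comm:
  assumes [simp]: "a \<in> carrier G" "b \<in> carrier G"
    and c: "cm b a \<otimes> a = a \<otimes> cm b a" "cm b a \<otimes> b = b \<otimes> cm b a"
  shows "b [^] (n::nat) \<otimes> a = a \<otimes> (cm b a [^] n \<otimes> b [^] n)"
proof (induction n)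
  case (Suc n)
  let ?c = "cm b a"
  have cn: "?c [^] n \<otimes> b = b \<otimes> ?c [^] n" using c(2) by (simp add: group_commutes_pow)
  have "b [^] Suc n \<otimes> a = b \<otimes> (b [^] n \<otimes> a)" unfolding nat_pow_Suc2[OF assms(2)] by (simp add: m_assoc)
  also have "\<dots> = b \<otimes> a \<otimes> ?c [^] n \<otimes> b [^] n" by (simp add: Suc m_assoc)
  also have "b \<otimes> a = a \<otimes> ?c \<otimes> b"
    by (subst comm_swap) (simp_all add: c(1) flip: m_assoc)
  also have "a \<otimes> ?c \<otimes> b \<otimes> ?c [^] n \<otimes> b [^] n = a \<otimes> ?c \<otimes> (b \<otimes> ?c [^] n) \<otimes> b [^] n"
    by (simp add: m_assoc)
  also have "\<dots> = a \<otimes> (?c \<otimes> ?c [^] n) \<otimes> (b \<otimes> b [^] n)"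
    unfolding cn[symmetric] by (simp add: m_assoc)
  finally show ?case unfolding nat_pow_Suc2[OF assms(2)] nat_pow_Suc2[OF comm_closed[OF assms(2,1)]] by (simp add: m_assoc)
qed simp

text \<open>Moving each new \<open>a\<close> to the left past \<open>b [^] n\<close> costs
  \<open>cm b a [^] n\<close>, and these exponents add up to \<open>n choose 2\<close>.\<close>

lemma pow_mult_class2:
  assumes [simp]: "a \<in> carrier G" "b \<in> carrier G"
    and c: "cm b a \<otimes> a = a \<otimes> cm b a" "cm b a \<otimes> b = b \<otimes> cm b a"
  shows "(a \<otimes> b) [^] (n::nat) = a [^] n \<otimes> (cm b a [^] (n choose 2) \<otimes> b [^] n)"
proof (induction n)
  case (Suc n)
  let ?c = "cm b a"
  have ca: "?c [^] k \<otimes> a = a \<otimes> ?c [^] k" for k :: nat using c(1) by (simp add: group_commutes_pow)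
  have C: "Suc n choose 2 = (n choose 2) + n" by (simp add: numeral_2_eq_2)
  have "(a \<otimes> b) [^] Suc n = a [^] n \<otimes> (?c [^] (n choose 2) \<otimes> (b [^] n \<otimes> a \<otimes> b))"
    by (simp add: Suc m_assoc)
  also have "\<dots> = a [^] n \<otimes> (?c [^] (n choose 2) \<otimes> a \<otimes> (?c [^] n \<otimes> (b [^] n \<otimes> b)))"
    by (simp add: pow_commute_comm[OF assms] m_assoc)
  also have "\<dots> = (a [^] n \<otimes> a) \<otimes> (?c [^] (n choose 2) \<otimes> ?c [^] n) \<otimes> (b [^] n \<otimes> b)"
    by (simp add: ca m_assoc)
  finally show ?case by (simp add: nat_pow_mult C m_assoc)
qed (simp add: binomial_eq_0)

lemma pow_mod_exp:
  assumes "x \<in> carrier G" "x [^] (e::nat) = \<one>" "e dvd n"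
  shows "x [^] n = \<one>"
  using assms by (auto simp: nat_pow_pow[symmetric])

lemma pow_inv_one: "x \<in> carrier G \<Longrightarrow> x [^] (n::nat) = \<one> \<Longrightarrow> inv x [^] n = \<one>"
  by (simp add: nat_pow_inv)

lemma comm_pow_central:
  assumes [simp]: "a \<in> carrier G" "h \<in> carrier G" and c: "cm a h \<otimes> a = a \<otimes> cm a h"
  shows "cm (a [^] (n::nat)) h = cm a h [^] n"
proof (induction n)
  case (Suc n)
  have "conj_el G a (cm a h [^] n) = cm a h [^] n"
    unfolding conj_el_def by (subst group_commutes_pow[OF c, symmetric]) (simp_all add: m_assoc)
  then show ?case
    unfolding nat_pow_Suc2[OF assms(1)] by (simp add: comm_mult_left Suc del: nat_pow_Suc)
qed simp

text \<open>For \<open>a\<close> in \<open>gam m\<close> the commutator \<open>[[a, h], a]\<close>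
  has weight \<open>2 * m + 1\<close> and is trivial, so \<open>[a, h]^e = [a^e, h] = 1\<close>. As
  \<open>gam (Suc m)\<close> is abelian here, powers of products split.\<close>

lemma central_pow_comm:
  assumes "\<And>x y. x \<in> carrier G \<Longrightarrow> y \<in> carrier G \<Longrightarrow> cm (x [^] (e::nat)) y = \<one>"
    and "gam (2 * m + 1) = {\<one>}" "m > 0" "z \<in> gam (Suc m)"
  shows "z [^] e = \<one>"
  using assms(4,3)
proof (induction rule: gam_induct)
  case (comm a h)
  have [simp]: "a \<in> carrier G" "h \<in> carrier G" using comm gam_carrier by auto
  have "cm (cm a h) a \<in> gam (Suc m + m)" using comm comm_gam comm_gam_carrier by blast
  then have "cm a h \<otimes> a = a \<otimes> cm a h" using assms(2) by (simp add: comm_eq_one_iff mult_2)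
  then show ?case using assms(1)[of a h] comm_pow_central[of a h e] by simp
next
  case (mult x y)
  have [simp]: "x \<in> carrier G" "y \<in> carrier G" using mult gam_carrier by auto
  have "cm x y \<in> gam (2 * m + 1)" using mult(1,2) by (rule comm_gam_le) simp
  then have "x \<otimes> y = y \<otimes> x" using assms(2) by (simp add: comm_eq_one_iff)
  then show ?case using mult pow_mult_distrib by simp
next
  case (inv x) then show ?case using gam_carrier pow_inv_one by blast
qed simp

end

section \<open>Images and quotients\<close>

lemma (in group_hom) hom_comm:
  "x \<in> carrier G \<Longrightarrow> y \<in> carrier G \<Longrightarrow> h (grp_comm G x y) = grp_comm H (h x) (h y)"
  by (simp add: grp_comm_def)

lemma (in group_hom) lower_central_image:
  assumes "h ` carrier G = carrier H"
  shows "h ` lower_central G k = lower_central H k"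
proof (induction k)
  case 0 then show ?case using assms by simp
next
  case (Suc k)
  show ?case
  proof (cases "k = 0")
    case False
    then have k: "k > 0" by simp
    let ?S = "{grp_comm G x y | x y. x \<in> lower_central G k \<and> y \<in> carrier G}"
    have "?S \<subseteq> carrier G" using G.gam_carrier G.comm_closed by blast
    then have "h ` lower_central G (Suc k) = generate H (h ` ?S)"
      unfolding G.gam_Suc[OF k] by (rule generate_img[symmetric])
    also have "h ` ?S = {grp_comm H x y | x y. x \<in> lower_central H k \<and> y \<in> carrier H}"
    proof
      show "h ` ?S \<subseteq> {grp_comm H x y | x y. x \<in> lower_central H k \<and> y \<in> carrier H}"
        using Suc G.gam_carrier by (fastforce simp: hom_comm)
      show "{grp_comm H x y | x y. x \<in> lower_central H k \<and> y \<in> carrier H} \<subseteq> h ` ?S"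
      proof clarify
        fix x y assume "x \<in> lower_central H k" "y \<in> carrier H"
        then obtain a b where "a \<in> lower_central G k" "b \<in> carrier G" "x = h a" "y = h b"
          unfolding Suc[symmetric] assms[symmetric] by blast
        then show "grp_comm H x y \<in> h ` ?S" using G.gam_carrier hom_comm by (metis (mono_tags, lifting) image_eqI mem_Collect_eq)
      qed
    qed
    finally show ?thesis by (simp add: H.gam_Suc[OF k])
  qed (use assms in simp)
qed

lemma (in group_hom) central_pow_image:
  assumes "h ` carrier G = carrier H"
    and "\<And>x y. x \<in> carrier G \<Longrightarrow> y \<in> carrier G \<Longrightarrow> grp_comm G (x [^] (e::nat)) y = \<one>"
    and "x \<in> carrier H" "y \<in> carrier H"
  shows "grp_comm H (x [^]\<^bsub>H\<^esub> e) y = \<one>\<^bsub>H\<^esub>"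
proof -
  obtain a b where ab: "a \<in> carrier G" "b \<in> carrier G" "x = h a" "y = h b"
    using assms(1,3,4) by (metis imageE)
  then have "grp_comm H (x [^]\<^bsub>H\<^esub> e) y = h (grp_comm G (a [^] e) b)"
    by (simp add: hom_comm hom_nat_pow)
  then show ?thesis using assms(2) ab by simp
qed

context group
begin

lemma quotient_gam:
  fixes k :: nat
  defines "Q \<equiv> G Mod gam k" and "q \<equiv> \<lambda>a. gam k #> a"
  shows "group_hom G Q q" "q ` carrier G = carrier Q"
    "x \<in> carrier G \<Longrightarrow> q x = \<one>\<^bsub>Q\<^esub> \<longleftrightarrow> x \<in> gam k" "lower_central Q k = {\<one>\<^bsub>Q\<^esub>}"
proof -
  interpret N: normal "gam k" G by (rule gam_normal)
  show h: "group_hom G Q q" unfolding Q_def q_def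
    by (simp add: group_hom_def group_hom_axioms_def N.factorgroup_is_group N.r_coset_hom_Mod is_group)
  show s: "q ` carrier G = carrier Q" unfolding Q_def q_def by (auto simp: FactGroup_def RCOSETS_def)
  show 1: "q x = \<one>\<^bsub>Q\<^esub> \<longleftrightarrow> x \<in> gam k" if "x \<in> carrier G" for x
    unfolding Q_def q_def using that coset_join1[OF _ that gam_subgroup] coset_join2[OF that gam_subgroup]
    by (auto simp: gam_in_carrier')
  have "lower_central Q k = q ` gam k" using group_hom.lower_central_image[OF h s] by simp
  also have "\<dots> = {\<one>\<^bsub>Q\<^esub>}" using 1 gam_carrier gam_one by blast
  finally show "lower_central Q k = {\<one>\<^bsub>Q\<^esub>}" .
qed

lemma central_pow_comm_mod:
  assumes "\<And>x y. x \<in> carrier G \<Longrightarrow> y \<in> carrier G \<Longrightarrow> cm (x [^] (e::nat)) y = \<one>"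
    and "m > 0" "z \<in> gam (Suc m)"
  shows "z [^] e \<in> gam (2 * m + 1)"
proof -
  let ?k = "2 * m + 1"
  let ?Q = "G Mod gam ?k" and ?q = "\<lambda>a. gam ?k #> a"
  interpret q: group_hom G ?Q ?q by (rule quotient_gam)
  note q = quotient_gam[where k = ?k]
  have "?q z [^]\<^bsub>?Q\<^esub> e = \<one>\<^bsub>?Q\<^esub>"
  proof (rule q.H.central_pow_comm[OF _ q(4) assms(2)])
    show "grp_comm ?Q (x [^]\<^bsub>?Q\<^esub> e) y = \<one>\<^bsub>?Q\<^esub>" if "x \<in> carrier ?Q" "y \<in> carrier ?Q" for x y
      using q.central_pow_image[OF q(2) assms(1) that] .
    show "?q z \<in> lower_central ?Q (Suc m)"
      using assms(3) q.lower_central_image[OF q(2)] by blast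
  qed
  then show ?thesis using q(3)[of "z [^] e"] q.hom_nat_pow[of z e] gam_carrier[OF assms(3)] by simp
qed

end

section \<open>Groups of class at most six\<close>

text \<open>Absorption gives \<open>e dvd k * (e choose k)\<close>. Oddness cancels the factors 2
  and 4; the factors 3 and 5 stay, since they may divide \<open>e\<close>.\<close>

lemma odd_dvd_choose:
  fixes e :: nat
  assumes "odd e"
  shows "e dvd e choose 2" "e dvd e choose 4" "e dvd 3 * (e choose 3)" "e dvd 5 * (e choose 5)"
proof -
  have *: "e dvd k * (e choose k)" if "k > 0" for k
    using binomial_absorption[of "k - 1" e] that by simp
  have "coprime e 2" using assms by simp
  moreover from this have "coprime e (2 ^ 2)" unfolding coprime_power_right_iff by simp
  ultimately have "coprime e 2" "coprime e 4" by simp_all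
  then show "e dvd e choose 2" "e dvd e choose 4"
    using *[of 2] *[of 4] by (simp_all add: coprime_dvd_mult_right_iff)
  show "e dvd 3 * (e choose 3)" "e dvd 5 * (e choose 5)" using * by simp_all
qed

lemma choose_Suc_numeral:
  "Suc n choose 2 = (n choose 2) + n" "Suc n choose 3 = (n choose 3) + (n choose 2)"
  "Suc n choose 4 = (n choose 4) + (n choose 3)" "Suc n choose 5 = (n choose 5) + (n choose 4)"
  by (simp_all add: eval_nat_numeral)

section \<open>Collection formulas in class six\<close>

locale class6 = group G for G (structure) +
  fixes e :: nat
  assumes gam_7: "gam 7 = {\<one>}"
    and odd_e: "odd e"
    and central: "\<lbrakk>x \<in> carrier G; y \<in> carrier G\<rbrakk> \<Longrightarrow> cm (x [^] e) y = \<one>"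
begin

lemma comm_trivial: "\<lbrakk>x \<in> gam i; y \<in> gam j; 7 \<le> i + j\<rbrakk> \<Longrightarrow> cm x y = \<one>"
  using comm_gam_le[of x i y j 7] gam_7 by auto

lemma commute: "\<lbrakk>x \<in> gam i; y \<in> gam j; 7 \<le> i + j\<rbrakk> \<Longrightarrow> x \<otimes> y = y \<otimes> x"
  using comm_trivial comm_eq_one_iff gam_carrier by metis

lemma conj_trivial: "\<lbrakk>x \<in> gam i; y \<in> gam j; 7 \<le> i + j\<rbrakk> \<Longrightarrow> conj_el G x y = y"
  using comm_trivial conj_eq_comm gam_carrier by (metis l_one)

lemma pow_mult_gam:
  "\<lbrakk>x \<in> gam i; y \<in> gam j; 7 \<le> i + j\<rbrakk> \<Longrightarrow> (x \<otimes> y) [^] (n::nat) = x [^] n \<otimes> y [^] n"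
  using pow_mult_distrib commute gam_carrier by blast

text \<open>Conjugation by \<open>x\<close> multiplies each of \<open>v\<close>, \<open>b1\<close>,
  \<open>b2\<close>, \<open>b3\<close> by its successor and \<open>q1\<close> by \<open>q2\<close>,
  so the step from \<open>n\<close> to \<open>Suc n\<close> is Pascal's rule. The \<open>q\<close>
  terms arise because \<open>b1\<close> and \<open>v\<close> need not commute:
  \<open>(b1 \<otimes> v) [^] n\<close> contributes \<open>q1 [^] (n choose 2)\<close>.\<close>

lemma comm_pow_formula:
  assumes [simp]: "x \<in> carrier G" "y \<in> carrier G"
  defines "v \<equiv> cm x y"
  defines "b1 \<equiv> cm x v"
  defines "b2 \<equiv> cm x b1"
  defines "b3 \<equiv> cm x b2"
  defines "b4 \<equiv> cm x b3"
  defines "q1 \<equiv> cm v b1"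
  defines "q2 \<equiv> cm v b2"
  shows "cm (x [^] n) y = b1 [^] (n choose 2) \<otimes> (b2 [^] (n choose 3) \<otimes> (b3 [^] (n choose 4) \<otimes>
    (b4 [^] (n choose 5) \<otimes> (q1 [^] (n choose 3) \<otimes> (q2 [^] (n choose 4) \<otimes> v [^] n)))))"
    (is "_ = ?R n")
proof -
  have x1: "x \<in> gam 1" "y \<in> gam 1" by simp_all
  have v: "v \<in> gam 2" unfolding v_def by (rule comm_gam_le[OF x1]) simp
  have b1: "b1 \<in> gam 3" unfolding b1_def by (rule comm_gam_le[OF x1(1) v]) simp
  have b2: "b2 \<in> gam 4" unfolding b2_def by (rule comm_gam_le[OF x1(1) b1]) simp
  have b3: "b3 \<in> gam 5" unfolding b3_def by (rule comm_gam_le[OF x1(1) b2]) simp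
  have b4: "b4 \<in> gam 6" unfolding b4_def by (rule comm_gam_le[OF x1(1) b3]) simp
  have q1: "q1 \<in> gam 5" unfolding q1_def by (rule comm_gam_le[OF v b1]) simp
  have q2: "q2 \<in> gam 6" unfolding q2_def by (rule comm_gam_le[OF v b2]) simp
  have c [simp]: "v \<in> carrier G" "b1 \<in> carrier G" "b2 \<in> carrier G" "b3 \<in> carrier G" "b4 \<in> carrier G"
    "q1 \<in> carrier G" "q2 \<in> carrier G"
    using v b1 b2 b3 b4 q1 q2 gam_carrier by blast+
  have g4: "b2 \<in> gam 4" "b3 \<in> gam 4" "b4 \<in> gam 4" "q1 \<in> gam 4" "q2 \<in> gam 4"
    using b2 b3 b4 q1 q2 gam_mono[of _ _ 4] by simp_all
  \<comment> \<open>Two elements of \<open>gam 3\<close> need not commute, since 3 + 3 < 7. Powers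
    of the single element \<open>b1\<close> times elements of \<open>gam 4\<close> do, and all
    factors except \<open>v\<close> are of this kind.\<close>
  define A where "A = {b1 [^] (i::nat) \<otimes> m | i m. m \<in> gam 4}"
  have Ac: "z \<otimes> w = w \<otimes> z" if zw: "z \<in> A" "w \<in> A" for z w
  proof -
    obtain i m j l where z: "z = b1 [^] (i::nat) \<otimes> m" "m \<in> gam 4" "w = b1 [^] (j::nat) \<otimes> l" "l \<in> gam 4"
      using zw unfolding A_def by blast
    note [simp] = gam_carrier[OF z(2)] gam_carrier[OF z(4)]
    have 1: "m \<otimes> b1 [^] k = b1 [^] k \<otimes> m" "l \<otimes> b1 [^] k = b1 [^] k \<otimes> l" for k :: nat
      using commute[OF z(2) gam_pow[OF b1]] commute[OF z(4) gam_pow[OF b1]] by simp_all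
    have "z \<otimes> w = b1 [^] i \<otimes> (m \<otimes> b1 [^] j) \<otimes> l" by (simp add: z m_assoc)
    also have "\<dots> = (b1 [^] i \<otimes> b1 [^] j) \<otimes> (m \<otimes> l)" unfolding 1 by (simp add: m_assoc)
    also have "\<dots> = (b1 [^] j \<otimes> b1 [^] i) \<otimes> (l \<otimes> m)"
      using commute[OF z(2,4)] nat_pow_comm[of b1 i j] by simp
    also have "\<dots> = b1 [^] j \<otimes> (b1 [^] i \<otimes> l) \<otimes> m" by (simp add: m_assoc)
    also have "\<dots> = w \<otimes> z" unfolding 1[symmetric] by (simp add: z m_assoc)
    finally show ?thesis .
  qed
  have A4 [simp]: "m \<in> A" if "m \<in> gam 4" for m
    unfolding A_def using that gam_carrier[OF that] by (auto intro!: exI[of _ "0::nat"] exI[of _ m])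
  have A1 [simp]: "b1 [^] (i::nat) \<in> A" for i
    unfolding A_def by (auto intro!: exI[of _ i] exI[of _ \<one>])
  have Alc: "z \<otimes> (w \<otimes> u) = w \<otimes> (z \<otimes> u)" if "z \<in> A" "w \<in> A" "u \<in> carrier G" for z w u
  proof -
    have "A \<subseteq> carrier G" unfolding A_def using gam_carrier by auto
    then show ?thesis using Ac[OF that(1,2)] that by (simp flip: m_assoc add: subsetD)
  qed
  have cj: "conj_el G x v = b1 \<otimes> v" "conj_el G x b1 = b2 \<otimes> b1" "conj_el G x b2 = b3 \<otimes> b2"
    "conj_el G x b3 = b4 \<otimes> b3"
    unfolding b1_def[symmetric] b2_def[symmetric] b3_def[symmetric] b4_def[symmetric]
    by (simp_all add: conj_eq_comm b1_def b2_def b3_def b4_def)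
  have cj4: "conj_el G x b4 = b4" "conj_el G x q2 = q2"
    using conj_trivial[OF x1(1)] b4 q2 by auto
  have cjq: "conj_el G x q1 = q2 \<otimes> q1"
  proof -
    have "conj_el G x q1 = cm (b1 \<otimes> v) (b2 \<otimes> b1)" unfolding q1_def by (simp add: conj_comm cj)
    also have "\<dots> = conj_el G b1 (cm v (b2 \<otimes> b1)) \<otimes> cm b1 (b2 \<otimes> b1)" by (simp add: comm_mult_left)
    also have "cm b1 (b2 \<otimes> b1) = \<one>" using comm_trivial[OF b1 b2] by (simp add: comm_mult_right conj_el_def)
    also have "cm v (b2 \<otimes> b1) = q2 \<otimes> q1"
      using conj_trivial[OF b2 q1] by (simp add: comm_mult_right q1_def q2_def)
    also have "conj_el G b1 (q2 \<otimes> q1) = q2 \<otimes> q1"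
      using conj_trivial[OF b1 q1] conj_trivial[OF b1 q2] by (simp add: conj_mult)
    finally show ?thesis by simp
  qed
  have pd: "(b2 \<otimes> b1) [^] k = b2 [^] k \<otimes> b1 [^] k" "(b3 \<otimes> b2) [^] k = b3 [^] k \<otimes> b2 [^] k"
    "(b4 \<otimes> b3) [^] k = b4 [^] k \<otimes> b3 [^] k" "(q2 \<otimes> q1) [^] k = q2 [^] k \<otimes> q1 [^] k" for k :: nat
    using pow_mult_gam[OF b2 b1] pow_mult_gam[OF b3 b2] pow_mult_gam[OF b4 b3] pow_mult_gam[OF q2 q1]
    by simp_all
  have pv: "(b1 \<otimes> v) [^] k = b1 [^] k \<otimes> (q1 [^] (k choose 2) \<otimes> v [^] k)" for k :: nat
    unfolding q1_def using commute[OF q1 b1] commute[OF q1 v] by (intro pow_mult_class2) (simp_all add: q1_def)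
  note sp = nat_pow_mult[of b1, symmetric] nat_pow_mult[of b2, symmetric] nat_pow_mult[of b3, symmetric]
    nat_pow_mult[of b4, symmetric] nat_pow_mult[of q1, symmetric] nat_pow_mult[of q2, symmetric]
  show ?thesis
  proof (induction n)
    case (Suc n)
    have "cm (x [^] Suc n) y = conj_el G x (cm (x [^] n) y) \<otimes> v"
      unfolding nat_pow_Suc2[OF assms(1)] v_def by (simp add: comm_mult_left)
    also have "\<dots> = (b2 [^] (n choose 2) \<otimes> b1 [^] (n choose 2)) \<otimes> ((b3 [^] (n choose 3) \<otimes> b2 [^] (n choose 3)) \<otimes>
       ((b4 [^] (n choose 4) \<otimes> b3 [^] (n choose 4)) \<otimes> (b4 [^] (n choose 5) \<otimes>
        ((q2 [^] (n choose 3) \<otimes> q1 [^] (n choose 3)) \<otimes> (q2 [^] (n choose 4) \<otimes>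
         (b1 [^] n \<otimes> (q1 [^] (n choose 2) \<otimes> v [^] n))))))) \<otimes> v"
      unfolding Suc by (simp add: conj_mult conj_pow cj cj4 cjq pd pv)
    also have "\<dots> = ?R (Suc n)"
      unfolding choose_Suc_numeral by (simp add: sp m_assoc Ac Alc g4)
    finally show ?case .
  qed (simp add: binomial_eq_0 v_def)
qed

lemma comm_pow_gam2:
  assumes "u \<in> gam 2" "v \<in> gam 2"
  shows "cm (v [^] (n::nat)) u = cm v u [^] n \<otimes> cm v (cm v u) [^] (n choose 2)"
proof -
  have [simp]: "u \<in> carrier G" "v \<in> carrier G" using assms gam_carrier by auto
  have a: "cm v u \<in> gam 4" by (rule comm_gam_le[OF assms(2,1)]) simp
  have b: "cm v (cm v u) \<in> gam 6" by (rule comm_gam_le[OF assms(2) a]) simp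
  have [simp]: "cm v (cm v (cm v u)) = \<one>" by (rule comm_trivial[OF assms(2) b]) simp
  have [simp]: "cm (cm v u) (cm v (cm v u)) = \<one>" by (rule comm_trivial[OF a b]) simp
  have "cm v (cm v u) [^] (n choose 2) \<otimes> cm v u [^] n = cm v u [^] n \<otimes> cm v (cm v u) [^] (n choose 2)"
    using commute[OF gam_pow[OF b] gam_pow[OF a]] by simp
  then show ?thesis by (simp add: comm_pow_formula)
qed

text \<open>Inside \<open>gam 2\<close> commutators of four entries have weight eight and vanish.
  Commuting \<open>u [^] k\<close> with \<open>a1 [^] k\<close> costs \<open>a3 [^] (k * k)\<close>,
  so the exponent of \<open>a3\<close> is the sum of the squares below \<open>n\<close>.\<close>

lemma pow_mult_gam2_formula:
  assumes "u \<in> gam 2" "v \<in> gam 2"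
  defines "a1 \<equiv> cm v u"
  defines "a2 \<equiv> cm v a1"
  defines "a3 \<equiv> cm u a1"
  shows "(u \<otimes> v) [^] n = a1 [^] (n choose 2) \<otimes> (a2 [^] (n choose 3) \<otimes>
    (a3 [^] (2 * (n choose 3) + (n choose 2)) \<otimes> (u [^] n \<otimes> v [^] n)))"
proof -
  have [simp]: "u \<in> carrier G" "v \<in> carrier G" using assms gam_carrier by auto
  have a1: "a1 \<in> gam 4" unfolding a1_def by (rule comm_gam_le[OF assms(2,1)]) simp
  have a2: "a2 \<in> gam 6" unfolding a2_def by (rule comm_gam_le[OF assms(2) a1]) simp
  have a3: "a3 \<in> gam 6" unfolding a3_def by (rule comm_gam_le[OF assms(1) a1]) simp
  have [simp]: "a1 \<in> carrier G" "a2 \<in> carrier G" "a3 \<in> carrier G" using a1 a2 a3 gam_carrier by auto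
  have ac: "z \<otimes> w = w \<otimes> z" "z \<otimes> (w \<otimes> y) = w \<otimes> (z \<otimes> y)"
    if "z \<in> gam 6" "w \<in> carrier G" "y \<in> carrier G" for z w y
    using commute[OF that(1), of w 1] that gam_carrier[OF that(1)] by (simp_all flip: m_assoc)
  have mv: "u [^] n \<otimes> a1 [^] n = a3 [^] (n * n) \<otimes> (a1 [^] n \<otimes> u [^] n)" for n :: nat
  proof -
    have c: "a3 \<otimes> a1 = a1 \<otimes> a3" "a3 \<otimes> u = u \<otimes> a3" using ac(1)[OF a3 _ one_closed] by auto
    have 1: "u [^] n \<otimes> a1 = a3 [^] n \<otimes> (a1 \<otimes> u [^] n)"
      using pow_commute_comm[of a1 u n] c ac(2)[OF gam_pow[OF a3]] unfolding a3_def[symmetric] by simp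
    then have "conj_el G (u [^] n) a1 = a3 [^] n \<otimes> a1" by (simp add: conj_el_def m_assoc)
    then have "conj_el G (u [^] n) (a1 [^] n) = a3 [^] (n * n) \<otimes> a1 [^] n"
      using pow_mult_gam[OF gam_pow[OF a3] a1] by (simp add: conj_pow nat_pow_pow)
    then have "conj_el G (u [^] n) (a1 [^] n) \<otimes> u [^] n = a3 [^] (n * n) \<otimes> a1 [^] n \<otimes> u [^] n" by simp
    then show ?thesis by (simp add: conj_el_def m_assoc)
  qed
  show ?thesis
  proof (induction n)
    case (Suc n)
    have vu: "v [^] n \<otimes> u = a1 [^] n \<otimes> (a2 [^] (n choose 2) \<otimes> (u \<otimes> v [^] n))"
      using comm_swap[of "v [^] n" u] comm_pow_gam2[OF assms(1,2), of n]
      by (simp add: m_assoc a1_def a2_def)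
    have sq: "2 * (Suc n choose 3) + (Suc n choose 2) = 2 * (n choose 3) + (n choose 2) + n * n"
    proof -
      have "2 * (n choose 2) + n = n * n" by (induction n) (simp_all add: choose_Suc_numeral binomial_eq_0)
      then show ?thesis by (simp add: choose_Suc_numeral)
    qed
    have "(u \<otimes> v) [^] Suc n = a1 [^] (n choose 2) \<otimes> (a2 [^] (n choose 3) \<otimes>
      (a3 [^] (2 * (n choose 3) + (n choose 2)) \<otimes> (u [^] n \<otimes> ((v [^] n \<otimes> u) \<otimes> v))))"
      by (simp add: Suc m_assoc)
    also have "\<dots> = a1 [^] (n choose 2) \<otimes> (a2 [^] (n choose 3) \<otimes>
      (a3 [^] (2 * (n choose 3) + (n choose 2)) \<otimes> ((u [^] n \<otimes> a1 [^] n) \<otimes> (a2 [^] (n choose 2) \<otimes> (u \<otimes> (v [^] n \<otimes> v))))))"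
      unfolding vu by (simp add: m_assoc)
    also have "\<dots> = (a1 [^] (n choose 2) \<otimes> a1 [^] n) \<otimes> ((a2 [^] (n choose 3) \<otimes> a2 [^] (n choose 2)) \<otimes>
      ((a3 [^] (2 * (n choose 3) + (n choose 2)) \<otimes> a3 [^] (n * n)) \<otimes> ((u [^] n \<otimes> u) \<otimes> (v [^] n \<otimes> v))))"
      unfolding mv using a2 a3 by (simp add: m_assoc ac)
    also have "\<dots> = a1 [^] (Suc n choose 2) \<otimes> (a2 [^] (Suc n choose 3) \<otimes>
      (a3 [^] (2 * (Suc n choose 3) + (Suc n choose 2)) \<otimes> (u [^] Suc n \<otimes> v [^] Suc n)))"
      unfolding sq unfolding choose_Suc_numeral by (simp add: nat_pow_mult)
    finally show ?case .
  qed (simp add: binomial_eq_0)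
qed

section \<open>Exponents of \<open>gam 4\<close> and \<open>gam 3\<close>, and the relation for
  \<open>[x, y]^e\<close>\<close>

lemma gam4_exp: "z \<in> gam 4 \<Longrightarrow> z [^] e = \<one>"
  using central_pow_comm[of e 3 z] central gam_7 by simp

lemma gam4_pow_mod: "z \<in> gam 4 \<Longrightarrow> e dvd n \<Longrightarrow> z [^] n = \<one>"
  using gam4_exp pow_mod_exp gam_carrier by blast

text \<open>For \<open>a\<close> in \<open>gam 2\<close> the expansion of \<open>[a^e, h]\<close>
  ends with \<open>[a, [a, h]]\<close>, whose exponent \<open>e choose 2\<close> is a multiple of
  \<open>e\<close>. The same exponent occurs for products.\<close>

lemma gam3_exp: "z \<in> gam 3 \<Longrightarrow> z [^] e = \<one>"
proof -
  assume "z \<in> gam 3"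
  then have "z \<in> gam (Suc 2)" by simp
  from this pos2 show "z [^] e = \<one>"
  proof (induction rule: gam_induct)
    case (comm a h)
    have [simp]: "a \<in> carrier G" "h \<in> carrier G" using comm gam_carrier by auto
    have v: "cm a h \<in> gam 3" using comm_gam_carrier[OF comm] by simp
    have b1: "cm a (cm a h) \<in> gam 5" by (rule comm_gam_le[OF comm(1) v]) simp
    have o: "cm a (cm a (cm a h)) = \<one>" by (rule comm_trivial[OF comm(1) b1]) simp
    have o': "cm (cm a h) (cm a (cm a h)) = \<one>" by (rule comm_trivial[OF v b1]) simp
    have "cm a (cm a h) [^] (e choose 2) = \<one>"
      using gam_mono[OF b1, of 4] by (intro gam4_pow_mod odd_dvd_choose odd_e) simp
    then have "cm (a [^] e) h = cm a h [^] e" by (simp add: comm_pow_formula o o')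
    then show ?case using central[of a h] by simp
  next
    case (mult x y)
    have xy: "x \<in> gam 3" "y \<in> gam 3" using mult by simp_all
    have c: "cm y x \<in> gam 6" by (rule comm_gam_le[OF xy(2,1)]) simp
    have [simp]: "x \<in> carrier G" "y \<in> carrier G" using xy gam_carrier by auto
    have "(x \<otimes> y) [^] e = x [^] e \<otimes> (cm y x [^] (e choose 2) \<otimes> y [^] e)"
      using commute[OF c xy(1)] commute[OF c xy(2)] by (intro pow_mult_class2) auto
    moreover have "cm y x [^] (e choose 2) = \<one>"
      using gam_mono[OF c, of 4] by (intro gam4_pow_mod odd_dvd_choose odd_e) simp
    ultimately show ?case using mult by simp
  next
    case (inv x) then show ?case using gam_carrier pow_inv_one by blast
  qed simp_all
qed

lemma gam3_pow_mod: "z \<in> gam 3 \<Longrightarrow> e dvd n \<Longrightarrow> z [^] n = \<one>"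
  using gam3_exp pow_mod_exp gam_carrier by blast

definition comm_pow where "comm_pow x y = cm x y [^] e"
text \<open>The product of the two commutators that carry the exponent \<open>n choose 3\<close> in
  \<open>comm_pow_formula\<close>; likewise \<open>quintic\<close> carries
  \<open>n choose 5\<close>.\<close>

definition cubic where "cubic x y = cm x (cm x (cm x y)) \<otimes> cm (cm x y) (cm x (cm x y))"
definition quintic where "quintic x y = cm x (cm x (cm x (cm x (cm x y))))"
definition binom3 where "binom3 = e choose 3"
definition binom5 where "binom5 = e choose 5"

lemma commutator_memberships:
  assumes "x \<in> carrier G" "y \<in> carrier G"
  shows "cm x y \<in> gam 2" "cm x (cm x y) \<in> gam 3" "cm x (cm x (cm x y)) \<in> gam 4"
    "cm x (cm x (cm x (cm x y))) \<in> gam 5" "quintic x y \<in> gam 6"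
    "cm (cm x y) (cm x (cm x y)) \<in> gam 5" "cubic x y \<in> gam 4"
proof -
  have x1: "x \<in> gam 1" "y \<in> gam 1" using assms by simp_all
  show v: "cm x y \<in> gam 2" by (rule comm_gam_le[OF x1]) simp
  show b1: "cm x (cm x y) \<in> gam 3" by (rule comm_gam_le[OF x1(1) v]) simp
  show b2: "cm x (cm x (cm x y)) \<in> gam 4" by (rule comm_gam_le[OF x1(1) b1]) simp
  show b3: "cm x (cm x (cm x (cm x y))) \<in> gam 5" by (rule comm_gam_le[OF x1(1) b2]) simp
  show b4: "quintic x y \<in> gam 6" unfolding quintic_def by (rule comm_gam_le[OF x1(1) b3]) simp
  show q1: "cm (cm x y) (cm x (cm x y)) \<in> gam 5" by (rule comm_gam_le[OF v b1]) simp
  show "cubic x y \<in> gam 4" unfolding cubic_def using b2 gam_mono[OF q1, of 4] by simp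
qed

lemma comm_pow_relation:
  assumes [simp]: "x \<in> carrier G" "y \<in> carrier G"
  shows "cubic x y [^] binom3 \<otimes> quintic x y [^] binom5 \<otimes> comm_pow x y = \<one>"
proof -
  note m = commutator_memberships[OF assms]
  have m4: "cm x (cm x (cm x (cm x y))) \<in> gam 4" using m(4) gam_mono by force
  have m6: "cm (cm x y) (cm x (cm x (cm x y))) \<in> gam 4"
    by (rule comm_gam_le[OF m(1,3)]) simp
  have o: "cm x (cm x y) [^] (e choose 2) = \<one>" "cm x (cm x (cm x (cm x y))) [^] (e choose 4) = \<one>"
    "cm (cm x y) (cm x (cm x (cm x y))) [^] (e choose 4) = \<one>"
    using gam3_pow_mod[OF m(2)] gam4_pow_mod[OF m4] gam4_pow_mod[OF m6] odd_dvd_choose[OF odd_e] by auto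
  have "cm (x [^] e) y = cm x (cm x (cm x y)) [^] binom3 \<otimes> (quintic x y [^] binom5 \<otimes> (cm (cm x y) (cm x (cm x y)) [^] binom3 \<otimes> comm_pow x y))"
    by (subst comm_pow_formula) (simp_all add: o quintic_def binom3_def binom5_def comm_pow_def)
  then have 1: "cm x (cm x (cm x y)) [^] binom3 \<otimes> (quintic x y [^] binom5 \<otimes> (cm (cm x y) (cm x (cm x y)) [^] binom3 \<otimes> comm_pow x y)) = \<one>"
    using central[of x y] by simp
  have "quintic x y [^] binom5 \<otimes> cm (cm x y) (cm x (cm x y)) [^] binom3 = cm (cm x y) (cm x (cm x y)) [^] binom3 \<otimes> quintic x y [^] binom5"
    using m by (intro commute[OF gam_pow gam_pow]) auto
  moreover have "cubic x y [^] binom3 = cm x (cm x (cm x y)) [^] binom3 \<otimes> cm (cm x y) (cm x (cm x y)) [^] binom3"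
    unfolding cubic_def using m by (intro pow_mult_gam) auto
  moreover have "quintic x y \<in> carrier G" "comm_pow x y \<in> carrier G" unfolding quintic_def comm_pow_def by simp_all
  ultimately show ?thesis using 1 by (simp add: m_assoc) (simp flip: m_assoc)
qed

lemma comm_pow_eq:
  assumes [simp]: "x \<in> carrier G" "y \<in> carrier G"
  shows "comm_pow x y = inv (cubic x y) [^] binom3 \<otimes> inv (quintic x y) [^] binom5" "comm_pow x y \<in> gam 4"
proof -
  note m = commutator_memberships[OF assms]
  have [simp]: "cubic x y \<in> carrier G" "quintic x y \<in> carrier G" "comm_pow x y \<in> carrier G"
    using m gam_carrier unfolding comm_pow_def by auto
  have "comm_pow x y = inv (cubic x y [^] binom3 \<otimes> quintic x y [^] binom5)"
    using comm_pow_relation[OF assms] by (metis inv_equality inv_inv m_closed nat_pow_closed \<open>cubic x y \<in> carrier G\<close> \<open>quintic x y \<in> carrier G\<close> \<open>comm_pow x y \<in> carrier G\<close>)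
  also have "\<dots> = inv (quintic x y [^] binom5 \<otimes> cubic x y [^] binom3)"
    using commute[OF gam_pow gam_pow, OF m(5) m(7), of binom5 binom3] by simp
  finally show e: "comm_pow x y = inv (cubic x y) [^] binom3 \<otimes> inv (quintic x y) [^] binom5"
    by (simp add: inv_mult_group nat_pow_inv)
  show "comm_pow x y \<in> gam 4" unfolding e using m gam_mono[OF m(5), of 4] by simp
qed

text \<open>The tenth power kills the part of exponent 5, the 21st power the part of exponent 3, and
  \<open>21 - 2 * 10 = 1\<close>.\<close>

lemma comm_pow_tenth:
  assumes [simp]: "x \<in> carrier G" "y \<in> carrier G"
  shows "comm_pow x y [^] (10::nat) = inv (cubic x y) [^] (10 * binom3)"
proof -
  note m = commutator_memberships[OF assms]
  have [simp]: "cubic x y \<in> carrier G" "quintic x y \<in> carrier G"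
    using m gam_carrier by auto
  have d: "e dvd 10 * binom5" using dvd_mult[OF odd_dvd_choose(4)[OF odd_e], of 2] unfolding binom5_def by simp
  have "comm_pow x y [^] (10::nat) = (inv (cubic x y) [^] binom3) [^] (10::nat) \<otimes> (inv (quintic x y) [^] binom5) [^] (10::nat)"
    unfolding comm_pow_eq[OF assms] using m by (intro pow_mult_gam[OF gam_pow gam_pow] gam_inv) auto
  also have "(inv (quintic x y) [^] binom5) [^] (10::nat) = \<one>"
    using gam4_pow_mod[of "inv (quintic x y)" "10 * binom5"] d gam_mono[OF m(5), of 4] by (simp add: nat_pow_pow mult.commute)
  finally show ?thesis by (simp add: nat_pow_pow mult.commute)
qed

lemma comm_pow_21st:
  assumes [simp]: "x \<in> carrier G" "y \<in> carrier G"
  shows "comm_pow x y [^] (21::nat) = inv (quintic x y) [^] (21 * binom5)"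
proof -
  note m = commutator_memberships[OF assms]
  have [simp]: "cubic x y \<in> carrier G" "quintic x y \<in> carrier G"
    using m gam_carrier by auto
  have d: "e dvd 21 * binom3" using dvd_mult[OF odd_dvd_choose(3)[OF odd_e], of 7] unfolding binom3_def by simp
  have "comm_pow x y [^] (21::nat) = (inv (cubic x y) [^] binom3) [^] (21::nat) \<otimes> (inv (quintic x y) [^] binom5) [^] (21::nat)"
    unfolding comm_pow_eq[OF assms] using m by (intro pow_mult_gam[OF gam_pow gam_pow] gam_inv) auto
  also have "(inv (cubic x y) [^] binom3) [^] (21::nat) = \<one>"
    using gam4_pow_mod[of "inv (cubic x y)" "21 * binom3"] d m(7) by (simp add: nat_pow_pow mult.commute)
  finally show ?thesis by (simp add: nat_pow_pow mult.commute)
qed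

text \<open>Oddness kills the exponents \<open>e choose 2\<close>. What is left is a
  \<open>binom3\<close>-th power from \<open>gam 6\<close>, bundled into one \<open>z\<close> so
  that \<open>gam6_binom3\<close> can remove it later.\<close>

lemma pow_mult_gam2:
  assumes "u \<in> gam 2" "v \<in> gam 2"
  obtains z where "z \<in> gam 6" "(u \<otimes> v) [^] e = z [^] binom3 \<otimes> (u [^] e \<otimes> v [^] e)"
proof -
  let ?a1 = "cm v u"
  have [simp]: "u \<in> carrier G" "v \<in> carrier G" using assms gam_carrier by auto
  have a1: "?a1 \<in> gam 4" by (rule comm_gam_le[OF assms(2,1)]) simp
  have a2: "cm v ?a1 \<in> gam 6" by (rule comm_gam_le[OF assms(2) a1]) simp
  have a3: "cm u ?a1 \<in> gam 6" by (rule comm_gam_le[OF assms(1) a1]) simp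
  have 1: "?a1 [^] (e choose 2) = \<one>" "cm u ?a1 [^] (e choose 2) = \<one>"
    using gam4_pow_mod[OF a1] gam4_pow_mod[OF gam_mono[OF a3, of 4]] odd_dvd_choose[OF odd_e] by auto
  define z where "z = cm v ?a1 \<otimes> cm u ?a1 [^] (2::nat)"
  show ?thesis
  proof
    show "z \<in> gam 6" using a2 a3 by (simp add: z_def)
    have "z [^] binom3 = cm v ?a1 [^] binom3 \<otimes> (cm u ?a1 [^] (2::nat)) [^] binom3"
      unfolding z_def by (rule pow_mult_gam[OF a2 gam_pow[OF a3]]) simp
    then show "(u \<otimes> v) [^] e = z [^] binom3 \<otimes> (u [^] e \<otimes> v [^] e)"
      using pow_mult_gam2_formula[OF assms, of e] 1
      by (simp add: binom3_def nat_pow_pow m_assoc flip: nat_pow_mult)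
  qed
qed

text \<open>Replacing \<open>x\<close> by \<open>x \<otimes> a\<close> multiplies the commutator by
  an element of \<open>gam 3\<close>, whose \<open>e\<close>-th power is trivial. This invariance
  later isolates the weight-five terms linear in \<open>a\<close>.\<close>

lemma comm_pow_mult_gam2:
  assumes [simp]: "x \<in> carrier G" "y \<in> carrier G" and a: "a \<in> gam 2"
  shows "comm_pow (x \<otimes> a) y = comm_pow x y"
proof -
  have [simp]: "a \<in> carrier G" using a gam_carrier by auto
  let ?r = "conj_el G x (cm a y)" and ?v = "cm x y"
  have r: "?r \<in> gam 3" using comm_gam_le[of a 2 y 1 3] a by simp
  have v: "?v \<in> gam 2" by (rule commutator_memberships) simp_all
  have c: "cm ?v ?r \<in> gam 5" by (rule comm_gam_le[OF v r]) simp
  have "(?r \<otimes> ?v) [^] e = ?r [^] e \<otimes> (cm ?v ?r [^] (e choose 2) \<otimes> ?v [^] e)"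
    using commute[OF c r] commute[OF c v] by (intro pow_mult_class2) auto
  moreover have "cm ?v ?r [^] (e choose 2) = \<one>"
    using gam_mono[OF c, of 4] by (intro gam4_pow_mod odd_dvd_choose odd_e) simp
  ultimately show ?thesis using gam3_exp[OF r] by (simp add: comm_pow_def comm_mult_left)
qed

lemma cubic_mult_gam2:
  assumes "x \<in> carrier G" "y \<in> carrier G" "a \<in> gam 2"
  shows "cubic (x \<otimes> a) y [^] (10 * binom3) = cubic x y [^] (10 * binom3)"
proof -
  have "x \<otimes> a \<in> carrier G" using assms gam_carrier by auto
  then have "inv (cubic (x \<otimes> a) y [^] (10 * binom3)) = inv (cubic x y [^] (10 * binom3))"
    using comm_pow_tenth[of "x \<otimes> a" y] comm_pow_tenth[of x y] comm_pow_mult_gam2[of x y a] assms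
      commutator_memberships(7)[of x y] commutator_memberships(7)[of "x \<otimes> a" y] gam_carrier
    by (simp add: nat_pow_inv)
  then show ?thesis
    using commutator_memberships(7)[of x y] commutator_memberships(7)[of "x \<otimes> a" y] gam_carrier assms
    by (metis inv_inv nat_pow_closed m_closed)
qed

end

section \<open>Multilinear maps on the lower central quotients\<close>

context class6
begin

lemma gam4_commute: "\<lbrakk>x \<in> gam 4; y \<in> gam 4\<rbrakk> \<Longrightarrow> x \<otimes> y = y \<otimes> x"
  using commute[of x 4 y 4] by simp

lemma gam4_left_commute: "\<lbrakk>x \<in> gam 4; y \<in> gam 4; z \<in> gam 4\<rbrakk> \<Longrightarrow> x \<otimes> (y \<otimes> z) = y \<otimes> (x \<otimes> z)"
  using gam4_commute gam_carrier by (metis m_assoc)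

lemma gam4_assoc: "\<lbrakk>x \<in> gam 4; y \<in> gam 4; z \<in> gam 4\<rbrakk> \<Longrightarrow> x \<otimes> y \<otimes> z = x \<otimes> (y \<otimes> z)"
  using gam_carrier by (intro m_assoc)

lemma gam4_inv_mult: "\<lbrakk>x \<in> gam 4; y \<in> gam 4\<rbrakk> \<Longrightarrow> inv (x \<otimes> y) = inv x \<otimes> inv y"
  using gam4_commute gam_carrier by (metis gam_inv inv_mult_group)

lemma gam4_pow_mult: "\<lbrakk>x \<in> gam 4; y \<in> gam 4\<rbrakk> \<Longrightarrow> (x \<otimes> y) [^] (n::nat) = x [^] n \<otimes> y [^] n"
  using pow_mult_gam[of x 4 y 4] by simp

lemmas gam4_ac = gam4_assoc gam4_commute gam4_left_commute

text \<open>A homomorphism \<open>\<Gamma>\<^sub>k / \<Gamma>\<^sub>k\<^sub>+\<^sub>1 \<rightarrow> \<Gamma>\<^sub>4\<close>; composing it with brackets gives multilinear maps on the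
  associated graded Lie ring, without constructing that ring.\<close>

definition graded_hom where
  "graded_hom k f \<longleftrightarrow> (\<forall>m\<in>gam k. f m \<in> gam 4) \<and>
     (\<forall>m\<in>gam k. \<forall>n\<in>gam k. f (m \<otimes> n) = f m \<otimes> f n) \<and> (\<forall>m\<in>gam (Suc k). f m = \<one>)"

lemma graded_hom_gam4: "\<lbrakk>graded_hom k f; m \<in> gam k\<rbrakk> \<Longrightarrow> f m \<in> gam 4"
  and graded_hom_mult: "\<lbrakk>graded_hom k f; m \<in> gam k; n \<in> gam k\<rbrakk> \<Longrightarrow> f (m \<otimes> n) = f m \<otimes> f n"
  and graded_hom_kill: "\<lbrakk>graded_hom k f; m \<in> gam (Suc k)\<rbrakk> \<Longrightarrow> f m = \<one>"
  by (auto simp: graded_hom_def)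

lemma graded_hom_one: "graded_hom k f \<Longrightarrow> f \<one> = \<one>"
  by (rule graded_hom_kill) simp_all

lemma graded_hom_inv:
  assumes "graded_hom k f" "m \<in> gam k"
  shows "f (inv m) = inv (f m)"
proof -
  have [simp]: "m \<in> carrier G" "f m \<in> carrier G" "f (inv m) \<in> carrier G"
    using assms graded_hom_gam4 gam_carrier gam_inv by blast+
  have "f (inv m) \<otimes> f m = \<one>"
    using graded_hom_mult[OF assms(1) gam_inv[OF assms(2)] assms(2)] graded_hom_one[OF assms(1)] by simp
  then show ?thesis by (simp add: inv_equality)
qed

lemma graded_hom_pow:
  assumes "graded_hom k f" "m \<in> gam k"
  shows "f (m [^] (n::nat)) = f m [^] n"
  using assms by (induction n) (simp_all add: graded_hom_one graded_hom_mult)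

lemma graded_hom_conj:
  assumes "graded_hom k f" "m \<in> gam k" "x \<in> carrier G"
  shows "f (conj_el G x m) = f m"
proof -
  have c: "cm x m \<in> gam (Suc k)" using comm_gam_le[of x 1 m k] assms by simp
  then have "cm x m \<in> gam k" using gam_mono[of _ "Suc k" k] by simp
  then have "f (cm x m \<otimes> m) = f m"
    using graded_hom_mult[OF assms(1) _ assms(2)] graded_hom_kill[OF assms(1) c]
      graded_hom_gam4[OF assms(1,2), THEN gam_carrier] by simp
  then show ?thesis using conj_eq_comm assms gam_carrier by simp
qed

text \<open>A commutator is multiplicative in its second entry up to a conjugation, which
  \<open>f\<close> does not see by \<open>graded_hom_conj\<close>.\<close>

lemma graded_hom_comm_right:
  assumes f: "graded_hom n f" and x: "x \<in> gam i" and n: "n = i + j"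
  shows "graded_hom j (\<lambda>y. f (cm x y))"
  unfolding graded_hom_def
proof (intro conjI ballI)
  have c [simp]: "x \<in> carrier G" using x gam_carrier by auto
  show "f (cm x m) \<in> gam 4" if "m \<in> gam j" for m
    using comm_gam[OF x that] graded_hom_gam4[OF f] n by simp
  show "f (cm x m) = \<one>" if "m \<in> gam (Suc j)" for m
    using comm_gam[OF x that] graded_hom_kill[OF f] n by simp
  show "f (cm x (m \<otimes> m')) = f (cm x m) \<otimes> f (cm x m')" if "m \<in> gam j" "m' \<in> gam j" for m m'
    using that[THEN gam_carrier] comm_gam[OF x that(1)] comm_gam[OF x that(2)] n
    by (simp add: comm_mult_right graded_hom_mult[OF f] graded_hom_conj[OF f])
qed

lemma graded_hom_comm_left:
  assumes f: "graded_hom n f" and y: "y \<in> gam j" and n: "n = i + j"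
  shows "graded_hom i (\<lambda>x. f (cm x y))"
  unfolding graded_hom_def
proof (intro conjI ballI)
  have c [simp]: "y \<in> carrier G" using y gam_carrier by auto
  show "f (cm m y) \<in> gam 4" if "m \<in> gam i" for m
    using comm_gam[OF that y] graded_hom_gam4[OF f] n by simp
  show "f (cm m y) = \<one>" if "m \<in> gam (Suc i)" for m
    using comm_gam[OF that y] graded_hom_kill[OF f] n by simp
  show "f (cm (m \<otimes> m') y) = f (cm m y) \<otimes> f (cm m' y)" if "m \<in> gam i" "m' \<in> gam i" for m m'
    using that[THEN gam_carrier] comm_gam[OF that(1) y] comm_gam[OF that(2) y] n
      gam4_commute[OF graded_hom_gam4[OF f] graded_hom_gam4[OF f]]
    by (simp add: comm_mult_left graded_hom_mult[OF f] graded_hom_conj[OF f])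
qed

lemma graded_hom_antisym:
  assumes f: "graded_hom n f" and xy: "x \<in> gam i" "y \<in> gam j" and n: "n = i + j"
  shows "f (cm y x) = inv (f (cm x y))"
  using graded_hom_inv[OF f, of "cm x y"] comm_gam[OF xy] n xy[THEN gam_carrier] by (simp add: inv_comm)

text \<open>The Hall-Witt identity, with its conjugations invisible to \<open>f\<close>.\<close>

lemma graded_hom_Jacobi:
  assumes f: "graded_hom n f" and x: "x \<in> gam i" and y: "y \<in> gam j" and z: "z \<in> gam k" and n: "n = i + j + k"
  shows "f (cm (cm x y) z) = f (cm x (cm y z)) \<otimes> inv (f (cm y (cm x z)))"
proof -
  have [simp]: "x \<in> carrier G" "y \<in> carrier G" "z \<in> carrier G" using x y z gam_carrier by auto
  have m: "cm x y \<in> gam (i + j)" "cm y z \<in> gam (j + k)" "cm z x \<in> gam (k + i)" "cm x z \<in> gam (i + k)"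
    using comm_gam x y z by blast+
  have 1: "f (cm (cm x y) (conj_el G y z)) = f (cm (cm x y) z)"
    using graded_hom_conj[OF graded_hom_comm_right[OF f m(1)] z] n by simp
  have 2: "f (cm (cm y z) (conj_el G z x)) = f (cm (cm y z) x)"
    using graded_hom_conj[OF graded_hom_comm_right[OF f m(2)] x] n by simp
  have 3: "f (cm (cm z x) (conj_el G x y)) = f (cm (cm z x) y)"
    using graded_hom_conj[OF graded_hom_comm_right[OF f m(3)] y] n by simp
  have h: "cm (cm x y) (conj_el G y z) \<in> gam n" "cm (cm y z) (conj_el G z x) \<in> gam n"
    "cm (cm z x) (conj_el G x y) \<in> gam n"
    using comm_gam_le[OF m(1) conj_gam[OF _ z]] comm_gam_le[OF m(2) conj_gam[OF _ x]]
      comm_gam_le[OF m(3) conj_gam[OF _ y]] n by simp_all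
  have sum: "f (cm (cm x y) z) \<otimes> f (cm (cm y z) x) \<otimes> f (cm (cm z x) y) = \<one>"
    using arg_cong[OF Hall_Witt[of x y z], of f] h graded_hom_one[OF f]
    by (simp add: graded_hom_mult[OF f] 1 2 3)
  have a: "f (cm (cm y z) x) = inv (f (cm x (cm y z)))"
    using graded_hom_antisym[OF f x m(2)] n by simp
  have [simp]: "f (cm (cm x y) z) \<in> carrier G" "f (cm x (cm y z)) \<in> carrier G" "f (cm y (cm x z)) \<in> carrier G"
    using comm_gam[OF m(1) z] comm_gam[OF x m(2)] comm_gam[OF y m(4)] graded_hom_gam4[OF f] n gam_carrier
    by (auto simp: add_ac)
  have b: "f (cm (cm z x) y) = f (cm y (cm x z))"
    using graded_hom_antisym[OF f y m(3)] graded_hom_antisym[OF graded_hom_comm_right[OF f y] x z, of "i + k"] n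
    by (simp add: add_ac)
  have s': "f (cm (cm x y) z) \<otimes> (inv (f (cm x (cm y z))) \<otimes> f (cm y (cm x z))) = \<one>"
    using sum by (simp add: a b m_assoc)
  have g4: "f (cm x (cm y z)) \<in> gam 4" "f (cm y (cm x z)) \<in> gam 4"
    using comm_gam[OF x m(2)] comm_gam[OF y m(4)] graded_hom_gam4[OF f] n by (simp_all add: add_ac)
  have "f (cm (cm x y) z) = inv (inv (f (cm x (cm y z))) \<otimes> f (cm y (cm x z)))"
    using inv_equality[OF s'] by simp
  also have "\<dots> = f (cm x (cm y z)) \<otimes> inv (f (cm y (cm x z)))"
    using g4 by (simp add: gam4_inv_mult)
  finally show ?thesis .
qed

text \<open>Commutators generate \<open>gam (Suc k)\<close>. Applied weight by weight, this passes
  from left-normed commutators of group elements to all of a lower central term.\<close>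

lemma graded_hom_vanish:
  assumes f: "graded_hom (Suc k) f" and "k > 0"
    and "\<And>m w. m \<in> gam k \<Longrightarrow> w \<in> carrier G \<Longrightarrow> f (cm m w) = \<one>"
    and "z \<in> gam (Suc k)"
  shows "f z = \<one>"
  using assms(4,2)
proof (induction rule: gam_induct)
  case (mult x y) then show ?case by (simp add: graded_hom_mult[OF f])
next
  case (inv x) then show ?case by (simp add: graded_hom_inv[OF f])
qed (use assms graded_hom_one[OF f] in simp_all)

text \<open>Three uses of the Jacobi identity. If the values have order dividing 3, the exponent -2
  of the middle term acts as 1, and the right side runs over the three positions of \<open>a\<close>
  among two entries \<open>z\<close>.\<close>

lemma graded_hom_double_bracket:
  assumes f: "graded_hom n f" and a: "a \<in> gam i" and zy: "z \<in> carrier G" "y \<in> carrier G" and n: "n = i + 3"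
  shows "f (cm (cm (cm a z) z) y) = f (cm a (cm z (cm z y))) \<otimes> 
    (inv (f (cm z (cm a (cm z y)))) [^] (2::nat) \<otimes> f (cm z (cm z (cm a y))))"
proof -
  have zy1: "z \<in> gam 1" "y \<in> gam 1" using zy by simp_all
  have m: "cm a z \<in> gam (i + 1)" "cm z y \<in> gam (1 + 1)" using comm_gam a zy1 by blast+
  have g: "graded_hom (i + 2) (\<lambda>m. f (cm z m))" by (rule graded_hom_comm_right[OF f zy1(1)]) (simp add: n)
  have 1: "f (cm (cm (cm a z) z) y) = f (cm (cm a z) (cm z y)) \<otimes> inv (f (cm z (cm (cm a z) y)))"
    by (rule graded_hom_Jacobi[OF f m(1) zy1]) (simp add: n)
  have 2: "f (cm (cm a z) (cm z y)) = f (cm a (cm z (cm z y))) \<otimes> inv (f (cm z (cm a (cm z y))))"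
    by (rule graded_hom_Jacobi[OF f a zy1(1) m(2)]) (simp add: n)
  have 3: "f (cm z (cm (cm a z) y)) = f (cm z (cm a (cm z y))) \<otimes> inv (f (cm z (cm z (cm a y))))"
    by (rule graded_hom_Jacobi[OF g a zy1]) simp
  have "cm a (cm z (cm z y)) \<in> gam n" "cm z (cm a (cm z y)) \<in> gam n" "cm z (cm z (cm a y)) \<in> gam n"
    using comm_gam[OF a comm_gam[OF zy1(1) m(2)]] comm_gam[OF zy1(1) comm_gam[OF a m(2)]]
      comm_gam[OF zy1(1) comm_gam[OF zy1(1) comm_gam[OF a zy1(2)]]] n by (simp_all add: numeral_3_eq_3)
  then have c: "f (cm a (cm z (cm z y))) \<in> gam 4" "f (cm z (cm a (cm z y))) \<in> gam 4" "f (cm z (cm z (cm a y))) \<in> gam 4"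
    using graded_hom_gam4[OF f] by auto
  note [simp] = c c[THEN gam_carrier]
  show ?thesis unfolding 1 2 3 by (simp add: gam4_inv_mult gam4_ac numeral_2_eq_2)
qed

lemma graded_hom_alternating:
  assumes f: "\<And>y. y \<in> carrier G \<Longrightarrow> graded_hom 1 (\<lambda>x. B x y)" "\<And>x. x \<in> carrier G \<Longrightarrow> graded_hom 1 (B x)"
    and alt: "\<And>x. x \<in> carrier G \<Longrightarrow> B x x = \<one>" and x: "x \<in> carrier G" and y: "y \<in> carrier G"
  shows "B x y = inv (B y x)"
proof -
  have [simp]: "B x y \<in> carrier G" "B y x \<in> carrier G"
    using x y f graded_hom_gam4[of 1] gam_carrier[of _ 4] by auto
  have "B (x \<otimes> y) (x \<otimes> y) = (B x x \<otimes> B y x) \<otimes> (B x y \<otimes> B y y)"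
    using x y graded_hom_mult[OF f(1)] graded_hom_mult[OF f(2)] by simp
  then have "B y x \<otimes> B x y = \<one>" using alt x y by simp
  then have "inv (B x y) = B y x" by (simp add: inv_equality)
  then show ?thesis by (metis \<open>B x y \<in> carrier G\<close> inv_inv)
qed

text \<open>Since 10 is 1 modulo 3 and 21 is 1 modulo 5, on \<open>gam 4\<close> the power
  \<open>tau\<close> agrees with \<open>binom3\<close> and \<open>sigma\<close> with
  \<open>binom5\<close>.\<close>

abbreviation tau :: nat where "tau \<equiv> 10 * binom3"
abbreviation sigma :: nat where "sigma \<equiv> 21 * binom5"

lemma e_dvd_tau: "e dvd 3 * tau"
  using dvd_mult[OF odd_dvd_choose(3)[OF odd_e], of 10] by (simp add: binom3_def)

lemma e_dvd_sigma: "e dvd 5 * sigma"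
  using dvd_mult[OF odd_dvd_choose(4)[OF odd_e], of 21] by (simp add: binom5_def)

lemma graded_hom_pow_map:
  assumes "k \<ge> 4" "\<And>m. m \<in> gam (Suc k) \<Longrightarrow> m [^] (n::nat) = \<one>"
  shows "graded_hom k (\<lambda>m. m [^] n)"
  unfolding graded_hom_def using assms gam4_pow_mult gam_mono[of _ k 4] by simp

lemma tau_cube: "m \<in> gam 4 \<Longrightarrow> (m [^] tau) [^] (3::nat) = \<one>"
  using gam4_pow_mod[of m "3 * tau"] e_dvd_tau gam_carrier by (simp add: nat_pow_pow mult.commute)

section \<open>Characteristic 3: the cubic part\<close>

lemma comm_pow_mult:
  assumes xz: "x \<in> carrier G" "z \<in> carrier G" and y: "y \<in> carrier G"
  obtains w where "w \<in> gam 6" "comm_pow (x \<otimes> z) y = w [^] binom3 \<otimes> (conj_el G x (comm_pow z y) \<otimes> comm_pow x y)"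
proof -
  note [simp] = xz y
  obtain w where w: "w \<in> gam 6" "(conj_el G x (cm z y) \<otimes> cm x y) [^] e =
      w [^] binom3 \<otimes> (conj_el G x (cm z y) [^] e \<otimes> cm x y [^] e)"
    using pow_mult_gam2[of "conj_el G x (cm z y)" "cm x y"] commutator_memberships(1)[of z y]
      commutator_memberships(1)[of x y] by auto
  then show ?thesis using that by (simp add: comm_pow_def comm_mult_left conj_pow)
qed

lemma triple_bracket_homs:
  assumes f: "graded_hom 4 f" and [simp]: "a \<in> carrier G" "b \<in> carrier G" "c \<in> carrier G" "y \<in> carrier G"
  shows "graded_hom 1 (\<lambda>a. f (cm a (cm b (cm c y))))" "graded_hom 1 (\<lambda>b. f (cm a (cm b (cm c y))))"
    "graded_hom 1 (\<lambda>c. f (cm a (cm b (cm c y))))"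
proof -
  have 1: "a \<in> gam 1" "b \<in> gam 1" "c \<in> gam 1" "y \<in> gam 1" by simp_all
  have m: "cm c y \<in> gam 2" "cm b (cm c y) \<in> gam 3"
    using comm_gam_le[OF 1(3,4)] comm_gam_le[OF 1(2) comm_gam[OF 1(3,4)]] by simp_all
  show "graded_hom 1 (\<lambda>a. f (cm a (cm b (cm c y))))" by (rule graded_hom_comm_left[OF f m(2)]) simp
  have g: "graded_hom 3 (\<lambda>m. f (cm a m))" by (rule graded_hom_comm_right[OF f 1(1)]) simp
  show "graded_hom 1 (\<lambda>b. f (cm a (cm b (cm c y))))" by (rule graded_hom_comm_left[OF g m(1)]) simp
  have h: "graded_hom 2 (\<lambda>m. f (cm a (cm b m)))" by (rule graded_hom_comm_right[OF g 1(2)]) simp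
  show "graded_hom 1 (\<lambda>c. f (cm a (cm b (cm c y))))" by (rule graded_hom_comm_left[OF h 1(4)]) simp
qed

text \<open>The cubic form \<open>x \<mapsto> cubic x y [^] tau\<close> is additive, and comparing its values at \<open>x \<otimes> z\<close> and
  \<open>x \<otimes> inv z\<close> isolates the part that is quadratic in \<open>z\<close>.\<close>

lemma tau_gam4:
  assumes g5: "\<And>m. m \<in> gam 5 \<Longrightarrow> m [^] tau = \<one>"
    and [simp]: "x \<in> carrier G" "z \<in> carrier G" "y \<in> carrier G"
  shows "cm (cm (cm x z) z) y [^] tau = \<one>"
proof -
  define f where "f m = m [^] tau" for m
  have f: "graded_hom 4 f" unfolding f_def by (rule graded_hom_pow_map) (simp_all add: g5)
  define F where "F a b c = f (cm a (cm b (cm c y)))" for a b c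
  have F4: "F a b c \<in> gam 4" if "a \<in> carrier G" "b \<in> carrier G" "c \<in> carrier G" for a b c
    unfolding F_def using graded_hom_gam4[OF triple_bracket_homs(1)[OF f]] that by simp
  have FC: "F a b c \<in> carrier G" if "a \<in> carrier G" "b \<in> carrier G" "c \<in> carrier G" for a b c
    using F4[OF that] gam_carrier by blast
  have Fm: "F (a \<otimes> a') b c = F a b c \<otimes> F a' b c" "F b (a \<otimes> a') c = F b a c \<otimes> F b a' c"
      "F b c (a \<otimes> a') = F b c a \<otimes> F b c a'"
    if "a \<in> carrier G" "a' \<in> carrier G" "b \<in> carrier G" "c \<in> carrier G" for a a' b c
    unfolding F_def using that graded_hom_mult[OF triple_bracket_homs(1)[OF f]]
      graded_hom_mult[OF triple_bracket_homs(2)[OF f]] graded_hom_mult[OF triple_bracket_homs(3)[OF f]] by simp_all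
  have Fi: "F (inv a) b c = inv (F a b c)" "F b (inv a) c = inv (F b a c)" "F b c (inv a) = inv (F b c a)"
    if "a \<in> carrier G" "b \<in> carrier G" "c \<in> carrier G" for a b c
    unfolding F_def using that graded_hom_inv[OF triple_bracket_homs(1)[OF f]]
      graded_hom_inv[OF triple_bracket_homs(2)[OF f]] graded_hom_inv[OF triple_bracket_homs(3)[OF f]] by simp_all
  have F3: "F a b c \<otimes> (F a b c \<otimes> F a b c) = \<one>" if "a \<in> carrier G" "b \<in> carrier G" "c \<in> carrier G" for a b c
  proof -
    have "cm a (cm b (cm c y)) \<in> gam 4"
      using comm_gam_le[of a 1 "cm b (cm c y)" 3] comm_gam_le[of b 1 "cm c y" 2] comm_gam_le[of c 1 y 1] that by simp
    from tau_cube[OF this] show ?thesis using that unfolding F_def f_def by (simp add: numeral_3_eq_3 m_assoc)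
  qed
  have cubic: "cubic a y [^] tau = F a a a" if [simp]: "a \<in> carrier G" for a
  proof -
    note m = commutator_memberships[of a y]
    have "f (cubic a y) = f (cm a (cm a (cm a y))) \<otimes> f (cm (cm a y) (cm a (cm a y)))"
      unfolding cubic_def by (rule graded_hom_mult[OF f]) (use m gam_mono[of _ 5 4] in simp_all)
    also have "f (cm (cm a y) (cm a (cm a y))) = \<one>" using m(6) g5 by (simp add: f_def)
    finally show ?thesis by (simp add: f_def F_def)
  qed
  \<comment> \<open>\<open>[a \<otimes> b, y]^e\<close> splits into the two \<open>e\<close>-th
    powers up to a factor \<open>w [^] binom3\<close>. Its tenth power is a \<open>tau\<close>-th
    power of an element of \<open>gam 6\<close>, hence trivial by \<open>g5\<close>.\<close>
  have add: "F (a \<otimes> b) (a \<otimes> b) (a \<otimes> b) = F a a a \<otimes> F b b b" if ab [simp]: "a \<in> carrier G" "b \<in> carrier G" for a b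
  proof -
    have P: "comm_pow c y [^] (10::nat) = inv (F c c c)" "comm_pow c y \<in> gam 4" if "c \<in> carrier G" for c
      using comm_pow_tenth[OF that \<open>y \<in> carrier G\<close>] comm_pow_eq(2) that cubic[OF that] commutator_memberships(7)[of c y] gam_carrier
      by (simp_all add: nat_pow_inv)
    obtain w where w: "w \<in> gam 6" "comm_pow (a \<otimes> b) y = w [^] binom3 \<otimes> (conj_el G a (comm_pow b y) \<otimes> comm_pow a y)"
      using comm_pow_mult[of a b y] by auto
    have w4: "w [^] binom3 \<in> gam 4" and w1: "(w [^] binom3) [^] (10::nat) = \<one>"
      using w(1) gam_mono[OF w(1), of 4] gam_mono[OF w(1), of 5] g5[of w] gam_carrier[OF w(1)]
      by (simp_all add: nat_pow_pow mult.commute)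
    have "conj_el G a (comm_pow b y) [^] (10::nat) = conj_el G a (inv (cubic b y) [^] tau)"
      using comm_pow_tenth[of b y] by (simp add: comm_pow_def conj_pow[symmetric])
    also have "\<dots> = f (conj_el G a (inv (cubic b y)))"
      using commutator_memberships(7)[of b y] gam_carrier by (simp add: f_def conj_pow)
    also have "\<dots> = f (inv (cubic b y))"
      using commutator_memberships(7)[of b y] by (intro graded_hom_conj[OF f]) auto
    also have "\<dots> = inv (F b b b)"
      using commutator_memberships(7)[of b y] graded_hom_inv[OF f] cubic by (simp add: f_def)
    finally have c: "conj_el G a (comm_pow b y) [^] (10::nat) = inv (F b b b)" .
    have "inv (F (a \<otimes> b) (a \<otimes> b) (a \<otimes> b)) = inv (F b b b) \<otimes> inv (F a a a)"
      using P(1)[of "a \<otimes> b"] w(2) w4 w1 c P FC by (simp add: gam4_pow_mult)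
    also have "\<dots> = inv (F a a a \<otimes> F b b b)" using FC by (simp add: inv_mult_group)
    finally show ?thesis by (rule inj_onD[OF inv_inj]) (simp_all add: FC)
  qed
  \<comment> \<open>\<open>S1\<close> and \<open>S2\<close> are the mixed terms linear and quadratic
    in \<open>z\<close>; inverting \<open>z\<close> changes the sign of \<open>S1\<close>
    only.\<close>
  define S1 where "S1 = F z x x \<otimes> (F x z x \<otimes> F x x z)"
  define S2 where "S2 = F x z z \<otimes> (F z x z \<otimes> F z z x)"
  have S4: "S1 \<in> gam 4" "S2 \<in> gam 4" "F x x x \<in> gam 4" "F z z z \<in> gam 4" by (simp_all add: S1_def S2_def F4)
  note [simp] = S4[THEN gam_carrier]
  have "F (x \<otimes> z) (x \<otimes> z) (x \<otimes> z) = F x x x \<otimes> (F z z z \<otimes> (S1 \<otimes> S2))"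
    by (simp add: Fm F4 gam4_ac S1_def S2_def)
  then have e1: "S1 \<otimes> S2 = \<one>" using add[of x z] by simp
  have "F (x \<otimes> inv z) (x \<otimes> inv z) (x \<otimes> inv z) = F x x x \<otimes> (inv (F z z z) \<otimes> (inv S1 \<otimes> S2))"
    by (simp add: Fm Fi F4 FC gam4_ac gam4_inv_mult S1_def S2_def)
  then have e2: "inv S1 \<otimes> S2 = \<one>" using add[of x "inv z"] by (simp add: Fi)
  \<comment> \<open>The order of \<open>S2\<close> divides 3, and by \<open>e1\<close> and
    \<open>e2\<close> also 2.\<close>
  have "S2 \<otimes> (S2 \<otimes> S2) = \<one>" unfolding S2_def using F3 F4 by (simp add: gam4_ac)
  moreover have "S1 = S2" using arg_cong[OF e2, of "\<lambda>u. S1 \<otimes> u"] by simp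
  ultimately have S2: "S2 = \<one>" using e1 by simp
  have F: "F x z z \<in> gam 4" "F z x z \<in> gam 4" "F z z x \<in> gam 4" using F4 by simp_all
  note [simp] = F[THEN gam_carrier]
  \<comment> \<open>Order dividing 3 turns the exponent -2 of the double bracket formula into 1, so
    that the double bracket is \<open>S2\<close>.\<close>
  have "F z x z = inv (F z x z) \<otimes> inv (F z x z)"
    using inv_equality[OF F3[of z x z]] by (simp add: inv_mult_group)
  then have "inv (F z x z) [^] (2::nat) = F z x z" by (simp add: numeral_2_eq_2)
  moreover have "f (cm (cm (cm x z) z) y) = F x z z \<otimes> (inv (F z x z) [^] (2::nat) \<otimes> F z z x)"
    unfolding F_def by (rule graded_hom_double_bracket[OF f, of x 1]) simp_all
  ultimately show ?thesis using S2 by (simp add: S2_def f_def)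
qed

text \<open>Up to sign, \<open>[x, [x, [x, y]]]\<close> is \<open>[[[y, x], x], x]\<close>, a double
  bracket as in \<open>tau_gam4\<close>; the other factor of \<open>cubic\<close> has weight
  five.\<close>

lemma cubic_tau:
  assumes g5: "\<And>m. m \<in> gam 5 \<Longrightarrow> m [^] tau = \<one>" and [simp]: "x \<in> carrier G" "y \<in> carrier G"
  shows "cubic x y [^] tau = \<one>"
proof -
  define f where "f m = m [^] tau" for m
  have f: "graded_hom 4 f" unfolding f_def by (rule graded_hom_pow_map) (simp_all add: g5)
  have x1: "x \<in> gam 1" "y \<in> gam 1" by simp_all
  have y2: "cm y x \<in> gam 2" "cm x y \<in> gam 2" by (rule commutator_memberships; simp)+
  note m = commutator_memberships[of x y]
  have g: "graded_hom 3 (\<lambda>m. f (cm x m))" by (rule graded_hom_comm_right[OF f x1(1)]) simp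
  have h: "graded_hom 2 (\<lambda>m. f (cm x (cm x m)))" by (rule graded_hom_comm_right[OF g x1(1)]) simp
  have y3: "cm (cm y x) x \<in> gam 3" by (rule comm_gam_le[OF y2(1) x1(1)]) simp
  have "f (cm x (cm (cm y x) x)) = inv (f (cm (cm (cm y x) x) x))"
    by (rule graded_hom_antisym[OF f y3 x1(1)]) simp
  then have 1: "f (cm x (cm (cm y x) x)) = \<one>" using tau_gam4[OF g5, of y x x] by (simp add: f_def)
  have "f (cm x (cm x (cm y x))) = inv (f (cm x (cm (cm y x) x)))"
    by (rule graded_hom_antisym[OF g y2(1) x1(1)]) simp
  then have 2: "f (cm x (cm x (cm y x))) = \<one>" using 1 by simp
  have "f (cm x (cm x (cm x y))) = inv (f (cm x (cm x (cm y x))))"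
    by (rule graded_hom_antisym[OF h x1(2,1)]) simp
  then have "f (cm x (cm x (cm x y))) = \<one>" using 2 by simp
  moreover have "f (cubic x y) = f (cm x (cm x (cm x y))) \<otimes> f (cm (cm x y) (cm x (cm x y)))"
    unfolding cubic_def by (rule graded_hom_mult[OF f]) (use m gam_mono[of _ 5 4] in simp_all)
  moreover have "f (cm (cm x y) (cm x (cm x y))) = \<one>" using m(6) g5 by (simp add: f_def)
  ultimately show ?thesis by (simp add: f_def)
qed


text \<open>By \<open>cubic_mult_gam2\<close> the power \<open>cubic x y [^] tau\<close> survives
  replacing \<open>x\<close> by \<open>x \<otimes> a\<close>. The change consists of the three
  weight-five terms in which \<open>a\<close> takes the place of one \<open>x\<close>, and in
  exponent 3 their product is the double bracket.\<close>

lemma tau_double_bracket_gam2: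
  assumes g6: "\<And>m. m \<in> gam 6 \<Longrightarrow> m [^] tau = \<one>"
    and [simp]: "x \<in> carrier G" "y \<in> carrier G" and a: "a \<in> gam 2"
  shows "cm (cm (cm a x) x) y [^] tau = \<one>"
proof -
  define f where "f m = m [^] tau" for m
  have f5: "graded_hom 5 f" unfolding f_def by (rule graded_hom_pow_map) (simp_all add: g6)
  \<comment> \<open>The map is multiplicative on \<open>gam 4\<close> but need not kill
    \<open>gam 5\<close>, so it is graded only from weight five on, and the weight-four factors have
    to be kept until they cancel.\<close>
  have fm: "f (m \<otimes> n) = f m \<otimes> f n" if "m \<in> gam 4" "n \<in> gam 4" for m n
    unfolding f_def using gam4_pow_mult that by simp
  have f4: "f m \<in> gam 4" if "m \<in> gam 4" for m using that by (simp add: f_def)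
  have [simp]: "a \<in> carrier G" using a gam_carrier by auto
  have x1: "x \<in> gam 1" "y \<in> gam 1" "x \<otimes> a \<in> gam 1" by simp_all
  let ?v = "cm x y" and ?w = "x \<otimes> a"
  let ?b1 = "cm x ?v"
  define r where "r = conj_el G x (cm a y)"
  define m where "m = cm ?w y"
  define m1 where "m1 = cm ?w m"
  \<comment> \<open>The cost of removing the conjugation by \<open>r\<close> from
    \<open>[x, [x, y]]\<close>. It has weight six, so bracketing it with \<open>x\<close> makes it
    trivial.\<close>
  define \<zeta> where "\<zeta> = cm r ?b1"
  define g0 where "g0 = conj_el G x (cm a m)"
  define g where "g = g0 \<otimes> (cm x r \<otimes> \<zeta>)"
  note M = commutator_memberships[of x y, simplified]
  have ay: "cm a y \<in> gam 3" by (rule comm_gam_le[OF a x1(2)]) simp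
  have r: "r \<in> gam 3" using ay by (simp add: r_def)
  have mM: "m \<in> gam 2" "m1 \<in> gam 3" unfolding m_def m1_def by (rule commutator_memberships; simp)+
  have zt: "\<zeta> \<in> gam 6" unfolding \<zeta>_def by (rule comm_gam_le[OF r M(2)]) simp
  have am: "cm a m \<in> gam 4" by (rule comm_gam_le[OF a mM(1)]) simp
  have g0: "g0 \<in> gam 4" using am by (simp add: g0_def)
  have xr: "cm x r \<in> gam 4" by (rule comm_gam_le[OF x1(1) r]) simp
  have g: "g \<in> gam 4" using g0 xr zt gam_mono[OF zt, of 4] by (simp add: g_def)
  have [simp]: "r \<in> carrier G" "m \<in> carrier G" "m1 \<in> carrier G" "\<zeta> \<in> carrier G" "g0 \<in> carrier G" "g \<in> carrier G"
    using r mM zt g0 g gam_carrier by auto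
  have m_eq: "m = r \<otimes> ?v" by (simp add: m_def r_def comm_mult_left)
  have m1_eq: "m1 = g \<otimes> ?b1"
  proof -
    have "m1 = g0 \<otimes> cm x m" by (simp add: m1_def g0_def comm_mult_left)
    also have "cm x m = cm x r \<otimes> conj_el G r ?b1" by (simp add: m_eq comm_mult_right)
    also have "conj_el G r ?b1 = \<zeta> \<otimes> ?b1" by (simp add: conj_eq_comm \<zeta>_def)
    finally show ?thesis by (simp add: g_def m_assoc)
  qed
  have xm1: "cm x m1 = cm x g \<otimes> cm x ?b1"
    using conj_trivial[OF g M(3)] by (simp add: m1_eq comm_mult_right)
  have T1: "cubic ?w y = (conj_el G x (cm a m1) \<otimes> (cm x g \<otimes> cm x ?b1)) \<otimes> cm m m1"
  proof -
    have "cm ?w m1 = conj_el G x (cm a m1) \<otimes> cm x m1" by (simp add: comm_mult_left)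
    then show ?thesis by (simp add: cubic_def m_def[symmetric] m1_def[symmetric] xm1)
  qed
  have k: "cm a m1 \<in> gam 5" "cm x g \<in> gam 5" "cm m m1 \<in> gam 5"
    using comm_gam_le[OF a mM(2)] comm_gam_le[OF x1(1) g] comm_gam_le[OF mM] by simp_all
  have k4: "conj_el G x (cm a m1) \<in> gam 4" "cm x g \<in> gam 4" "cm m m1 \<in> gam 4"
     "cm ?v ?b1 \<in> gam 4"
    using k M(6) gam_mono[of _ 5 4] by simp_all
  have fT1: "f (cubic ?w y) = (f (conj_el G x (cm a m1)) \<otimes> (f (cm x g) \<otimes> f (cm x ?b1))) \<otimes> f (cm m m1)"
    unfolding T1 using k4 M(3) by (simp add: fm)
  have fT: "f (cubic x y) = f (cm x ?b1) \<otimes> f (cm ?v ?b1)"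
    unfolding cubic_def using k4 M(3) by (simp add: fm)
  have e1: "f (conj_el G x (cm a m1)) = f (cm a ?b1)"
  proof -
    have h: "graded_hom 3 (\<lambda>m. f (cm a m))" by (rule graded_hom_comm_right[OF f5 a]) simp
    have "f (conj_el G x (cm a m1)) = f (cm a m1)" by (rule graded_hom_conj[OF f5 k(1)]) simp
    also have "\<dots> = f (cm a g) \<otimes> f (cm a ?b1)"
      unfolding m1_eq by (rule graded_hom_mult[OF h]) (use g M(2) gam_mono[OF g, of 3] in simp_all)
    also have "f (cm a g) = \<one>" using graded_hom_kill[OF h] g by simp
    finally show ?thesis by (simp add: f_def)
  qed
  have e2: "f (cm x g) = f (cm x (cm a ?v)) \<otimes> f (cm x (cm x (cm a y)))"
  proof -
    have h: "graded_hom 4 (\<lambda>g. f (cm x g))" by (rule graded_hom_comm_right[OF f5 x1(1)]) simp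
    have h2: "graded_hom 2 (\<lambda>u. f (cm x (cm a u)))" by (rule graded_hom_comm_right[OF h a]) simp
    have h3: "graded_hom 3 (\<lambda>u. f (cm x (cm x u)))" by (rule graded_hom_comm_right[OF h x1(1)]) simp
    have z4: "\<zeta> \<in> gam 5" "\<zeta> \<in> gam 4" using zt gam_mono[OF zt] by simp_all
    have "f (cm x g) = f (cm x g0) \<otimes> (f (cm x (cm x r)) \<otimes> f (cm x \<zeta>))"
      unfolding g_def using g0 xr z4 by (simp add: graded_hom_mult[OF h])
    also have "f (cm x \<zeta>) = \<one>" using graded_hom_kill[OF h] z4 by simp
    also have "f (cm x g0) = f (cm x (cm a m))" unfolding g0_def by (rule graded_hom_conj[OF h am]) simp
    also have "\<dots> = f (cm x (cm a r)) \<otimes> f (cm x (cm a ?v))"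
      unfolding m_eq by (rule graded_hom_mult[OF h2]) (use r M(1) gam_mono[OF r, of 2] in simp_all)
    also have "f (cm x (cm a r)) = \<one>" using graded_hom_kill[OF h2] r by simp
    also have "f (cm x (cm x r)) = f (cm x (cm x (cm a y)))"
      unfolding r_def by (rule graded_hom_conj[OF h3 ay]) simp
    finally show ?thesis by (simp add: f_def)
  qed
  have e3: "f (cm m m1) = f (cm ?v ?b1)"
  proof -
    have h: "graded_hom 2 (\<lambda>u. f (cm u m1))" by (rule graded_hom_comm_left[OF f5 mM(2)]) simp
    have h2: "graded_hom 3 (\<lambda>u. f (cm ?v u))" by (rule graded_hom_comm_right[OF f5 M(1)]) simp
    have "f (cm m m1) = f (cm r m1) \<otimes> f (cm ?v m1)"
      unfolding m_eq by (rule graded_hom_mult[OF h]) (use r M(1) gam_mono[OF r, of 2] in simp_all)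
    also have "f (cm r m1) = \<one>" using graded_hom_kill[OF h] r by simp
    also have "f (cm ?v m1) = f (cm ?v g) \<otimes> f (cm ?v ?b1)"
      unfolding m1_eq by (rule graded_hom_mult[OF h2]) (use g M(2) gam_mono[OF g, of 3] in simp_all)
    also have "f (cm ?v g) = \<one>" using graded_hom_kill[OF h2] g by simp
    finally show ?thesis by (simp add: f_def)
  qed
  let ?A = "f (cm a ?b1)" and ?B = "f (cm x (cm a ?v))" and ?C = "f (cm x (cm x (cm a y)))"
  have ABC4: "cm a ?b1 \<in> gam 4" "cm x (cm a ?v) \<in> gam 4" "cm x (cm x (cm a y)) \<in> gam 4"
    using comm_gam_le[OF a M(2), of 4] comm_gam_le[OF x1(1) comm_gam[OF a M(1)], of 4]
     comm_gam_le[OF x1(1) comm_gam[OF x1(1) ay], of 4] by simp_all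
  note F4 = ABC4[THEN f4] M(3)[THEN f4] k4(4)[THEN f4]
  note [simp] = F4[THEN gam_carrier]
  have "f (cubic ?w y) = f (cubic x y)" unfolding f_def by (rule cubic_mult_gam2) (simp_all add: a)
  then have "f (cm x ?b1) \<otimes> (f (cm ?v ?b1) \<otimes> (?A \<otimes> (?B \<otimes> ?C))) = f (cm x ?b1) \<otimes> (f (cm ?v ?b1) \<otimes> \<one>)"
    unfolding fT1 fT e1 e2 e3 using F4 by (simp add: gam4_ac)
  then have ABC: "?A \<otimes> (?B \<otimes> ?C) = \<one>" by simp
  have "?B [^] (3::nat) = \<one>" using tau_cube[OF ABC4(2)] by (simp add: f_def)
  then have "?B \<otimes> (?B \<otimes> ?B) = \<one>" by (simp add: numeral_3_eq_3 m_assoc)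
  then have "?B = inv ?B \<otimes> inv ?B" using inv_equality[of ?B "?B \<otimes> ?B"] F4
    by (metis \<open>?B \<in> carrier G\<close> inv_equality inv_mult_group m_closed)
  then have "inv ?B [^] (2::nat) = ?B" by (simp add: numeral_2_eq_2)
  moreover have "f (cm (cm (cm a x) x) y) = ?A \<otimes> (inv ?B [^] (2::nat) \<otimes> ?C)"
    by (rule graded_hom_double_bracket[OF f5 a]) simp_all
  ultimately show ?thesis using ABC by (simp add: f_def)
qed

text \<open>Under these hypotheses the \<open>tau\<close>-th power \<open>F\<close> of a five-fold left-normed commutator alternates in its
  first four entries, so swapping the two halves of \<open>[[a, b], [c, d]]\<close> gives \<open>4 F = 0\<close> next to \<open>3 F = 0\<close>.\<close>

lemma tau_gam5:
  assumes g6: "\<And>m. m \<in> gam 6 \<Longrightarrow> m [^] tau = \<one>"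
    and cen: "\<And>x z y w. \<lbrakk>x \<in> carrier G; z \<in> carrier G; y \<in> carrier G; w \<in> carrier G\<rbrakk>
      \<Longrightarrow> cm (cm (cm (cm x z) z) y [^] tau) w = \<one>"
    and k: "k \<in> gam 5"
  shows "k [^] tau = \<one>"
proof -
  define f where "f m = m [^] tau" for m
  have f: "graded_hom 5 f" unfolding f_def by (rule graded_hom_pow_map) (simp_all add: g6)
  define F where "F a b c d w = f (cm (cm (cm (cm a b) c) d) w)" for a b c d w
  have hw: "graded_hom 4 (\<lambda>m. f (cm m w))" if "w \<in> carrier G" for w
    by (rule graded_hom_comm_left[OF f, of w 1]) (simp_all add: that)
  have hdw: "graded_hom 3 (\<lambda>m. f (cm (cm m d) w))" if "w \<in> carrier G" "d \<in> carrier G" for w d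
    by (rule graded_hom_comm_left[OF hw, of w d 1]) (simp_all add: that)
  have hcdw: "graded_hom 2 (\<lambda>m. f (cm (cm (cm m c) d) w))" if "w \<in> carrier G" "d \<in> carrier G" "c \<in> carrier G" for w d c
    by (rule graded_hom_comm_left[OF hdw, of w d c 1]) (simp_all add: that)
  have mem2: "cm a b \<in> gam 2" if "a \<in> carrier G" "b \<in> carrier G" for a b
    using comm_gam_carrier[of a 1 b] that by (simp add: numeral_2_eq_2)
  have mem3: "cm (cm a b) c \<in> gam 3" if "a \<in> carrier G" "b \<in> carrier G" "c \<in> carrier G" for a b c
    using comm_gam_carrier[OF mem2] that by (simp add: numeral_3_eq_3)
  have mem4: "cm (cm (cm a b) c) d \<in> gam 4"
    if "a \<in> carrier G" "b \<in> carrier G" "c \<in> carrier G" "d \<in> carrier G" for a b c d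
    using comm_gam_carrier[OF mem3] that by (simp add: eval_nat_numeral)
  have mem5: "cm (cm (cm (cm a b) c) d) w \<in> gam 5"
    if "a \<in> carrier G" "b \<in> carrier G" "c \<in> carrier G" "d \<in> carrier G" "w \<in> carrier G" for a b c d w
    using comm_gam_carrier[OF mem4] that by (simp add: eval_nat_numeral)
  note mem = mem2 mem3 mem4 mem5
  have s12: "F b a c d w = inv (F a b c d w)"
    if "a \<in> carrier G" "b \<in> carrier G" "c \<in> carrier G" "d \<in> carrier G" "w \<in> carrier G" for a b c d w
    unfolding F_def by (rule graded_hom_antisym[OF hcdw, of _ _ _ a 1 b 1]) (simp_all add: that)
  have s23: "F a b c d w = inv (F a c b d w)"
    if [simp]: "a \<in> carrier G" "b \<in> carrier G" "c \<in> carrier G" "d \<in> carrier G" "w \<in> carrier G" for a b c d w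
    unfolding F_def
  proof (rule graded_hom_alternating[where B = "\<lambda>b c. f (cm (cm (cm (cm a b) c) d) w)"])
    show "graded_hom 1 (\<lambda>b. f (cm (cm (cm (cm a b) y) d) w))" if "y \<in> carrier G" for y
      by (rule graded_hom_comm_right[OF hcdw, of _ _ _ a 1]) (simp_all add: that)
    show "graded_hom 1 (\<lambda>c. f (cm (cm (cm (cm a x) c) d) w))" if [simp]: "x \<in> carrier G" for x
      by (rule graded_hom_comm_right[OF hdw, of _ _ _ 2]) (simp_all add: mem)
    show "f (cm (cm (cm (cm a x) x) d) w) = \<one>" if [simp]: "x \<in> carrier G" for x
    proof -
      let ?n = "cm (cm (cm a x) x) d"
      have n: "?n \<in> gam 4" "cm ?n w \<in> gam 5" using mem by simp_all
      \<comment> \<open>This carries the centrality assumption \<open>cen\<close> into weight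
        five.\<close>
      have "cm (?n [^] tau) w = cm ?n w [^] tau"
        using commute[OF n(2,1)] n gam_carrier by (intro comm_pow_central) auto
      then show ?thesis using cen[of a x d w] by (simp add: f_def)
    qed
  qed simp_all
  have s34: "F a b c d w = inv (F a b d c w)"
    if [simp]: "a \<in> carrier G" "b \<in> carrier G" "c \<in> carrier G" "d \<in> carrier G" "w \<in> carrier G" for a b c d w
    unfolding F_def
  proof (rule graded_hom_alternating[where B = "\<lambda>c d. f (cm (cm (cm (cm a b) c) d) w)"])
    show "graded_hom 1 (\<lambda>c. f (cm (cm (cm (cm a b) c) y) w))" if "y \<in> carrier G" for y
      by (rule graded_hom_comm_right[OF hdw, of _ _ _ 2]) (simp_all add: mem that)
    show "graded_hom 1 (\<lambda>d. f (cm (cm (cm (cm a b) x) d) w))" if [simp]: "x \<in> carrier G" for x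
      by (rule graded_hom_comm_right[OF hw, of _ _ 3]) (simp_all add: mem)
    show "f (cm (cm (cm (cm a b) x) x) w) = \<one>" if [simp]: "x \<in> carrier G" for x
      unfolding f_def by (rule tau_double_bracket_gam2[OF g6]) (simp_all add: mem)
  qed simp_all
  have F1: "F a b c d w = \<one>"
    if [simp]: "a \<in> carrier G" "b \<in> carrier G" "c \<in> carrier G" "d \<in> carrier G" "w \<in> carrier G" for a b c d w
  proof -
    have F4: "F a' b' c' d' w \<in> gam 4"
      if "a' \<in> carrier G" "b' \<in> carrier G" "c' \<in> carrier G" "d' \<in> carrier G" for a' b' c' d'
      unfolding F_def using graded_hom_gam4[OF f] mem that by simp
    have FC: "F a' b' c' d' w \<in> carrier G"
      if "a' \<in> carrier G" "b' \<in> carrier G" "c' \<in> carrier G" "d' \<in> carrier G" for a' b' c' d'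
      using F4[OF that] gam_carrier by blast
    \<comment> \<open>By Jacobi \<open>[u, [c', d']]\<close> is \<open>[[u, c'], d']\<close> minus
      \<open>[[u, d'], c']\<close>, and alternation makes the two terms opposite.\<close>
    have D: "f (cm (cm (cm a' b') (cm c' d')) w) = F a' b' c' d' w \<otimes> F a' b' c' d' w"
      if [simp]: "a' \<in> carrier G" "b' \<in> carrier G" "c' \<in> carrier G" "d' \<in> carrier G" for a' b' c' d'
    proof -
      let ?u = "cm a' b'"
      have u: "?u \<in> gam 2" "cm ?u d' \<in> gam 3" using mem by simp_all
      have cd1: "c' \<in> gam 1" "d' \<in> gam 1" by simp_all
      have cd: "cm c' d' \<in> gam 2" using mem by simp
      have 1: "F a' b' c' d' w = f (cm (cm ?u (cm c' d')) w) \<otimes> inv (f (cm (cm c' (cm ?u d')) w))"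
        unfolding F_def by (rule graded_hom_Jacobi[OF hw u(1) cd1]) simp_all
      have 2: "f (cm (cm c' (cm ?u d')) w) = inv (F a' b' d' c' w)"
        unfolding F_def by (rule graded_hom_antisym[OF hw u(2) cd1(1)]) simp_all
      have 3: "inv (F a' b' d' c' w) = F a' b' c' d' w" using s34[of a' b' c' d' w] by simp
      have ucd: "f (cm (cm ?u (cm c' d')) w) \<in> carrier G"
        using graded_hom_gam4[OF hw[of w] comm_gam_le[OF u(1) cd, of 4]] gam_carrier by simp
      have "F a' b' c' d' w = f (cm (cm ?u (cm c' d')) w) \<otimes> inv (F a' b' c' d' w)"
        using 1 unfolding 2 3 .
      then have "F a' b' c' d' w \<otimes> F a' b' c' d' w =
        f (cm (cm ?u (cm c' d')) w) \<otimes> inv (F a' b' c' d' w) \<otimes> F a' b' c' d' w" by simp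
      then show ?thesis using ucd FC by (simp add: m_assoc)
    qed
    have "f (cm (cm (cm c d) (cm a b)) w) = inv (f (cm (cm (cm a b) (cm c d)) w))"
      by (rule graded_hom_antisym[OF hw, of _ _ 2 _ 2]) (simp_all add: mem)
    \<comment> \<open>Exchanging the pairs is an even permutation, so the alternating
      \<open>F\<close> keeps its sign while the bracket of the two pairs changes its own.\<close>
    moreover have "F c d a b w = F a b c d w"
    proof -
      have "F c d a b w = inv (F c a d b w)" by (rule s23) simp_all
      also have "F c a d b w = inv (F a c d b w)" by (rule s12) simp_all
      also have "F a c d b w = inv (F a c b d w)" by (rule s34) simp_all
      also have "F a c b d w = inv (F a b c d w)" by (rule s23) simp_all
      finally show ?thesis by (simp add: FC)
    qed
    ultimately have "F a b c d w \<otimes> F a b c d w = inv (F a b c d w \<otimes> F a b c d w)"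
      by (simp add: D)
    then have "(F a b c d w \<otimes> F a b c d w) \<otimes> (F a b c d w \<otimes> F a b c d w) = \<one>"
      by (metis FC m_closed r_inv that(1-4))
    moreover have "F a b c d w \<otimes> F a b c d w \<otimes> F a b c d w = \<one>"
      using tau_cube[OF gam_mono[OF mem(4), of a b c d w 4]] FC by (simp add: F_def f_def numeral_3_eq_3)
    ultimately show ?thesis by (simp add: FC m_assoc)
  qed
  \<comment> \<open>From left-normed commutators to arbitrary elements of \<open>gam 5\<close>,
    raising the weight of the innermost entry by one each time.\<close>
  have 2: "f (cm (cm (cm m c) d) w) = \<one>" if "m \<in> gam 2" "c \<in> carrier G" "d \<in> carrier G" "w \<in> carrier G" for m c d w
    using graded_hom_vanish[of 1 "\<lambda>m. f (cm (cm (cm m c) d) w)" m] hcdw[of w d c] F1 that by (simp add: F_def numeral_eq_Suc)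
  have 3: "f (cm (cm m d) w) = \<one>" if "m \<in> gam 3" "d \<in> carrier G" "w \<in> carrier G" for m d w
    using graded_hom_vanish[of 2 "\<lambda>m. f (cm (cm m d) w)" m] hdw[of w d] 2 that by (simp add: numeral_eq_Suc)
  have 4: "f (cm m w) = \<one>" if "m \<in> gam 4" "w \<in> carrier G" for m w
    using graded_hom_vanish[of 3 "\<lambda>m. f (cm m w)" m] hw[of w] 3 that by (simp add: numeral_eq_Suc)
  show ?thesis
    using graded_hom_vanish[of 4 f k] f 4 k by (simp add: f_def numeral_eq_Suc)
qed

end

section \<open>Removing the hypotheses on \<open>gam 5\<close> and \<open>gam 6\<close> through
  quotients\<close>

context class6
begin

text \<open>The locale bounds the class from above only, so its results also hold in the quotients
  of class at most four and five used below.\<close>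

lemma class6_quotient:
  assumes "k \<le> 7"
  shows "class6 (G Mod gam k) e"
proof -
  interpret q: group_hom G "G Mod gam k" "\<lambda>a. gam k #> a" by (rule quotient_gam)
  note q = quotient_gam[where k = k]
  show ?thesis
  proof (unfold_locales)
    have "\<one>\<^bsub>G Mod gam k\<^esub> \<in> lower_central (G Mod gam k) 7" by (rule q.H.gam_one)
    then show "lower_central (G Mod gam k) 7 = {\<one>\<^bsub>G Mod gam k\<^esub>}"
      using q.H.gam_antimono[OF assms] q(4) by blast
    show "odd e" by (rule odd_e)
    show "grp_comm (G Mod gam k) (x [^]\<^bsub>G Mod gam k\<^esub> e) y = \<one>\<^bsub>G Mod gam k\<^esub>"
      if "x \<in> carrier (G Mod gam k)" "y \<in> carrier (G Mod gam k)" for x y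
      using q.central_pow_image[OF q(2) central that] .
  qed
qed

lemma quotient_pow_iff:
  assumes "m \<in> carrier G"
  shows "(gam k #> m) [^]\<^bsub>G Mod gam k\<^esub> (n::nat) = \<one>\<^bsub>G Mod gam k\<^esub> \<longleftrightarrow> m [^] n \<in> gam k"
proof -
  interpret q: group_hom G "G Mod gam k" "\<lambda>a. gam k #> a" by (rule quotient_gam)
  have "gam k #> (m [^] n) = (gam k #> m) [^]\<^bsub>G Mod gam k\<^esub> n" using assms by (rule q.hom_nat_pow)
  then show ?thesis using quotient_gam(3)[of "m [^] n" k] assms by simp
qed

lemma quotient_triple:
  fixes k :: nat
  assumes "x \<in> carrier G" "z \<in> carrier G" "y \<in> carrier G"
  defines "Q \<equiv> G Mod gam k" and "q \<equiv> \<lambda>a. gam k #> a"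
  shows "q (cm (cm (cm x z) z) y) = grp_comm Q (grp_comm Q (grp_comm Q (q x) (q z)) (q z)) (q y)"
proof -
  interpret q: group_hom G Q q unfolding Q_def q_def by (rule quotient_gam)
  show ?thesis using assms(1-3) by (simp add: q.hom_comm)
qed

text \<open>Start of the bootstrap: with \<open>gam 5\<close> trivial, the hypothesis of
  \<open>tau_gam4\<close> holds automatically.\<close>

lemma tau_class4:
  assumes "gam 5 = {\<one>}" "x \<in> carrier G" "z \<in> carrier G" "y \<in> carrier G"
  shows "cm (cm (cm x z) z) y [^] tau = \<one>"
  by (rule tau_gam4) (use assms in simp_all)

lemma tau_in_gam5:
  assumes xyz: "x \<in> carrier G" "z \<in> carrier G" "y \<in> carrier G"
  shows "cm (cm (cm x z) z) y [^] tau \<in> gam 5"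
proof -
  let ?Q = "G Mod gam 5" and ?q = "\<lambda>a. gam 5 #> a"
  interpret q: group_hom G ?Q ?q by (rule quotient_gam)
  interpret Q: class6 ?Q e by (rule class6_quotient) simp
  note q = quotient_gam[where k = 5]
  have "grp_comm ?Q (grp_comm ?Q (grp_comm ?Q (?q x) (?q z)) (?q z)) (?q y) [^]\<^bsub>?Q\<^esub> tau = \<one>\<^bsub>?Q\<^esub>"
    by (rule Q.tau_class4[OF q(4)]) (use xyz in simp_all)
  then show ?thesis using quotient_triple[OF xyz, of 5] quotient_pow_iff[of "cm (cm (cm x z) z) y" 5 tau] xyz by simp
qed

text \<open>The \<open>tau\<close>-th powers of double brackets lie in \<open>gam 5\<close> by
  \<open>tau_in_gam5\<close>, so their commutators lie in the trivial \<open>gam 6\<close> and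
  \<open>tau_gam5\<close> applies.\<close>

lemma tau_class5:
  assumes "gam 6 = {\<one>}"
  shows "k \<in> gam 5 \<Longrightarrow> k [^] tau = \<one>"
proof (rule tau_gam5)
  show "m [^] tau = \<one>" if "m \<in> gam 6" for m using that assms by simp
  show "cm (cm (cm (cm x z) z) y [^] tau) w = \<one>"
    if "x \<in> carrier G" "z \<in> carrier G" "y \<in> carrier G" "w \<in> carrier G" for x z y w
    using comm_gam_carrier[OF tau_in_gam5[OF that(1-3)] that(4)] assms by simp
qed

lemma tau_in_gam6:
  shows "k \<in> gam 5 \<Longrightarrow> k [^] tau \<in> gam 6"
    and "\<lbrakk>x \<in> carrier G; z \<in> carrier G; y \<in> carrier G\<rbrakk> \<Longrightarrow> cm (cm (cm x z) z) y [^] tau \<in> gam 6"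
proof -
  let ?Q = "G Mod gam 6" and ?q = "\<lambda>a. gam 6 #> a"
  interpret q: group_hom G ?Q ?q by (rule quotient_gam)
  interpret Q: class6 ?Q e by (rule class6_quotient) simp
  note q = quotient_gam[where k = 6]
  show "k [^] tau \<in> gam 6" if "k \<in> gam 5"
  proof -
    have "?q k \<in> lower_central ?Q 5" using that q.lower_central_image[OF q(2)] by blast
    then have "?q k [^]\<^bsub>?Q\<^esub> tau = \<one>\<^bsub>?Q\<^esub>" by (rule Q.tau_class5[OF q(4)])
    then show ?thesis using quotient_pow_iff gam_carrier[OF that] by simp
  qed
  show "cm (cm (cm x z) z) y [^] tau \<in> gam 6" if xyz: "x \<in> carrier G" "z \<in> carrier G" "y \<in> carrier G"
  proof -
    have "grp_comm ?Q (grp_comm ?Q (grp_comm ?Q (?q x) (?q z)) (?q z)) (?q y) [^]\<^bsub>?Q\<^esub> tau = \<one>\<^bsub>?Q\<^esub>"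
      by (rule Q.tau_gam4[OF Q.tau_class5[OF q(4)]]) (use xyz in simp_all)
    then show ?thesis using quotient_triple[OF xyz, of 6] quotient_pow_iff[of "cm (cm (cm x z) z) y" 6 tau] xyz by simp
  qed
qed

text \<open>For \<open>k\<close> in \<open>gam 5\<close> the power \<open>k [^] tau\<close> lies in
  \<open>gam 6\<close> and is central, so \<open>[k, w]^tau = [k^tau, w] = 1\<close>; these
  commutators generate \<open>gam 6\<close>.\<close>

lemma gam6_tau: "m \<in> gam 6 \<Longrightarrow> m [^] tau = \<one>"
proof -
  have "graded_hom 6 (\<lambda>m. m [^] tau)" by (rule graded_hom_pow_map) (use gam_7 in simp_all)
  then have f: "graded_hom (Suc 5) (\<lambda>m. m [^] tau)" by simp
  have v: "cm k w [^] tau = \<one>" if "k \<in> gam 5" "w \<in> carrier G" for k w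
  proof -
    have c: "cm k w \<in> gam 6" using comm_gam_carrier[OF that] by simp
    have "cm (k [^] tau) w = cm k w [^] tau"
      using commute[OF c that(1)] gam_carrier[OF that(1)] that(2) by (intro comm_pow_central) auto
    then show ?thesis using comm_gam_carrier[OF tau_in_gam6(1)[OF that(1)] that(2)] gam_7 by simp
  qed
  show "m \<in> gam 6 \<Longrightarrow> m [^] tau = \<one>"
    using graded_hom_vanish[OF f _ v, of m] by simp
qed

lemma gam5_tau: "m \<in> gam 5 \<Longrightarrow> m [^] tau = \<one>"
proof (rule tau_gam5[OF gam6_tau])
  show "cm (cm (cm (cm x z) z) y [^] tau) w = \<one>"
    if "x \<in> carrier G" "z \<in> carrier G" "y \<in> carrier G" "w \<in> carrier G" for x z y w
    using comm_gam_carrier[OF tau_in_gam6(2)[OF that(1-3)] that(4)] gam_7 by simp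
qed

lemma gam6_binom3: 
  assumes "m \<in> gam 6"
  shows "m [^] binom3 = \<one>"
proof -
  have [simp]: "m \<in> carrier G" using assms gam_carrier by blast
  have "m [^] (3 * binom3) = \<one>"
    using gam4_pow_mod[OF gam_mono[OF assms, of 4]] odd_dvd_choose(3)[OF odd_e] by (simp add: binom3_def)
  from pow_mod_exp[OF _ this, of "3 * (3 * binom3)"] have "m [^] (3 * (3 * binom3)) = \<one>" by simp
  moreover have "m [^] (10 * binom3) = m [^] (3 * (3 * binom3)) \<otimes> m [^] binom3" by (simp add: nat_pow_mult)
  ultimately show ?thesis using gam6_tau[OF assms] by simp
qed

section \<open>Characteristic 5: the quintic part\<close>

lemma comm_pow_eq_quintic:
  assumes "x \<in> carrier G" "y \<in> carrier G"
  shows "comm_pow x y = inv (quintic x y [^] sigma)"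
proof -
  note m = commutator_memberships[OF assms]
  have [simp]: "comm_pow x y \<in> carrier G" "cubic x y \<in> carrier G" "quintic x y \<in> carrier G"
    using m gam_carrier by (auto simp: comm_pow_def)
  have "comm_pow x y [^] (10::nat) = \<one>"
    using comm_pow_tenth[OF assms] cubic_tau[OF gam5_tau assms] by (simp add: nat_pow_inv)
  from pow_mod_exp[OF _ this, of 20] have "comm_pow x y [^] (20::nat) = \<one>" by simp
  moreover have "comm_pow x y [^] (21::nat) = comm_pow x y [^] (20::nat) \<otimes> comm_pow x y" by (simp flip: nat_pow_Suc)
  ultimately show ?thesis using comm_pow_21st[OF assms] by (simp add: nat_pow_inv)
qed

text \<open>Since \<open>z\<close> commutes with its powers, replacing \<open>x\<close> by \<open>x \<otimes> z [^] k\<close> does not change the innermost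
  bracket.\<close>

lemma quintic_sigma:
  assumes [simp]: "x \<in> carrier G" "z \<in> carrier G"
  shows "quintic z x [^] sigma = \<one>"
proof -
  define f where "f m = m [^] sigma" for m
  have f: "graded_hom 6 f" unfolding f_def by (rule graded_hom_pow_map) (use gam_7 in simp_all)
  \<comment> \<open>The innermost \<open>[z, x]\<close> stays fixed, so that \<open>L\<close> is
    linear in four entries and gives a polynomial of degree four along \<open>w k\<close>.\<close>
  define L where "L a b c d = f (cm a (cm b (cm c (cm d (cm z x)))))" for a b c d
  have zx: "cm z x \<in> gam 2" by (rule commutator_memberships) simp_all
  have one: "w \<in> gam 1" if "w \<in> carrier G" for w using that by simp
  have m3: "cm d (cm z x) \<in> gam 3" if "d \<in> carrier G" for d
    by (rule comm_gam_le[OF one[OF that] zx]) simp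
  have m4: "cm c (cm d (cm z x)) \<in> gam 4" if "c \<in> carrier G" "d \<in> carrier G" for c d
    by (rule comm_gam_le[OF one[OF that(1)] m3[OF that(2)]]) simp
  have m5: "cm b (cm c (cm d (cm z x))) \<in> gam 5" if "b \<in> carrier G" "c \<in> carrier G" "d \<in> carrier G" for b c d
    by (rule comm_gam_le[OF one[OF that(1)] m4[OF that(2,3)]]) simp
  have m6: "cm a (cm b (cm c (cm d (cm z x)))) \<in> gam 6"
    if "a \<in> carrier G" "b \<in> carrier G" "c \<in> carrier G" "d \<in> carrier G" for a b c d
    by (rule comm_gam_le[OF one[OF that(1)] m5[OF that(2-4)]]) simp
  have L4: "L a b c d \<in> gam 4" if "a \<in> carrier G" "b \<in> carrier G" "c \<in> carrier G" "d \<in> carrier G" for a b c d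
    unfolding L_def using graded_hom_gam4[OF f] m6 that by simp
  have LC: "L a b c d \<in> carrier G" if "a \<in> carrier G" "b \<in> carrier G" "c \<in> carrier G" "d \<in> carrier G" for a b c d
    using L4[OF that] gam_carrier by blast
  have h5: "graded_hom 5 (\<lambda>m. f (cm a m))" if "a \<in> carrier G" for a
    by (rule graded_hom_comm_right[OF f one[OF that]]) simp
  have h4: "graded_hom 4 (\<lambda>m. f (cm a (cm b m)))" if "a \<in> carrier G" "b \<in> carrier G" for a b
    by (rule graded_hom_comm_right[OF h5 one[OF that(2)]]) (simp_all add: that)
  have h3: "graded_hom 3 (\<lambda>m. f (cm a (cm b (cm c m))))" if "a \<in> carrier G" "b \<in> carrier G" "c \<in> carrier G" for a b c
    by (rule graded_hom_comm_right[OF h4 one[OF that(3)]]) (simp_all add: that)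
  have l1: "graded_hom 1 (\<lambda>a. L a b c d)" if "b \<in> carrier G" "c \<in> carrier G" "d \<in> carrier G" for b c d
    unfolding L_def by (rule graded_hom_comm_left[OF f m5]) (simp_all add: that)
  have l2: "graded_hom 1 (\<lambda>b. L a b c d)" if "a \<in> carrier G" "c \<in> carrier G" "d \<in> carrier G" for a c d
    unfolding L_def by (rule graded_hom_comm_left[OF h5 m4]) (simp_all add: that)
  have l3: "graded_hom 1 (\<lambda>c. L a b c d)" if "a \<in> carrier G" "b \<in> carrier G" "d \<in> carrier G" for a b d
    unfolding L_def by (rule graded_hom_comm_left[OF h4 m3]) (simp_all add: that)
  have l4: "graded_hom 1 (\<lambda>d. L a b c d)" if "a \<in> carrier G" "b \<in> carrier G" "c \<in> carrier G" for a b c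
    unfolding L_def by (rule graded_hom_comm_left[OF h3 zx]) (simp_all add: that)
  define w where "w k = x \<otimes> z [^] (k::nat)" for k
  have w [simp]: "w k \<in> carrier G" for k by (simp add: w_def)
  have slot: "g (w k) = g x \<otimes> g z [^] k" if "graded_hom 1 g" for g k
    unfolding w_def using graded_hom_mult[OF that] graded_hom_pow[OF that] by simp
  note ls = slot[OF l1] slot[OF l2] slot[OF l3] slot[OF l4]
  note ac = gam4_ac gam4_pow_mult LC nat_pow_pow
  let ?c4 = "L z z z z"
  \<comment> \<open>Only the leading coefficient has to be known; the lower ones are hidden behind
    existential quantifiers while the entries are expanded one after another.\<close>
  have q2: "\<exists>c0\<in>gam 4. \<exists>c1\<in>gam 4. \<forall>k. L a b (w k) (w k) = c0 \<otimes> (c1 [^] k \<otimes> L a b z z [^] (k ^ 2))"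
    if [simp]: "a \<in> carrier G" "b \<in> carrier G" for a b
    by (intro bexI[of _ "L a b x x"] bexI[of _ "L a b x z \<otimes> L a b z x"])
      (simp_all add: ls L4 ac power2_eq_square)
  have q3: "\<exists>c0\<in>gam 4. \<exists>c1\<in>gam 4. \<exists>c2\<in>gam 4. \<forall>k. L a (w k) (w k) (w k) =
     c0 \<otimes> (c1 [^] k \<otimes> (c2 [^] (k ^ 2) \<otimes> L a z z z [^] (k ^ 3)))"
    if a [simp]: "a \<in> carrier G" for a
  proof -
    obtain c0 c1 where c: "c0 \<in> gam 4" "c1 \<in> gam 4"
      "\<And>k. L a x (w k) (w k) = c0 \<otimes> (c1 [^] k \<otimes> L a x z z [^] (k ^ 2))" using q2[of a x] by auto
    obtain d0 d1 where d: "d0 \<in> gam 4" "d1 \<in> gam 4"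
      "\<And>k. L a z (w k) (w k) = d0 \<otimes> (d1 [^] k \<otimes> L a z z z [^] (k ^ 2))" using q2[of a z] by auto
    note [simp] = c(1,2)[THEN gam_carrier] d(1,2)[THEN gam_carrier]
    show ?thesis
      by (intro bexI[of _ c0] bexI[of _ "c1 \<otimes> d0"] bexI[of _ "L a x z z \<otimes> d1"])
        (simp_all add: slot[OF l2] L4 ac c d power2_eq_square power3_eq_cube)
  qed
  obtain c0 c1 c2 c3 where c: "c0 \<in> gam 4" "c1 \<in> gam 4" "c2 \<in> gam 4" "c3 \<in> gam 4"
    "\<And>k. L (w k) (w k) (w k) (w k) = c0 \<otimes> (c1 [^] k \<otimes> (c2 [^] (k ^ 2) \<otimes> (c3 [^] (k ^ 3) \<otimes> ?c4 [^] (k ^ 4))))"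
  proof -
    obtain c0 c1 c2 where c: "c0 \<in> gam 4" "c1 \<in> gam 4" "c2 \<in> gam 4"
      "\<And>k. L x (w k) (w k) (w k) = c0 \<otimes> (c1 [^] k \<otimes> (c2 [^] (k ^ 2) \<otimes> L x z z z [^] (k ^ 3)))"
      using q3[of x] by auto
    obtain d0 d1 d2 where d: "d0 \<in> gam 4" "d1 \<in> gam 4" "d2 \<in> gam 4"
      "\<And>k. L z (w k) (w k) (w k) = d0 \<otimes> (d1 [^] k \<otimes> (d2 [^] (k ^ 2) \<otimes> L z z z z [^] (k ^ 3)))"
      using q3[of z] by auto
    note [simp] = c(1-3)[THEN gam_carrier] d(1-3)[THEN gam_carrier]
    show ?thesis
      by (rule that[of c0 "c1 \<otimes> d0" "c2 \<otimes> d1" "L x z z z \<otimes> d2"])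
        (simp_all add: slot[OF l1] L4 ac c d power2_eq_square power3_eq_cube power4_eq_xxxx)
  qed
  \<comment> \<open>\<open>[w k, z]^e\<close> is the inverse of \<open>[z, w k]^e\<close>. Written
    by \<open>comm_pow_eq_quintic\<close>, this replaces the four outer entries \<open>w k\<close>
    by \<open>z\<close>, while the inner bracket is \<open>[z, x]\<close> for every
    \<open>k\<close>.\<close>
  have const: "L (w k) (w k) (w k) (w k) = ?c4" for k
  proof -
    let ?w = "w k"
    have zw: "cm z ?w = cm z x"
    proof -
      have "cm z (z [^] k) = \<one>" using nat_pow_Suc2[of z k] by (subst comm_eq_one_iff) simp_all
      then show ?thesis by (simp add: w_def comm_mult_right conj_el_def)
    qed
    have U6: "quintic ?w z \<in> gam 6" "quintic z ?w \<in> gam 6" by (rule commutator_memberships; simp)+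
    note [simp] = U6[THEN gam_carrier]
    have "L ?w ?w ?w ?w = f (cm ?w (cm ?w (cm ?w (cm ?w (cm z ?w)))))" by (simp add: L_def zw)
    also have "\<dots> = inv (f (quintic ?w z))"
    proof -
      have h2: "graded_hom 2 (\<lambda>m. f (cm ?w (cm ?w (cm ?w (cm ?w m)))))"
        by (rule graded_hom_comm_right[OF h3 one[OF w]]) simp_all
      show ?thesis unfolding quintic_def by (rule graded_hom_antisym[OF h2 one[OF w] one]) simp_all
    qed
    also have "\<dots> = comm_pow ?w z" using comm_pow_eq_quintic[of ?w z] by (simp add: f_def)
    also have "comm_pow ?w z = inv (comm_pow z ?w)"
    proof -
      have "comm_pow ?w z = inv (cm z ?w) [^] e" by (simp add: comm_pow_def inv_comm)
      then show ?thesis by (simp add: comm_pow_def nat_pow_inv)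
    qed
    also have "\<dots> = f (quintic z ?w)" using comm_pow_eq_quintic[of z ?w] by (simp add: f_def)
    also have "\<dots> = ?c4" by (simp add: quintic_def L_def zw)
    finally show ?thesis .
  qed
  note C = c(1-4)[THEN gam_carrier]
  have c44: "?c4 \<in> gam 4" and [simp]: "?c4 \<in> carrier G" by (simp_all add: L4 LC)
  have five: "?c4 [^] (5::nat) = \<one>"
    using gam4_pow_mod[OF gam_mono[OF m6, of z z z z 4], of "5 * sigma"] e_dvd_sigma
    by (simp add: L_def f_def nat_pow_pow mult.commute)
  \<comment> \<open>\<open>P\<close> is the contribution of \<open>c0\<close> to \<open>c3\<close>
    to both sides of the fourth difference, written without signs as
    \<open>v 0 + 6 * v 2 + v 4 = 4 * v 1 + 4 * v 3\<close>; a fourth difference annihilates cubics.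
    For \<open>c1\<close>, say, both sides give 16.\<close>
  define P where "P = c0 [^] (8::nat) \<otimes> (c1 [^] (16::nat) \<otimes> (c2 [^] (40::nat) \<otimes> c3 [^] (112::nat)))"
  define v where "v k = L (w k) (w k) (w k) (w k)" for k
  have eight: "u \<otimes> (u [^] (6::nat) \<otimes> u) = u [^] (8::nat)" if "u \<in> carrier G" for u
    using nat_pow_mult[OF that, of 6 1] nat_pow_mult[OF that, of 1 7] that by simp
  have v: "v 0 \<otimes> (v 2 [^] (6::nat) \<otimes> v 4) = v 1 [^] (4::nat) \<otimes> v 3 [^] (4::nat)"
    unfolding v_def const by (simp add: eight nat_pow_mult)
  have zip: "(a0 \<otimes> (a1 \<otimes> (a2 \<otimes> (a3 \<otimes> a4)))) \<otimes> (b0 \<otimes> (b1 \<otimes> (b2 \<otimes> (b3 \<otimes> b4)))) =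
      (a0 \<otimes> b0) \<otimes> ((a1 \<otimes> b1) \<otimes> ((a2 \<otimes> b2) \<otimes> ((a3 \<otimes> b3) \<otimes> (a4 \<otimes> b4))))"
    if "a0 \<in> gam 4" "a1 \<in> gam 4" "a2 \<in> gam 4" "a3 \<in> gam 4" "a4 \<in> gam 4"
      "b0 \<in> gam 4" "b1 \<in> gam 4" "b2 \<in> gam 4" "b3 \<in> gam 4" "b4 \<in> gam 4" for a0 a1 a2 a3 a4 b0 b1 b2 b3 b4
    using that by (simp add: gam4_ac)
  have vk: "v k [^] (n::nat) = c0 [^] n \<otimes> (c1 [^] (k * n) \<otimes> (c2 [^] (k ^ 2 * n) \<otimes> (c3 [^] (k ^ 3 * n) \<otimes>
     ?c4 [^] (k ^ 4 * n))))" for k n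
    unfolding v_def c(5) using c(1-4) c44 C by (simp add: gam4_pow_mult nat_pow_pow)
  have v0: "v 0 = c0" unfolding v_def c(5) using C by simp
  have v4: "v 4 = c0 \<otimes> (c1 [^] (4::nat) \<otimes> (c2 [^] (16::nat) \<otimes> (c3 [^] (64::nat) \<otimes> ?c4 [^] (256::nat))))"
    unfolding v_def c(5) by simp
  let ?R = "c1 [^] (16::nat) \<otimes> (c2 [^] (40::nat) \<otimes> (c3 [^] (112::nat) \<otimes> ?c4 [^] (352::nat)))"
  have "v 2 [^] (6::nat) \<otimes> v 4 = (c0 [^] (6::nat) \<otimes> c0) \<otimes> ?R"
    unfolding vk v4 using c(1-4) c44 C by (subst zip) (simp_all add: nat_pow_mult)
  then have "v 0 \<otimes> (v 2 [^] (6::nat) \<otimes> v 4) = (c0 \<otimes> (c0 [^] (6::nat) \<otimes> c0)) \<otimes> ?R"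
    unfolding v0 using C by (simp add: m_assoc)
  then have "v 0 \<otimes> (v 2 [^] (6::nat) \<otimes> v 4) = P \<otimes> ?c4 [^] (352::nat)"
    unfolding eight[OF C(1)] P_def using C by (simp add: m_assoc)
  moreover have "v 1 [^] (4::nat) \<otimes> v 3 [^] (4::nat) = P \<otimes> ?c4 [^] (328::nat)"
    unfolding vk P_def using c(1-4) c44 C
    by (subst zip) (simp_all add: nat_pow_mult m_assoc)
  ultimately have "P \<otimes> ?c4 [^] (352::nat) = P \<otimes> ?c4 [^] (328::nat)" using v by simp
  moreover have "P \<in> carrier G" using C by (simp add: P_def)
  ultimately have "?c4 [^] (352::nat) = ?c4 [^] (328::nat)" by simp
  \<comment> \<open>The exponents differ by 24, the factorial of 4. Modulo 5 they are 2 and 3, so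
    \<open>?c4\<close> is trivial.\<close>
  moreover have "?c4 [^] (352::nat) = ?c4 [^] (350::nat) \<otimes> (?c4 \<otimes> ?c4)"
    "?c4 [^] (328::nat) = ?c4 [^] (325::nat) \<otimes> (?c4 \<otimes> (?c4 \<otimes> ?c4))"
    using nat_pow_mult[of ?c4 350 2] nat_pow_mult[of ?c4 325 3] by (simp_all add: numeral_2_eq_2 numeral_3_eq_3 m_assoc)
  moreover have "?c4 [^] (350::nat) = \<one>" "?c4 [^] (325::nat) = \<one>"
    using pow_mod_exp[OF _ five, of 350] pow_mod_exp[OF _ five, of 325] by simp_all
  ultimately have "?c4 = \<one>" by simp
  then show ?thesis by (simp add: L_def quintic_def f_def)
qed

text \<open>Commutators are covered by the vanishing of the quintic part, and products because the
  defect in \<open>pow_mult_gam2\<close> is trivial by \<open>gam6_binom3\<close>.\<close>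

lemma gam2_exp: "z \<in> gam 2 \<Longrightarrow> z [^] e = \<one>"
proof -
  assume "z \<in> gam 2"
  then have "z \<in> gam (Suc 1)" by (simp add: numeral_2_eq_2)
  from this zero_less_one show "z [^] e = \<one>"
  proof (induction rule: gam_induct)
    case (comm a h)
    then show ?case using comm_pow_eq_quintic[of a h] quintic_sigma[of h a] by (simp add: comm_pow_def)
  next
    case (mult x y)
    then have xy: "x \<in> gam 2" "y \<in> gam 2" by (simp_all add: numeral_2_eq_2)
    show ?case using pow_mult_gam2[OF xy] gam6_binom3 mult by (metis l_one one_closed)
  next
    case (inv x) then show ?case using gam_carrier pow_inv_one by blast
  qed simp_all
qed

end

section \<open>Iterating the power estimate\<close>

context group
begin

lemma gam2_pow_in_gam7:
  assumes "odd e" "\<And>x y. \<lbrakk>x \<in> carrier G; y \<in> carrier G\<rbrakk> \<Longrightarrow> cm (x [^] (e::nat)) y = \<one>"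
    and z: "z \<in> gam 2"
  shows "z [^] e \<in> gam 7"
proof -
  let ?Q = "G Mod gam 7" and ?q = "\<lambda>a. gam 7 #> a"
  interpret q: group_hom G ?Q ?q by (rule quotient_gam)
  note q = quotient_gam[where k = 7]
  interpret Q: class6 ?Q e
  proof unfold_locales
    show "lower_central ?Q 7 = {\<one>\<^bsub>?Q\<^esub>}" "odd e" by fact+
    show "grp_comm ?Q (x [^]\<^bsub>?Q\<^esub> e) y = \<one>\<^bsub>?Q\<^esub>" if "x \<in> carrier ?Q" "y \<in> carrier ?Q" for x y
      using q.central_pow_image[OF q(2) assms(2) that] .
  qed
  have "?q z \<in> lower_central ?Q 2" using z q.lower_central_image[OF q(2)] by blast
  then have "?q z [^]\<^bsub>?Q\<^esub> e = \<one>\<^bsub>?Q\<^esub>" by (rule Q.gam2_exp)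
  then show ?thesis using q(3)[of "z [^] e"] q.hom_nat_pow[of z e] gam_carrier[OF z] by simp
qed

text \<open>The first factor \<open>e\<close> reaches weight 7 = 3 * 2 + 1; each further one leads
  from \<open>m + 1\<close> to \<open>2 * m + 1\<close> with \<open>m = 3 * 2 ^ n\<close>.\<close>

lemma gam2_pow_iterate:
  assumes "odd e" "\<And>x y. \<lbrakk>x \<in> carrier G; y \<in> carrier G\<rbrakk> \<Longrightarrow> cm (x [^] (e::nat)) y = \<one>"
    and z: "z \<in> gam 2" and "n > 0"
  shows "z [^] (e ^ n) \<in> gam (3 * 2 ^ n + 1)"
  using \<open>n > 0\<close>
proof (induction n rule: nat_induct_non_zero)
  case 1 then show ?case using gam2_pow_in_gam7[OF assms(1-3)] by simp
next
  case (Suc n)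
  have "(z [^] (e ^ n)) [^] e \<in> gam (2 * (3 * 2 ^ n) + 1)"
    using central_pow_comm_mod[OF assms(2), of "3 * 2 ^ n"] Suc by simp
  then show ?case using gam_carrier[OF z] by (simp add: nat_pow_pow mult.commute mult.left_commute)
qed

end

section \<open>The exterior square\<close>

context group
begin

abbreviation wedge_square ("\<Lambda>") where "\<Lambda> \<equiv> ext_square G"

definition wedge where "wedge g h = ext_class G [((g, h), True)]"

definition word_inverse :: "'a ext_word \<Rightarrow> 'a ext_word" where
  "word_inverse u = rev (map (\<lambda>(s, b). (s, \<not> b)) u)"

definition word_act :: "'a \<Rightarrow> 'a ext_word \<Rightarrow> 'a ext_word" where
  "word_act x u = map (\<lambda>((g, h), b). ((conj_el G x g, conj_el G x h), b)) u"

definition wedge_act where "wedge_act x C = ext_class G (word_act x (SOME u. u \<in> C))"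

lemma ext_words_simps [simp]:
  "[] \<in> ext_words G"
  "((g, h), b) # u \<in> ext_words G \<longleftrightarrow> g \<in> carrier G \<and> h \<in> carrier G \<and> u \<in> ext_words G"
  "u @ v \<in> ext_words G \<longleftrightarrow> u \<in> ext_words G \<and> v \<in> ext_words G"
  by (simp_all add: ext_words_def ball_Un)

lemma word_inverse_simps [simp]:
  "word_inverse [] = []" "word_inverse ((s, b) # u) = word_inverse u @ [(s, \<not> b)]"
  by (simp_all add: word_inverse_def)

lemma word_act_simps [simp]:
  "word_act x [] = []"
  "word_act x (((g, h), b) # u) = ((conj_el G x g, conj_el G x h), b) # word_act x u"
  "word_act x (u @ v) = word_act x u @ word_act x v"
  by (simp_all add: word_act_def)

lemma ext_words_induct [consumes 1, case_names Nil Cons]: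
  assumes "u \<in> ext_words G" "P []"
    and "\<And>g h b u. \<lbrakk>g \<in> carrier G; h \<in> carrier G; u \<in> ext_words G; P u\<rbrakk> \<Longrightarrow> P (((g, h), b) # u)"
  shows "P u"
  using assms(1) by (induction u) (use assms(2,3) in auto)

lemma word_inverse_words [simp]: "u \<in> ext_words G \<Longrightarrow> word_inverse u \<in> ext_words G"
  by (induction rule: ext_words_induct) simp_all

lemma word_act_words [simp]: "\<lbrakk>x \<in> carrier G; u \<in> ext_words G\<rbrakk> \<Longrightarrow> word_act x u \<in> ext_words G"
  by (rotate_tac, induction rule: ext_words_induct) simp_all

lemma ext_rel_append:
  assumes "ext_rel G u u'" "ext_rel G v v'"
  shows "ext_rel G (u @ v) (u' @ v')"
  using ext_rel.cong[OF assms(1), of "[]" v] ext_rel.cong[OF assms(2), of u' "[]"]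
  by (auto intro: ext_rel.trans)

lemma ext_eval_closed [simp]: "u \<in> ext_words G \<Longrightarrow> ext_eval G u \<in> carrier G"
  by (induction rule: ext_words_induct) simp_all

lemma ext_eval_append:
  "\<lbrakk>u \<in> ext_words G; v \<in> ext_words G\<rbrakk> \<Longrightarrow> ext_eval G (u @ v) = ext_eval G u \<otimes> ext_eval G v"
  by (induction rule: ext_words_induct) (simp_all add: m_assoc)

text \<open>\<open>ext_rel\<close> also relates lists outside \<open>ext_words\<close>, through
  \<open>refl\<close> and \<open>cong\<close>, so membership is proved invariant together with the
  value.\<close>

lemma ext_rel_eval:
  "ext_rel G u v \<Longrightarrow> (u \<in> ext_words G \<longleftrightarrow> v \<in> ext_words G) \<and> (u \<in> ext_words G \<longrightarrow> ext_eval G u = ext_eval G v)"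
proof (induction rule: ext_rel.induct)
  case (cong u v a b) then show ?case by (auto simp: ext_eval_append)
next
  case (cancel g h b) then show ?case by (cases b) simp_all
next
  case (rel_left g g' h)
  then have "cm (g \<otimes> g') h = cm (conj_el G g g') (conj_el G g h) \<otimes> cm g h"
    by (simp add: word_simps)
  with rel_left show ?case by simp
next
  case (rel_right g h h')
  then have "cm g (h \<otimes> h') = cm g h \<otimes> cm (conj_el G h g) (conj_el G h h')"
    by (simp add: word_simps)
  with rel_right show ?case by simp
qed auto

lemma ext_rel_act:
  assumes "x \<in> carrier G"
  shows "ext_rel G u v \<Longrightarrow> ext_rel G (word_act x u) (word_act x v)"
proof (induction rule: ext_rel.induct)
  case (rel_left g g' h)
  then have "conj_el G x (conj_el G g y) = conj_el G (conj_el G x g) (conj_el G x y)" if "y \<in> carrier G" for y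
    using that assms by (simp add: word_simps)
  then show ?case using rel_left assms ext_rel.rel_left[of "conj_el G x g" G "conj_el G x g'" "conj_el G x h"]
    by (simp add: conj_mult)
next
  case (rel_right g h h')
  then have "conj_el G x (conj_el G h y) = conj_el G (conj_el G x h) (conj_el G x y)" if "y \<in> carrier G" for y
    using that assms by (simp add: word_simps)
  then show ?case using rel_right assms ext_rel.rel_right[of "conj_el G x g" G "conj_el G x h" "conj_el G x h'"]
    by (simp add: conj_mult)
qed (use assms in \<open>auto intro: ext_rel.intros\<close>)

lemma ext_class_eq_iff:
  assumes "u \<in> ext_words G" "v \<in> ext_words G"
  shows "ext_class G u = ext_class G v \<longleftrightarrow> ext_rel G u v"
proof
  assume "ext_class G u = ext_class G v"
  moreover have "v \<in> ext_class G v" using assms ext_rel.refl by (simp add: ext_class_def)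
  ultimately show "ext_rel G u v" by (auto simp: ext_class_def)
next
  assume "ext_rel G u v"
  then show "ext_class G u = ext_class G v"
    unfolding ext_class_def by (auto intro: ext_rel.trans ext_rel.sym)
qed

lemma some_in_ext_class:
  assumes "u \<in> ext_words G"
  shows "(SOME a. a \<in> ext_class G u) \<in> ext_words G" "ext_rel G u (SOME a. a \<in> ext_class G u)"
proof -
  have "u \<in> ext_class G u" using assms ext_rel.refl by (simp add: ext_class_def)
  then have "(SOME a. a \<in> ext_class G u) \<in> ext_class G u" by (rule someI)
  then show "(SOME a. a \<in> ext_class G u) \<in> ext_words G" "ext_rel G u (SOME a. a \<in> ext_class G u)"
    by (simp_all add: ext_class_def)
qed

lemma carrier_wedge: "carrier \<Lambda> = ext_class G ` ext_words G"
  and one_wedge: "\<one>\<^bsub>\<Lambda>\<^esub> = ext_class G []"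
  by (simp_all add: ext_square_def)

lemma mult_wedge:
  assumes "u \<in> ext_words G" "v \<in> ext_words G"
  shows "ext_class G u \<otimes>\<^bsub>\<Lambda>\<^esub> ext_class G v = ext_class G (u @ v)"
  using some_in_ext_class[OF assms(1)] some_in_ext_class[OF assms(2)] assms
  by (simp add: ext_square_def ext_class_eq_iff ext_rel.sym ext_rel_append)

lemma word_inverse_cancel: "u \<in> ext_words G \<Longrightarrow> ext_rel G (word_inverse u @ u) []"
proof (induction rule: ext_words_induct)
  case (Cons g h b u)
  have "ext_rel G [((g, h), \<not> b), ((g, h), b)] []"
    using ext_rel.cancel[OF Cons(1,2), of "\<not> b"] by simp
  from ext_rel.cong[OF this, of "word_inverse u" u] Cons(4) show ?case
    by (auto intro: ext_rel.trans)
qed (simp add: ext_rel.refl)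

lemma group_wedge: "group \<Lambda>"
proof (rule groupI)
  show "\<exists>y\<in>carrier \<Lambda>. y \<otimes>\<^bsub>\<Lambda>\<^esub> x = \<one>\<^bsub>\<Lambda>\<^esub>" if "x \<in> carrier \<Lambda>" for x
  proof -
    obtain u where u: "u \<in> ext_words G" "x = ext_class G u" using \<open>x \<in> carrier \<Lambda>\<close> carrier_wedge by auto
    have "ext_class G (word_inverse u) \<otimes>\<^bsub>\<Lambda>\<^esub> x = \<one>\<^bsub>\<Lambda>\<^esub>"
      using word_inverse_cancel[OF u(1)] u by (simp add: mult_wedge one_wedge ext_class_eq_iff)
    then show ?thesis using u carrier_wedge by auto
  qed
qed (auto simp: carrier_wedge one_wedge mult_wedge)

interpretation wedge: group \<Lambda> by (rule group_wedge)

lemma wedge_closed [simp]: "\<lbrakk>g \<in> carrier G; h \<in> carrier G\<rbrakk> \<Longrightarrow> wedge g h \<in> carrier \<Lambda>"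
  by (simp add: wedge_def carrier_wedge)

lemma ext_class_letter:
  assumes "g \<in> carrier G" "h \<in> carrier G"
  shows "ext_class G [((g, h), b)] = (if b then wedge g h else inv\<^bsub>\<Lambda>\<^esub> (wedge g h))"
proof (cases b)
  case False
  have "ext_class G [((g, h), False)] \<otimes>\<^bsub>\<Lambda>\<^esub> wedge g h = \<one>\<^bsub>\<Lambda>\<^esub>"
    using ext_rel.cancel[OF assms, of False] assms by (simp add: wedge_def mult_wedge one_wedge ext_class_eq_iff)
  then have "inv\<^bsub>\<Lambda>\<^esub> (wedge g h) = ext_class G [((g, h), False)]"
    using assms by (intro wedge.inv_equality) (simp_all add: carrier_wedge wedge_def)
  then show ?thesis using False by simp
qed (simp add: wedge_def)

lemma wedge_square_induct [consumes 1, case_names one generator inverse]: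
  assumes "m \<in> carrier \<Lambda>" "P \<one>\<^bsub>\<Lambda>\<^esub>"
    and "\<And>g h m. \<lbrakk>g \<in> carrier G; h \<in> carrier G; m \<in> carrier \<Lambda>; P m\<rbrakk> \<Longrightarrow> P (wedge g h \<otimes>\<^bsub>\<Lambda>\<^esub> m)"
    and "\<And>g h m. \<lbrakk>g \<in> carrier G; h \<in> carrier G; m \<in> carrier \<Lambda>; P m\<rbrakk> \<Longrightarrow> P (inv\<^bsub>\<Lambda>\<^esub> (wedge g h) \<otimes>\<^bsub>\<Lambda>\<^esub> m)"
  shows "P m"
proof -
  have "P (ext_class G u)" if "u \<in> ext_words G" for u
    using that
  proof (induction rule: ext_words_induct)
    case Nil then show ?case using assms(2) by (simp add: one_wedge)
  next
    case (Cons g h b u)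
    have "ext_class G (((g, h), b) # u) = ext_class G [((g, h), b)] \<otimes>\<^bsub>\<Lambda>\<^esub> ext_class G u"
      using Cons by (simp add: mult_wedge)
    then show ?case using Cons assms(3,4) by (cases b) (simp_all add: ext_class_letter carrier_wedge)
  qed
  then show ?thesis using assms(1) carrier_wedge by auto
qed

lemma wedge_mult_left:
  "\<lbrakk>g \<in> carrier G; g' \<in> carrier G; h \<in> carrier G\<rbrakk>
    \<Longrightarrow> wedge (g \<otimes> g') h = wedge (conj_el G g g') (conj_el G g h) \<otimes>\<^bsub>\<Lambda>\<^esub> wedge g h"
  using ext_rel.rel_left[of g G g' h] by (simp add: wedge_def mult_wedge ext_class_eq_iff)

lemma wedge_mult_right:
  "\<lbrakk>g \<in> carrier G; h \<in> carrier G; h' \<in> carrier G\<rbrakk>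
    \<Longrightarrow> wedge g (h \<otimes> h') = wedge g h \<otimes>\<^bsub>\<Lambda>\<^esub> wedge (conj_el G h g) (conj_el G h h')"
  using ext_rel.rel_right[of g G h h'] by (simp add: wedge_def mult_wedge ext_class_eq_iff)

lemma wedge_diag: "g \<in> carrier G \<Longrightarrow> wedge g g = \<one>\<^bsub>\<Lambda>\<^esub>"
  using ext_rel.rel_diag[of g G] by (simp add: wedge_def one_wedge ext_class_eq_iff)

lemma wedge_act_class:
  assumes "x \<in> carrier G" "u \<in> ext_words G"
  shows "wedge_act x (ext_class G u) = ext_class G (word_act x u)"
  using some_in_ext_class[OF assms(2)] assms
  by (simp add: wedge_act_def ext_class_eq_iff ext_rel.sym ext_rel_act)

lemma wedge_act_hom: "x \<in> carrier G \<Longrightarrow> wedge_act x \<in> hom \<Lambda> \<Lambda>"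
  by (rule homI) (auto simp: carrier_wedge wedge_act_class mult_wedge)

lemma wedge_act_wedge:
  "\<lbrakk>x \<in> carrier G; g \<in> carrier G; h \<in> carrier G\<rbrakk>
    \<Longrightarrow> wedge_act x (wedge g h) = wedge (conj_el G x g) (conj_el G x h)"
  by (simp add: wedge_def wedge_act_class)

lemma ext_comm_map_class: "u \<in> ext_words G \<Longrightarrow> ext_comm_map G (ext_class G u) = ext_eval G u"
  using some_in_ext_class[of u] ext_rel_eval[of u] by (simp add: ext_comm_map_def)

lemma ext_comm_map_hom: "ext_comm_map G \<in> hom \<Lambda> G"
  by (rule homI) (auto simp: carrier_wedge ext_comm_map_class mult_wedge ext_eval_append)

lemma ext_comm_map_wedge:
  "\<lbrakk>g \<in> carrier G; h \<in> carrier G\<rbrakk> \<Longrightarrow> ext_comm_map G (wedge g h) = cm g h"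
  by (simp add: wedge_def ext_comm_map_class)


section \<open>The crossed module \<open>G \<and> G \<rightarrow> G\<close>\<close>

lemma wedge_act_closed [simp]: "\<lbrakk>x \<in> carrier G; m \<in> carrier \<Lambda>\<rbrakk> \<Longrightarrow> wedge_act x m \<in> carrier \<Lambda>"
  using wedge_act_hom by (auto simp: hom_def)

lemma group_hom_wedge_act: "x \<in> carrier G \<Longrightarrow> group_hom \<Lambda> \<Lambda> (wedge_act x)"
  by (simp add: group_hom_def group_hom_axioms_def wedge_act_hom group_wedge)

lemma group_hom_ext_comm_map: "group_hom \<Lambda> G (ext_comm_map G)"
  by (simp add: group_hom_def group_hom_axioms_def ext_comm_map_hom group_wedge is_group)

lemma wedge_act_mult:
  "\<lbrakk>x \<in> carrier G; m \<in> carrier \<Lambda>; n \<in> carrier \<Lambda>\<rbrakk>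
    \<Longrightarrow> wedge_act x (m \<otimes>\<^bsub>\<Lambda>\<^esub> n) = wedge_act x m \<otimes>\<^bsub>\<Lambda>\<^esub> wedge_act x n"
  using wedge_act_hom by (auto simp: hom_def)

lemma wedge_act_inv:
  "\<lbrakk>x \<in> carrier G; m \<in> carrier \<Lambda>\<rbrakk> \<Longrightarrow> wedge_act x (inv\<^bsub>\<Lambda>\<^esub> m) = inv\<^bsub>\<Lambda>\<^esub> (wedge_act x m)"
  by (rule group_hom.hom_inv[OF group_hom_wedge_act])

lemma wedge_act_comp:
  assumes "x \<in> carrier G" "y \<in> carrier G" "m \<in> carrier \<Lambda>"
  shows "wedge_act (x \<otimes> y) m = wedge_act x (wedge_act y m)"
  using assms(3)
proof (induction rule: wedge_square_induct)
  case one then show ?case using assms by (simp add: group_hom.hom_one[OF group_hom_wedge_act])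
qed (use assms in \<open>simp_all add: wedge_act_mult wedge_act_inv wedge_act_wedge conj_conj\<close>)

lemma wedge_act_one:
  assumes "m \<in> carrier \<Lambda>"
  shows "wedge_act \<one> m = m"
  using assms
proof (induction rule: wedge_square_induct)
  case one then show ?case by (simp add: group_hom.hom_one[OF group_hom_wedge_act])
qed (simp_all add: wedge_act_mult wedge_act_inv wedge_act_wedge conj_el_def)

lemma wedge_mult_left':
  "\<lbrakk>g \<in> carrier G; g' \<in> carrier G; h \<in> carrier G\<rbrakk>
    \<Longrightarrow> wedge (g \<otimes> g') h = wedge_act g (wedge g' h) \<otimes>\<^bsub>\<Lambda>\<^esub> wedge g h"
  by (simp add: wedge_mult_left wedge_act_wedge)

lemma wedge_mult_right':
  "\<lbrakk>g \<in> carrier G; h \<in> carrier G; h' \<in> carrier G\<rbrakk>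
    \<Longrightarrow> wedge g (h \<otimes> h') = wedge g h \<otimes>\<^bsub>\<Lambda>\<^esub> wedge_act h (wedge g h')"
  by (simp add: wedge_mult_right wedge_act_wedge)

lemma wedge_one_left: "h \<in> carrier G \<Longrightarrow> wedge \<one> h = \<one>\<^bsub>\<Lambda>\<^esub>"
  using wedge_mult_left[of \<one> \<one> h] by (simp add: conj_el_def)

lemma wedge_one_right: "h \<in> carrier G \<Longrightarrow> wedge h \<one> = \<one>\<^bsub>\<Lambda>\<^esub>"
  using wedge_mult_right[of h \<one> \<one>] by (simp add: conj_el_def)

text \<open>Both relations expand the trivial element \<open>hg \<and> hg\<close> into the image of
  this product under \<open>h\<close>, and \<open>h\<close> acts invertibly.\<close>

lemma wedge_swap:
  assumes [simp]: "g \<in> carrier G" "h \<in> carrier G"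
  shows "wedge g h \<otimes>\<^bsub>\<Lambda>\<^esub> wedge h g = \<one>\<^bsub>\<Lambda>\<^esub>"
proof -
  interpret a: group_hom \<Lambda> \<Lambda> "wedge_act h" by (rule group_hom_wedge_act) simp
  have "\<one>\<^bsub>\<Lambda>\<^esub> = wedge (h \<otimes> g) (h \<otimes> g)" by (simp add: wedge_diag)
  also have "\<dots> = wedge_act h (wedge g (h \<otimes> g)) \<otimes>\<^bsub>\<Lambda>\<^esub> wedge h (h \<otimes> g)"
    by (simp add: wedge_mult_left' del: wedge_diag)
  also have "wedge g (h \<otimes> g) = wedge g h"
    by (simp add: wedge_mult_right' wedge_diag)
  also have "wedge h (h \<otimes> g) = wedge_act h (wedge h g)"
    by (simp add: wedge_mult_right' wedge_diag)
  finally have e: "wedge_act h (wedge g h \<otimes>\<^bsub>\<Lambda>\<^esub> wedge h g) = \<one>\<^bsub>\<Lambda>\<^esub>" by (simp add: wedge_act_mult)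
  have "wedge g h \<otimes>\<^bsub>\<Lambda>\<^esub> wedge h g = wedge_act (inv h) (wedge_act h (wedge g h \<otimes>\<^bsub>\<Lambda>\<^esub> wedge h g))"
    by (subst wedge_act_comp[symmetric]) (simp_all add: wedge_act_one)
  also have "\<dots> = \<one>\<^bsub>\<Lambda>\<^esub>" unfolding e by (simp add: group_hom.hom_one[OF group_hom_wedge_act])
  finally show ?thesis .
qed

lemma inv_wedge: "\<lbrakk>g \<in> carrier G; h \<in> carrier G\<rbrakk> \<Longrightarrow> inv\<^bsub>\<Lambda>\<^esub> (wedge g h) = wedge h g"
  using wedge_swap[of h g] by (simp add: wedge.inv_equality)

text \<open>Expanding \<open>(g \<otimes> g') \<and> (h \<otimes> h')\<close> in the two possible orders.\<close>

lemma wedge_conj_act: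
  assumes [simp]: "g \<in> carrier G" "h \<in> carrier G" and m: "m \<in> carrier \<Lambda>"
  shows "wedge_act (g \<otimes> h) m \<otimes>\<^bsub>\<Lambda>\<^esub> wedge g h = wedge g h \<otimes>\<^bsub>\<Lambda>\<^esub> wedge_act (h \<otimes> g) m"
proof -
  have gen: "wedge_act (g \<otimes> h) (wedge g' h') \<otimes>\<^bsub>\<Lambda>\<^esub> wedge g h =
      wedge g h \<otimes>\<^bsub>\<Lambda>\<^esub> wedge_act (h \<otimes> g) (wedge g' h')"
    if [simp]: "g' \<in> carrier G" "h' \<in> carrier G" for g' h'
  proof -
    let ?a = "wedge_act g (wedge g' h)" and ?b = "wedge_act h (wedge g h')"
    have "wedge (g \<otimes> g') (h \<otimes> h') = ?a \<otimes>\<^bsub>\<Lambda>\<^esub> ((wedge_act (g \<otimes> h) (wedge g' h') \<otimes>\<^bsub>\<Lambda>\<^esub> wedge g h) \<otimes>\<^bsub>\<Lambda>\<^esub> ?b)"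
      by (subst wedge_mult_left') (simp_all add: wedge_mult_right' wedge_act_mult wedge_act_comp wedge.m_assoc)
    moreover have "wedge (g \<otimes> g') (h \<otimes> h') = ?a \<otimes>\<^bsub>\<Lambda>\<^esub> ((wedge g h \<otimes>\<^bsub>\<Lambda>\<^esub> wedge_act (h \<otimes> g) (wedge g' h')) \<otimes>\<^bsub>\<Lambda>\<^esub> ?b)"
      by (subst wedge_mult_right') (simp_all add: wedge_mult_left' wedge_act_mult wedge_act_comp wedge.m_assoc)
    ultimately show ?thesis by simp
  qed
  have step: "wedge_act (g \<otimes> h) (a \<otimes>\<^bsub>\<Lambda>\<^esub> b) \<otimes>\<^bsub>\<Lambda>\<^esub> wedge g h = wedge g h \<otimes>\<^bsub>\<Lambda>\<^esub> wedge_act (h \<otimes> g) (a \<otimes>\<^bsub>\<Lambda>\<^esub> b)"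
    if [simp]: "a \<in> carrier \<Lambda>" "b \<in> carrier \<Lambda>"
      and a: "wedge_act (g \<otimes> h) a \<otimes>\<^bsub>\<Lambda>\<^esub> wedge g h = wedge g h \<otimes>\<^bsub>\<Lambda>\<^esub> wedge_act (h \<otimes> g) a"
      and b: "wedge_act (g \<otimes> h) b \<otimes>\<^bsub>\<Lambda>\<^esub> wedge g h = wedge g h \<otimes>\<^bsub>\<Lambda>\<^esub> wedge_act (h \<otimes> g) b" for a b
  proof -
    have "wedge_act (g \<otimes> h) (a \<otimes>\<^bsub>\<Lambda>\<^esub> b) \<otimes>\<^bsub>\<Lambda>\<^esub> wedge g h =
        wedge_act (g \<otimes> h) a \<otimes>\<^bsub>\<Lambda>\<^esub> (wedge_act (g \<otimes> h) b \<otimes>\<^bsub>\<Lambda>\<^esub> wedge g h)"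
      by (simp add: wedge_act_mult wedge.m_assoc)
    also have "\<dots> = (wedge_act (g \<otimes> h) a \<otimes>\<^bsub>\<Lambda>\<^esub> wedge g h) \<otimes>\<^bsub>\<Lambda>\<^esub> wedge_act (h \<otimes> g) b"
      unfolding b by (simp add: wedge.m_assoc)
    also have "\<dots> = wedge g h \<otimes>\<^bsub>\<Lambda>\<^esub> wedge_act (h \<otimes> g) (a \<otimes>\<^bsub>\<Lambda>\<^esub> b)"
      unfolding a by (simp add: wedge_act_mult wedge.m_assoc)
    finally show ?thesis .
  qed
  from m show ?thesis
  proof (induction rule: wedge_square_induct)
    case one then show ?case by (simp add: group_hom.hom_one[OF group_hom_wedge_act])
  next
    case (generator a b n) then show ?case by (intro step gen) auto
  next
    case (inverse a b n) then show ?case unfolding inv_wedge[OF inverse(1,2)] by (intro step gen) auto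
  qed
qed

text \<open>\<open>wedge_conj_act\<close>, applied to the element that \<open>h \<otimes> g\<close>
  moves to \<open>m\<close>.\<close>

lemma wedge_conj_wedge:
  assumes [simp]: "g \<in> carrier G" "h \<in> carrier G" "m \<in> carrier \<Lambda>"
  shows "wedge g h \<otimes>\<^bsub>\<Lambda>\<^esub> m = wedge_act (cm g h) m \<otimes>\<^bsub>\<Lambda>\<^esub> wedge g h"
proof -
  have "wedge_act (h \<otimes> g) (wedge_act (inv (h \<otimes> g)) m) = m"
    by (subst wedge_act_comp[symmetric]) (simp_all add: wedge_act_one)
  moreover have "wedge_act (g \<otimes> h) (wedge_act (inv (h \<otimes> g)) m) = wedge_act (cm g h) m"
    by (subst wedge_act_comp[symmetric]) (simp_all add: word_simps)
  ultimately show ?thesis using wedge_conj_act[of g h "wedge_act (inv (h \<otimes> g)) m"] by simp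
qed

text \<open>The second crossed module axiom, with \<open>ext_comm_map\<close> as boundary; it
  spreads from symbols to products by \<open>wedge_conj_wedge\<close>.\<close>

lemma Peiffer:
  assumes n: "n \<in> carrier \<Lambda>" and [simp]: "m \<in> carrier \<Lambda>"
  shows "n \<otimes>\<^bsub>\<Lambda>\<^esub> m = wedge_act (ext_comm_map G n) m \<otimes>\<^bsub>\<Lambda>\<^esub> n"
proof -
  interpret d: group_hom \<Lambda> G "ext_comm_map G" by (rule group_hom_ext_comm_map)
  have w: "(wedge g h \<otimes>\<^bsub>\<Lambda>\<^esub> a) \<otimes>\<^bsub>\<Lambda>\<^esub> m = wedge_act (ext_comm_map G (wedge g h \<otimes>\<^bsub>\<Lambda>\<^esub> a)) m \<otimes>\<^bsub>\<Lambda>\<^esub> (wedge g h \<otimes>\<^bsub>\<Lambda>\<^esub> a)"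
    if [simp]: "g \<in> carrier G" "h \<in> carrier G" "a \<in> carrier \<Lambda>"
      and a: "a \<otimes>\<^bsub>\<Lambda>\<^esub> m = wedge_act (ext_comm_map G a) m \<otimes>\<^bsub>\<Lambda>\<^esub> a" for g h a
  proof -
    have "(wedge g h \<otimes>\<^bsub>\<Lambda>\<^esub> a) \<otimes>\<^bsub>\<Lambda>\<^esub> m = (wedge g h \<otimes>\<^bsub>\<Lambda>\<^esub> wedge_act (ext_comm_map G a) m) \<otimes>\<^bsub>\<Lambda>\<^esub> a"
      by (simp add: wedge.m_assoc a)
    also have "wedge g h \<otimes>\<^bsub>\<Lambda>\<^esub> wedge_act (ext_comm_map G a) m =
       wedge_act (ext_comm_map G (wedge g h \<otimes>\<^bsub>\<Lambda>\<^esub> a)) m \<otimes>\<^bsub>\<Lambda>\<^esub> wedge g h"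
      by (subst wedge_conj_wedge) (simp_all add: wedge_act_comp ext_comm_map_wedge)
    finally show ?thesis by (simp add: wedge.m_assoc)
  qed
  from n show ?thesis
  proof (induction rule: wedge_square_induct)
    case one then show ?case by (simp add: wedge_act_one)
  next
    case (inverse g h a) then show ?case unfolding inv_wedge[OF inverse(1,2)] by (intro w) auto
  qed (rule w)
qed

text \<open>Two expansions of \<open>a \<and> hb\<close>, the second one after writing
  \<open>hb\<close> as \<open>b\<close> times the conjugate of \<open>h\<close> by the inverse of
  \<open>b\<close>.\<close>

lemma act_wedge_eq:
  assumes [simp]: "a \<in> carrier G" "b \<in> carrier G" "h \<in> carrier G"
  shows "wedge_act h (wedge a b) = wedge a b \<otimes>\<^bsub>\<Lambda>\<^esub> wedge (cm b a) h"
proof -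
  have "h \<otimes> b = b \<otimes> conj_el G (inv b) h" by (simp add: word_simps)
  moreover have "conj_el G b (conj_el G (inv b) h) = h" by (simp add: word_simps)
  ultimately have "wedge a h \<otimes>\<^bsub>\<Lambda>\<^esub> wedge_act h (wedge a b) = wedge a b \<otimes>\<^bsub>\<Lambda>\<^esub> wedge (conj_el G b a) h"
    using wedge_mult_right'[of a h b] wedge_mult_right[of a b "conj_el G (inv b) h"] by simp
  also have "wedge (conj_el G b a) h = wedge_act (cm b a) (wedge a h) \<otimes>\<^bsub>\<Lambda>\<^esub> wedge (cm b a) h"
    by (simp add: conj_eq_comm wedge_mult_left')
  also have "wedge_act (cm b a) (wedge a h) = wedge b a \<otimes>\<^bsub>\<Lambda>\<^esub> (wedge a h \<otimes>\<^bsub>\<Lambda>\<^esub> wedge a b)"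
  proof -
    have "wedge b a \<otimes>\<^bsub>\<Lambda>\<^esub> (wedge a h \<otimes>\<^bsub>\<Lambda>\<^esub> wedge a b) = (wedge b a \<otimes>\<^bsub>\<Lambda>\<^esub> wedge a h) \<otimes>\<^bsub>\<Lambda>\<^esub> wedge a b"
      by (simp add: wedge.m_assoc)
    also have "\<dots> = wedge_act (cm b a) (wedge a h) \<otimes>\<^bsub>\<Lambda>\<^esub> (wedge b a \<otimes>\<^bsub>\<Lambda>\<^esub> wedge a b)"
      by (simp add: wedge_conj_wedge wedge.m_assoc)
    finally show ?thesis by (simp add: wedge_swap)
  qed
  also have "wedge a b \<otimes>\<^bsub>\<Lambda>\<^esub> ((wedge b a \<otimes>\<^bsub>\<Lambda>\<^esub> (wedge a h \<otimes>\<^bsub>\<Lambda>\<^esub> wedge a b)) \<otimes>\<^bsub>\<Lambda>\<^esub> wedge (cm b a) h) =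
      (wedge a b \<otimes>\<^bsub>\<Lambda>\<^esub> wedge b a) \<otimes>\<^bsub>\<Lambda>\<^esub> (wedge a h \<otimes>\<^bsub>\<Lambda>\<^esub> (wedge a b \<otimes>\<^bsub>\<Lambda>\<^esub> wedge (cm b a) h))"
    by (simp add: wedge.m_assoc)
  finally show ?thesis by (simp add: wedge_swap)
qed

text \<open>On symbols this is \<open>act_wedge_eq\<close> solved for the wedge of the commutator.
  With the Peiffer identity it yields the commutator formula of a cover for
  \<open>G \<and> G\<close> itself.\<close>

lemma wedge_boundary_left:
  assumes n: "n \<in> carrier \<Lambda>" and [simp]: "h \<in> carrier G"
  shows "wedge (ext_comm_map G n) h = n \<otimes>\<^bsub>\<Lambda>\<^esub> inv\<^bsub>\<Lambda>\<^esub> (wedge_act h n)"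
proof -
  interpret d: group_hom \<Lambda> G "ext_comm_map G" by (rule group_hom_ext_comm_map)
  have gen: "wedge (cm a b) h = wedge a b \<otimes>\<^bsub>\<Lambda>\<^esub> inv\<^bsub>\<Lambda>\<^esub> (wedge_act h (wedge a b))"
    if [simp]: "a \<in> carrier G" "b \<in> carrier G" for a b
  proof -
    have "wedge (cm a b) h = inv\<^bsub>\<Lambda>\<^esub> (wedge b a) \<otimes>\<^bsub>\<Lambda>\<^esub> wedge_act h (wedge b a)"
      by (simp add: act_wedge_eq)
    also have "wedge_act h (wedge b a) = inv\<^bsub>\<Lambda>\<^esub> (wedge_act h (wedge a b))"
      by (simp flip: inv_wedge[of a b] add: wedge_act_inv)
    finally show ?thesis by (simp add: inv_wedge)
  qed
  have step: "wedge (ext_comm_map G (wedge a b \<otimes>\<^bsub>\<Lambda>\<^esub> m)) h =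
      (wedge a b \<otimes>\<^bsub>\<Lambda>\<^esub> m) \<otimes>\<^bsub>\<Lambda>\<^esub> inv\<^bsub>\<Lambda>\<^esub> (wedge_act h (wedge a b \<otimes>\<^bsub>\<Lambda>\<^esub> m))"
    if [simp]: "a \<in> carrier G" "b \<in> carrier G" "m \<in> carrier \<Lambda>"
      and m: "wedge (ext_comm_map G m) h = m \<otimes>\<^bsub>\<Lambda>\<^esub> inv\<^bsub>\<Lambda>\<^esub> (wedge_act h m)" for a b m
  proof -
    let ?w = "wedge a b"
    have "wedge (ext_comm_map G (?w \<otimes>\<^bsub>\<Lambda>\<^esub> m)) h =
        wedge_act (cm a b) (wedge (ext_comm_map G m) h) \<otimes>\<^bsub>\<Lambda>\<^esub> (?w \<otimes>\<^bsub>\<Lambda>\<^esub> inv\<^bsub>\<Lambda>\<^esub> (wedge_act h ?w))"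
      by (simp add: ext_comm_map_wedge wedge_mult_left' gen)
    also have "\<dots> = (?w \<otimes>\<^bsub>\<Lambda>\<^esub> wedge (ext_comm_map G m) h) \<otimes>\<^bsub>\<Lambda>\<^esub> inv\<^bsub>\<Lambda>\<^esub> (wedge_act h ?w)"
      by (simp add: wedge_conj_wedge wedge.m_assoc)
    finally show ?thesis by (simp add: m wedge_act_mult wedge.m_assoc wedge.inv_mult_group)
  qed
  from n show ?thesis
  proof (induction rule: wedge_square_induct)
    case one then show ?case by (simp add: wedge_one_left group_hom.hom_one[OF group_hom_wedge_act])
  next
    case (inverse a b m) then show ?case unfolding inv_wedge[OF inverse(1,2)] by (intro step) auto
  qed (rule step)
qed

lemma wedge_boundary_right:
  assumes "n \<in> carrier \<Lambda>" "h \<in> carrier G"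
  shows "wedge h (ext_comm_map G n) = wedge_act h n \<otimes>\<^bsub>\<Lambda>\<^esub> inv\<^bsub>\<Lambda>\<^esub> n"
proof -
  interpret d: group_hom \<Lambda> G "ext_comm_map G" by (rule group_hom_ext_comm_map)
  have "wedge h (ext_comm_map G n) = inv\<^bsub>\<Lambda>\<^esub> (wedge (ext_comm_map G n) h)"
    using assms by (simp add: inv_wedge)
  then show ?thesis using assms by (simp add: wedge_boundary_left wedge.inv_mult_group)
qed

end

section \<open>Central extensions with commutator subgroup the exterior square\<close>

text \<open>\<open>E\<close> extends the subgroup \<open>l ` E\<close> of \<open>G\<close>, centrally by the last axiom, and the commutator formula makes
  the image of \<open>i\<close> contain \<open>[E, E]\<close>. Covers of larger and larger subgroups are built by adjoining one cyclic
  subgroup \<open>C\<close> at a time, acting on \<open>E\<close> by \<open>lift\<close>.\<close>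

locale wedge_cover = group G + E: group E for G (structure) and E :: "'x monoid" (structure) +
  fixes l :: "'x \<Rightarrow> 'a" and i :: "'a ext_word set \<Rightarrow> 'x"
  assumes l_hom: "l \<in> hom E G"
    and i_hom: "i \<in> hom \<Lambda> E"
    and i_inj: "inj_on i (carrier \<Lambda>)"
    and l_i: "m \<in> carrier \<Lambda> \<Longrightarrow> l (i m) = ext_comm_map G m"
    and comm_eq: "\<lbrakk>z \<in> carrier E; z' \<in> carrier E\<rbrakk> \<Longrightarrow> grp_comm E z z' = i (wedge (l z) (l z'))"
begin

interpretation wedge: group \<Lambda> by (rule group_wedge)
interpretation l: group_hom E G l
  by (simp add: group_hom_def group_hom_axioms_def l_hom E.is_group is_group)
interpretation i: group_hom \<Lambda> E i
  by (simp add: group_hom_def group_hom_axioms_def i_hom E.is_group group_wedge)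

lemma mult_i:
  assumes [simp]: "z \<in> carrier E" "m \<in> carrier \<Lambda>"
  shows "z \<otimes>\<^bsub>E\<^esub> i m = i (wedge_act (l z) m) \<otimes>\<^bsub>E\<^esub> z"
proof -
  have "grp_comm E z (i m) = i (wedge_act (l z) m) \<otimes>\<^bsub>E\<^esub> inv\<^bsub>E\<^esub> (i m)"
    by (simp add: comm_eq l_i wedge_boundary_right)
  then show ?thesis using E.comm_swap[of z "i m"] by (simp add: E.m_assoc)
qed

lemma mult_swap:
  "\<lbrakk>z \<in> carrier E; z' \<in> carrier E\<rbrakk> \<Longrightarrow> z \<otimes>\<^bsub>E\<^esub> z' = i (wedge (l z) (l z')) \<otimes>\<^bsub>E\<^esub> (z' \<otimes>\<^bsub>E\<^esub> z)"
  using E.comm_swap comm_eq by metis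

text \<open>If \<open>h = l y\<close>, then conjugating \<open>z\<close> by \<open>y\<close> gives
  \<open>[y, z] z\<close>, which is this element. The formula makes sense for every \<open>h\<close>
  in \<open>G\<close>, so it extends conjugation beyond the image of \<open>l\<close>.\<close>

definition lift where "lift h z = i (wedge h (l z)) \<otimes>\<^bsub>E\<^esub> z"

lemma lift_closed [simp]: "\<lbrakk>h \<in> carrier G; z \<in> carrier E\<rbrakk> \<Longrightarrow> lift h z \<in> carrier E"
  by (simp add: lift_def)

lemma lift_mult:
  assumes [simp]: "h \<in> carrier G" "z \<in> carrier E" "z' \<in> carrier E"
  shows "lift h (z \<otimes>\<^bsub>E\<^esub> z') = lift h z \<otimes>\<^bsub>E\<^esub> lift h z'"
proof -
  have "lift h z \<otimes>\<^bsub>E\<^esub> lift h z' = i (wedge h (l z)) \<otimes>\<^bsub>E\<^esub> (z \<otimes>\<^bsub>E\<^esub> i (wedge h (l z'))) \<otimes>\<^bsub>E\<^esub> z'"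
    by (simp add: lift_def E.m_assoc)
  also have "z \<otimes>\<^bsub>E\<^esub> i (wedge h (l z')) = i (wedge_act (l z) (wedge h (l z'))) \<otimes>\<^bsub>E\<^esub> z" by (rule mult_i) simp_all
  finally show ?thesis by (simp add: lift_def wedge_mult_right' E.m_assoc)
qed

lemma l_lift: "\<lbrakk>h \<in> carrier G; z \<in> carrier E\<rbrakk> \<Longrightarrow> l (lift h z) = conj_el G h (l z)"
  by (simp add: lift_def l_i ext_comm_map_wedge conj_eq_comm)

lemma lift_comp:
  assumes [simp]: "h \<in> carrier G" "h' \<in> carrier G" "z \<in> carrier E"
  shows "lift (h \<otimes> h') z = lift h (lift h' z)"
proof -
  let ?n = "wedge h' (l z)" and ?w = "wedge h (l z)"
  have "wedge h (cm h' (l z) \<otimes> l z) \<otimes>\<^bsub>\<Lambda>\<^esub> ?n = wedge_act h ?n \<otimes>\<^bsub>\<Lambda>\<^esub> inv\<^bsub>\<Lambda>\<^esub> ?n \<otimes>\<^bsub>\<Lambda>\<^esub> (wedge_act (cm h' (l z)) ?w \<otimes>\<^bsub>\<Lambda>\<^esub> ?n)"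
    using wedge_boundary_right[of ?n h] by (simp add: wedge_mult_right' ext_comm_map_wedge wedge.m_assoc)
  also have "wedge_act (cm h' (l z)) ?w \<otimes>\<^bsub>\<Lambda>\<^esub> ?n = ?n \<otimes>\<^bsub>\<Lambda>\<^esub> ?w" by (simp add: wedge_conj_wedge)
  finally have "wedge h (cm h' (l z) \<otimes> l z) \<otimes>\<^bsub>\<Lambda>\<^esub> ?n = wedge_act h ?n \<otimes>\<^bsub>\<Lambda>\<^esub> ?w"
    by (simp add: wedge.m_assoc)
  moreover have "lift h (lift h' z) = i (wedge h (cm h' (l z) \<otimes> l z) \<otimes>\<^bsub>\<Lambda>\<^esub> ?n) \<otimes>\<^bsub>E\<^esub> z"
    by (simp add: lift_def l_i ext_comm_map_wedge E.m_assoc)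
  ultimately show ?thesis by (simp add: lift_def wedge_mult_left')
qed

lemma lift_one_left: "z \<in> carrier E \<Longrightarrow> lift \<one> z = z"
  by (simp add: lift_def wedge_one_left)

definition semidirect :: "'a set \<Rightarrow> ('x \<times> 'a) monoid" where
  "semidirect C = \<lparr>carrier = carrier E \<times> C,
     monoid.mult = (\<lambda>(z, h) (z', h'). (z \<otimes>\<^bsub>E\<^esub> lift h z', h \<otimes> h')), one = (\<one>\<^bsub>E\<^esub>, \<one>)\<rparr>"

lemma semidirect_group:
  assumes C: "subgroup C G"
  shows "group (semidirect C)"
proof (rule groupI)
  interpret C: subgroup C G by (rule C)
  show "\<exists>y\<in>carrier (semidirect C). y \<otimes>\<^bsub>semidirect C\<^esub> x = \<one>\<^bsub>semidirect C\<^esub>" if xC: "x \<in> carrier (semidirect C)" for x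
  proof -
    obtain z h where x: "x = (z, h)" "z \<in> carrier E" "h \<in> C" using xC by (auto simp: semidirect_def)
    then have "(inv\<^bsub>E\<^esub> (lift (inv h) z), inv h) \<otimes>\<^bsub>semidirect C\<^esub> x = \<one>\<^bsub>semidirect C\<^esub>"
      by (simp add: semidirect_def)
    moreover have "(inv\<^bsub>E\<^esub> (lift (inv h) z), inv h) \<in> carrier (semidirect C)"
      using x by (simp add: semidirect_def)
    ultimately show ?thesis by blast
  qed
qed (use C in \<open>auto simp: semidirect_def lift_mult lift_comp lift_one_left E.m_assoc m_assoc
  subgroup.m_closed subgroup.one_closed subgroup.mem_carrier\<close>)

text \<open>In the semidirect product the commutator of two elements of \<open>C\<close> is their
  commutator in \<open>C\<close>, while the cover axiom asks for the image of their wedge. Both are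
  trivial under the two hypotheses, which cyclic subgroups satisfy.\<close>

lemma semidirect_cover:
  assumes C: "subgroup C G" and w: "\<And>h h'. \<lbrakk>h \<in> C; h' \<in> C\<rbrakk> \<Longrightarrow> wedge h h' = \<one>\<^bsub>\<Lambda>\<^esub>"
    and comm: "\<And>h h'. \<lbrakk>h \<in> C; h' \<in> C\<rbrakk> \<Longrightarrow> h \<otimes> h' = h' \<otimes> h"
  shows "wedge_cover G (semidirect C) (\<lambda>(z, h). l z \<otimes> h) (\<lambda>m. (i m, \<one>))"
proof -
  interpret C: subgroup C G by (rule C)
  interpret S: group "semidirect C" by (rule semidirect_group[OF C])
  let ?l = "\<lambda>(z, h). l z \<otimes> h" and ?i = "\<lambda>m. (i m, \<one>)"
  show ?thesis
  proof unfold_locales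
    show "?l \<in> hom (semidirect C) G"
      by (rule homI) (auto simp: semidirect_def l_lift word_simps)
    show "?i \<in> hom \<Lambda> (semidirect C)"
      by (rule homI) (simp_all add: semidirect_def lift_one_left)
    show "inj_on ?i (carrier \<Lambda>)" using i_inj by (auto simp: inj_on_def)
    show "?l (?i m) = ext_comm_map G m" if "m \<in> carrier \<Lambda>" for m
      using that group_hom.hom_closed[OF group_hom_ext_comm_map] by (simp add: l_i)
    show "grp_comm (semidirect C) x y = ?i (wedge (?l x) (?l y))"
      if xy: "x \<in> carrier (semidirect C)" "y \<in> carrier (semidirect C)" for x y
    proof -
      obtain z h z' h' where x: "x = (z, h)" "z \<in> carrier E" "h \<in> C" and y: "y = (z', h')" "z' \<in> carrier E" "h' \<in> C"
        using xy by (auto simp: semidirect_def)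
      note [simp] = x(2) y(2) x(3) y(3) C.mem_carrier[OF x(3)] C.mem_carrier[OF y(3)]
      let ?w = "wedge (l z \<otimes> h) (l z' \<otimes> h')"
      \<comment> \<open>The \<open>E\<close>-components of \<open>x y\<close> and
        \<open>[x, y] y x\<close> are compared; moving all images of \<open>i\<close> to the left
        reduces this to an identity between wedges.\<close>
      have "?w \<otimes>\<^bsub>\<Lambda>\<^esub> wedge_act (l z') (wedge h' (l z)) =
         wedge (l z \<otimes> h) (l z') \<otimes>\<^bsub>\<Lambda>\<^esub> wedge_act (l z') (wedge (l z \<otimes> h) h' \<otimes>\<^bsub>\<Lambda>\<^esub> wedge h' (l z))"
        by (subst wedge_mult_right') (simp_all add: wedge_act_mult wedge.m_assoc)
      also have "wedge (l z \<otimes> h) h' \<otimes>\<^bsub>\<Lambda>\<^esub> wedge h' (l z) = \<one>\<^bsub>\<Lambda>\<^esub>"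
        by (simp add: wedge_mult_left' w wedge_swap group_hom.hom_one[OF group_hom_wedge_act])
      finally have ww: "?w \<otimes>\<^bsub>\<Lambda>\<^esub> wedge_act (l z') (wedge h' (l z)) = wedge_act (l z) (wedge h (l z')) \<otimes>\<^bsub>\<Lambda>\<^esub> wedge (l z) (l z')"
        by (simp add: group_hom.hom_one[OF group_hom_wedge_act] wedge_mult_left')
      have "i ?w \<otimes>\<^bsub>E\<^esub> (z' \<otimes>\<^bsub>E\<^esub> lift h' z) = i ?w \<otimes>\<^bsub>E\<^esub> (z' \<otimes>\<^bsub>E\<^esub> i (wedge h' (l z))) \<otimes>\<^bsub>E\<^esub> z"
        by (simp add: lift_def E.m_assoc)
      also have "z' \<otimes>\<^bsub>E\<^esub> i (wedge h' (l z)) = i (wedge_act (l z') (wedge h' (l z))) \<otimes>\<^bsub>E\<^esub> z'"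
        by (rule mult_i) simp_all
      also have "i ?w \<otimes>\<^bsub>E\<^esub> (i (wedge_act (l z') (wedge h' (l z))) \<otimes>\<^bsub>E\<^esub> z') \<otimes>\<^bsub>E\<^esub> z =
          i (?w \<otimes>\<^bsub>\<Lambda>\<^esub> wedge_act (l z') (wedge h' (l z))) \<otimes>\<^bsub>E\<^esub> (z' \<otimes>\<^bsub>E\<^esub> z)"
        by (simp add: E.m_assoc)
      also have "\<dots> = i (wedge_act (l z) (wedge h (l z'))) \<otimes>\<^bsub>E\<^esub> (i (wedge (l z) (l z')) \<otimes>\<^bsub>E\<^esub> (z' \<otimes>\<^bsub>E\<^esub> z))"
        unfolding ww by (simp add: E.m_assoc)
      also have "\<dots> = i (wedge_act (l z) (wedge h (l z'))) \<otimes>\<^bsub>E\<^esub> (z \<otimes>\<^bsub>E\<^esub> z')"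
        using mult_swap[of z z'] by simp
      also have "\<dots> = (z \<otimes>\<^bsub>E\<^esub> i (wedge h (l z'))) \<otimes>\<^bsub>E\<^esub> z'"
        using mult_i[of z "wedge h (l z')"] by (simp flip: E.m_assoc)
      also have "\<dots> = z \<otimes>\<^bsub>E\<^esub> lift h z'" by (simp add: lift_def E.m_assoc)
      finally have "x \<otimes>\<^bsub>semidirect C\<^esub> y = (i ?w, \<one>) \<otimes>\<^bsub>semidirect C\<^esub> (y \<otimes>\<^bsub>semidirect C\<^esub> x)"
        using comm[of h h'] by (simp add: x(1) y(1) semidirect_def lift_one_left)
      moreover have "(i ?w, \<one>) \<in> carrier (semidirect C)" by (simp add: semidirect_def)
      ultimately have "(i ?w, \<one>) = x \<otimes>\<^bsub>semidirect C\<^esub> y \<otimes>\<^bsub>semidirect C\<^esub> inv\<^bsub>semidirect C\<^esub> (y \<otimes>\<^bsub>semidirect C\<^esub> x)"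
        using xy by (simp add: S.m_assoc)
      then show ?thesis using xy by (simp add: S.word_simps x(1) y(1))
    qed
  qed
qed

lemma wedge_in_gam2:
  assumes "g \<in> l ` carrier E" "h \<in> l ` carrier E"
  shows "i (wedge g h) \<in> lower_central E 2"
proof -
  obtain a b where ab: "a \<in> carrier E" "b \<in> carrier E" "g = l a" "h = l b" using assms by auto
  then show ?thesis using comm_eq[of a b] E.comm_gam_carrier[of a 1 b] by (simp add: numeral_2_eq_2)
qed

text \<open>Adjoining a subgroup changes the type of the cover. Transport along an injection with
  left inverse \<open>f'\<close> returns it to a fixed type, as the induction in
  \<open>exists_cover\<close> requires.\<close>

lemma cover_transport:
  fixes f :: "'x \<Rightarrow> 'y" and f' :: "'y \<Rightarrow> 'x"
  assumes f [simp]: "\<And>z. f' (f z) = z"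
  defines "F \<equiv> \<lparr>carrier = f ` carrier E, monoid.mult = (\<lambda>x y. f (f' x \<otimes>\<^bsub>E\<^esub> f' y)), one = f \<one>\<^bsub>E\<^esub>\<rparr>"
  shows "wedge_cover G F (l \<circ> f') (f \<circ> i)"
proof -
  have "group F"
  proof (rule groupI)
    show "\<exists>y\<in>carrier F. y \<otimes>\<^bsub>F\<^esub> x = \<one>\<^bsub>F\<^esub>" if xF: "x \<in> carrier F" for x
    proof -
      obtain z where "z \<in> carrier E" "x = f z" using xF by (auto simp: F_def)
      then show ?thesis by (intro bexI[of _ "f (inv\<^bsub>E\<^esub> z)"]) (auto simp: F_def)
    qed
  qed (auto simp: F_def E.m_assoc)
  then interpret F: group F .
  have "f \<in> hom E F" by (rule homI) (simp_all add: F_def)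
  then have fh: "group_hom E F f" by (simp add: group_hom_def group_hom_axioms_def E.is_group F.is_group)
  show ?thesis
  proof unfold_locales
    show "l \<circ> f' \<in> hom F G" by (rule homI) (auto simp: F_def)
    show "f \<circ> i \<in> hom \<Lambda> F" by (rule Group.hom_compose[OF i_hom \<open>f \<in> hom E F\<close>])
    have "inj f" by (metis f injI)
    then show "inj_on (f \<circ> i) (carrier \<Lambda>)" using i_inj by (auto simp: inj_on_def)
    show "(l \<circ> f') ((f \<circ> i) m) = ext_comm_map G m" if "m \<in> carrier \<Lambda>" for m using that by (simp add: l_i)
    show "grp_comm F x y = (f \<circ> i) (wedge ((l \<circ> f') x) ((l \<circ> f') y))" if xy: "x \<in> carrier F" "y \<in> carrier F" for x y
    proof -
      obtain z z' where "z \<in> carrier E" "z' \<in> carrier E" "x = f z" "y = f z'" using xy by (auto simp: F_def)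
      then show ?thesis by (simp add: group_hom.hom_comm[OF fh, symmetric] comm_eq)
    qed
  qed
qed

end

section \<open>Existence of covers of finitely generated subgroups\<close>

context group
begin

interpretation wedge: group \<Lambda> by (rule group_wedge)

text \<open>The starting point of the construction: \<open>G \<and> G\<close> over the commutator
  subgroup of \<open>G\<close>.\<close>

lemma trivial_cover: "wedge_cover G \<Lambda> (ext_comm_map G) (\<lambda>m. m)"
proof unfold_locales
  show "grp_comm \<Lambda> z z' = wedge (ext_comm_map G z) (ext_comm_map G z')"
    if [simp]: "z \<in> carrier \<Lambda>" "z' \<in> carrier \<Lambda>" for z z'
  proof -
    have [simp]: "ext_comm_map G z \<in> carrier G" "ext_comm_map G z' \<in> carrier G"
      by (simp_all add: group_hom.hom_closed[OF group_hom_ext_comm_map])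
    have "z' \<otimes>\<^bsub>\<Lambda>\<^esub> inv\<^bsub>\<Lambda>\<^esub> z = wedge_act (ext_comm_map G z') (inv\<^bsub>\<Lambda>\<^esub> z) \<otimes>\<^bsub>\<Lambda>\<^esub> z'"
      by (rule Peiffer) simp_all
    then have "z' \<otimes>\<^bsub>\<Lambda>\<^esub> inv\<^bsub>\<Lambda>\<^esub> z \<otimes>\<^bsub>\<Lambda>\<^esub> inv\<^bsub>\<Lambda>\<^esub> z' = inv\<^bsub>\<Lambda>\<^esub> (wedge_act (ext_comm_map G z') z)"
      by (simp add: wedge_act_inv wedge.m_assoc)
    then show ?thesis by (simp add: wedge_boundary_left grp_comm_def wedge.m_assoc)
  qed
  show "(\<lambda>m. m) \<in> hom \<Lambda> \<Lambda>" by (rule homI) simp_all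
qed (simp_all add: ext_comm_map_hom)

lemma wedge_subgroups:
  assumes [simp]: "g \<in> carrier G"
  shows "subgroup {h \<in> carrier G. wedge h g = \<one>\<^bsub>\<Lambda>\<^esub>} G"
proof (rule subgroupI)
  show "inv h \<in> {h \<in> carrier G. wedge h g = \<one>\<^bsub>\<Lambda>\<^esub>}" if "h \<in> {h \<in> carrier G. wedge h g = \<one>\<^bsub>\<Lambda>\<^esub>}" for h
    using that wedge_mult_left'[of "inv h" h g]
    by (simp add: wedge_one_left group_hom.hom_one[OF group_hom_wedge_act])
qed (use wedge_one_left in \<open>auto simp: wedge_mult_left' group_hom.hom_one[OF group_hom_wedge_act]\<close>)

text \<open>Elements with trivial wedge against a fixed one form a subgroup; this is used first
  against \<open>g\<close> and then, with the entries swapped, against \<open>h\<close>.\<close>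

lemma wedge_cyclic:
  assumes [simp]: "g \<in> carrier G" and h: "h \<in> generate G {g}" "h' \<in> generate G {g}"
  shows "wedge h h' = \<one>\<^bsub>\<Lambda>\<^esub>"
proof -
  have C: "x \<in> carrier G" if "x \<in> generate G {g}" for x
    using generate_in_carrier[of "{g}" x] that by simp
  have "generate G {g} \<subseteq> {x \<in> carrier G. wedge x g = \<one>\<^bsub>\<Lambda>\<^esub>}"
    by (rule generate_subgroup_incl[OF _ wedge_subgroups]) (simp_all add: wedge_diag)
  then have "wedge h g = \<one>\<^bsub>\<Lambda>\<^esub>" using h(1) by blast
  then have "wedge g h = \<one>\<^bsub>\<Lambda>\<^esub>" using inv_wedge[of h g] C[OF h(1)] by simp
  then have "generate G {g} \<subseteq> {x \<in> carrier G. wedge x h = \<one>\<^bsub>\<Lambda>\<^esub>}"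
    by (intro generate_subgroup_incl[OF _ wedge_subgroups]) (simp_all add: C[OF h(1)])
  then have "wedge h' h = \<one>\<^bsub>\<Lambda>\<^esub>" using h(2) by blast
  then show ?thesis using inv_wedge[of h' h] C[OF h(1)] C[OF h(2)] by simp
qed

text \<open>The list holds one coordinate for each adjoined cyclic subgroup, which keeps the type
  the same at all stages.\<close>

lemma exists_cover:
  assumes "set gs \<subseteq> carrier G"
  shows "\<exists>(E :: ('a ext_word set \<times> 'a list) monoid) l i. wedge_cover G E l i \<and> set gs \<subseteq> l ` carrier E"
  using assms
proof (induction gs)
  case Nil
  interpret t: wedge_cover G \<Lambda> "ext_comm_map G" "\<lambda>m. m" by (rule trivial_cover)
  show ?case using t.cover_transport[of fst "\<lambda>m. (m, [])"] by auto
next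
  case (Cons g gs)
  then obtain E :: "('a ext_word set \<times> 'a list) monoid" and l i
    where E: "wedge_cover G E l i" "set gs \<subseteq> l ` carrier E" by auto
  interpret E: wedge_cover G E l i by (rule E)
  let ?C = "generate G {g}"
  have g: "g \<in> carrier G" using Cons by simp
  have C: "subgroup ?C G" using g generate_is_subgroup by simp
  have Cc: "x \<in> carrier G" if "x \<in> ?C" for x using subgroup.mem_carrier[OF C that] .
  have "wedge_cover G (E.semidirect ?C) (\<lambda>(z, h). l z \<otimes> h) (\<lambda>m. (i m, \<one>))"
  proof (rule E.semidirect_cover[OF C])
    show w: "wedge h h' = \<one>\<^bsub>\<Lambda>\<^esub>" if "h \<in> ?C" "h' \<in> ?C" for h h' using wedge_cyclic[OF g that] .
    show "h \<otimes> h' = h' \<otimes> h" if "h \<in> ?C" "h' \<in> ?C" for h h'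
      using ext_comm_map_wedge[of h h'] w[OF that] Cc[OF that(1)] Cc[OF that(2)] comm_eq_one_iff[of h h']
        group_hom.hom_one[OF group_hom_ext_comm_map] by simp
  qed
  then interpret S: wedge_cover G "E.semidirect ?C" "\<lambda>(z, h). l z \<otimes> h" "\<lambda>m. (i m, \<one>)" .
  let ?f = "\<lambda>((m, hs), h). (m, h # hs)" and ?f' = "\<lambda>(m, hs). ((m, tl hs), hd hs)"
  have t: "wedge_cover G \<lparr>carrier = ?f ` carrier (E.semidirect ?C),
       monoid.mult = (\<lambda>x y. ?f (?f' x \<otimes>\<^bsub>E.semidirect ?C\<^esub> ?f' y)), one = ?f \<one>\<^bsub>E.semidirect ?C\<^esub>\<rparr>
      ((\<lambda>(z, h). l z \<otimes> h) \<circ> ?f') (?f \<circ> (\<lambda>m. (i m, \<one>)))"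
    by (rule S.cover_transport) auto
  have im: "set (g # gs) \<subseteq> ((\<lambda>(z, h). l z \<otimes> h) \<circ> ?f') ` (?f ` carrier (E.semidirect ?C))"
  proof
    fix x assume "x \<in> set (g # gs)"
    then consider "x = g" | z where "z \<in> carrier E" "x = l z" using E(2) by auto
    then obtain z h where "z \<in> carrier E" "h \<in> ?C" "x = l z \<otimes> h"
    proof cases
      case 1
      have "l \<one>\<^bsub>E\<^esub> = \<one>" by (rule hom_one[OF E.l_hom E.E.is_group is_group])
      then show ?thesis using that[of "\<one>\<^bsub>E\<^esub>" g] 1 g by (simp add: generate.incl)
    next
      case 2
      then show ?thesis using that[of z \<one>] hom_in_carrier[OF E.l_hom] by (simp add: generate.one)
    qed
    then have zh: "(z, h) \<in> carrier (E.semidirect ?C)" "x = (\<lambda>(z, h). l z \<otimes> h) (z, h)"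
      by (simp_all add: E.semidirect_def)
    moreover have "?f' (?f (z, h)) = (z, h)" by (cases z) simp
    ultimately show "x \<in> ((\<lambda>(z, h). l z \<otimes> h) \<circ> ?f') ` (?f ` carrier (E.semidirect ?C))"
      by (metis (no_types, lifting) comp_apply image_eqI)
  qed
  show ?case by (intro exI conjI, rule t) (use im in simp)
qed

end

lemma (in group_hom) lower_central_hom:
  "x \<in> lower_central G k \<Longrightarrow> h x \<in> lower_central H k"
proof (induction k arbitrary: x)
  case (Suc k)
  show ?case
  proof (cases "k = 0")
    case False
    from Suc.prems False[unfolded neq0_conv] show ?thesis
    proof (induction rule: G.gam_induct)
      case (comm a b)
      then show ?case using Suc.IH H.comm_gam_carrier G.gam_carrier by (simp add: hom_comm)
    next
      case (mult a b) then show ?case using G.gam_carrier by simp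
    next
      case (inv a) then show ?case using G.gam_carrier by simp
    qed simp
  qed (use Suc in simp)
qed simp

section \<open>Exponent of the exterior square\<close>

context group
begin

interpretation wedge: group \<Lambda> by (rule group_wedge)

text \<open>The list \<open>gs\<close> of entries of \<open>m\<close> must come before the cover,
  which is then built for it. Once all entries lift, each symbol of \<open>m\<close> is a commutator
  in \<open>E\<close>.\<close>

lemma wedge_square_support:
  assumes "m \<in> carrier \<Lambda>"
  shows "\<exists>gs. set gs \<subseteq> carrier G \<and> (\<forall>(E :: 'x monoid) l i. wedge_cover G E l i \<longrightarrow> set gs \<subseteq> l ` carrier E
    \<longrightarrow> i m \<in> lower_central E 2)"
  using assms
proof (induction rule: wedge_square_induct)
  case one
  have "i \<one>\<^bsub>\<Lambda>\<^esub> \<in> lower_central E 2" if "wedge_cover G E l i" for E :: "'x monoid" and l i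
  proof -
    interpret wedge_cover G E l i by (rule that)
    have "i \<one>\<^bsub>\<Lambda>\<^esub> = \<one>\<^bsub>E\<^esub>" by (rule hom_one[OF i_hom group_wedge E.is_group])
    then show ?thesis by simp
  qed
  then show ?case by (intro exI[of _ "[]"]) auto
next
  case (generator g h m)
  then obtain gs where gs: "set gs \<subseteq> carrier G"
    "\<And>(E :: 'x monoid) l i. \<lbrakk>wedge_cover G E l i; set gs \<subseteq> l ` carrier E\<rbrakk> \<Longrightarrow> i m \<in> lower_central E 2"
    by blast
  have "i (wedge g h \<otimes>\<^bsub>\<Lambda>\<^esub> m) \<in> lower_central E 2"
    if "wedge_cover G E l i" "set (g # h # gs) \<subseteq> l ` carrier E" for E :: "'x monoid" and l i
  proof -
    interpret wedge_cover G E l i by (rule that)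
    have "i (wedge g h \<otimes>\<^bsub>\<Lambda>\<^esub> m) = i (wedge g h) \<otimes>\<^bsub>E\<^esub> i m"
      using generator by (intro hom_mult[OF i_hom]) simp_all
    moreover have "i m \<in> lower_central E 2" using gs(2) that by simp
    ultimately show ?thesis using wedge_in_gam2[of g h] that(2) by simp
  qed
  then show ?case using gs(1) generator(1,2) by (intro exI[of _ "g # h # gs"]) auto
next
  case (inverse g h m)
  then obtain gs where gs: "set gs \<subseteq> carrier G"
    "\<And>(E :: 'x monoid) l i. \<lbrakk>wedge_cover G E l i; set gs \<subseteq> l ` carrier E\<rbrakk> \<Longrightarrow> i m \<in> lower_central E 2"
    by blast
  have "i (wedge h g \<otimes>\<^bsub>\<Lambda>\<^esub> m) \<in> lower_central E 2"
    if "wedge_cover G E l i" "set (g # h # gs) \<subseteq> l ` carrier E" for E :: "'x monoid" and l i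
  proof -
    interpret wedge_cover G E l i by (rule that)
    have "i (wedge h g \<otimes>\<^bsub>\<Lambda>\<^esub> m) = i (wedge h g) \<otimes>\<^bsub>E\<^esub> i m"
      using inverse by (intro hom_mult[OF i_hom]) simp_all
    moreover have "i m \<in> lower_central E 2" using gs(2) that by simp
    ultimately show ?thesis using wedge_in_gam2[of h g] that(2) by simp
  qed
  then show ?case unfolding inv_wedge[OF inverse(1,2)]
    using gs(1) inverse(1,2) by (intro exI[of _ "g # h # gs"]) auto
qed

lemma wedge_square_pow:
  assumes e: "odd e" "\<And>x. x \<in> carrier G \<Longrightarrow> x [^] (e::nat) = \<one>"
    and c: "lcs G c = {\<one>}" "c + 1 \<le> 3 * 2 ^ n" "n > 0" and m: "m \<in> carrier \<Lambda>"
  shows "m [^]\<^bsub>\<Lambda>\<^esub> (e ^ n) = \<one>\<^bsub>\<Lambda>\<^esub>"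
proof -
  obtain gs where gs: "set gs \<subseteq> carrier G"
    "\<And>(E :: ('a ext_word set \<times> 'a list) monoid) l i.
      \<lbrakk>wedge_cover G E l i; set gs \<subseteq> l ` carrier E\<rbrakk> \<Longrightarrow> i m \<in> lower_central E 2"
    using wedge_square_support[OF m] by blast
  obtain E :: "('a ext_word set \<times> 'a list) monoid" and l i
    where E: "wedge_cover G E l i" "set gs \<subseteq> l ` carrier E" using exists_cover[OF gs(1)] by blast
  interpret wedge_cover G E l i by (rule E(1))
  have lh: "group_hom E G l" and ih: "group_hom \<Lambda> E i"
    by (simp_all add: group_hom_def group_hom_axioms_def l_hom i_hom E.is_group is_group group_wedge)
  have i1: "i \<one>\<^bsub>\<Lambda>\<^esub> = \<one>\<^bsub>E\<^esub>" by (rule group_hom.hom_one[OF ih])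
  have lc: "l x \<in> carrier G" if "x \<in> carrier E" for x using hom_in_carrier[OF l_hom that] .
  have "i m [^]\<^bsub>E\<^esub> (e ^ n) \<in> lower_central E (3 * 2 ^ n + 1)"
  proof (rule E.gam2_pow_iterate[OF e(1) _ gs(2)[OF E] c(3)])
    show "grp_comm E (x [^]\<^bsub>E\<^esub> e) y = \<one>\<^bsub>E\<^esub>" if "x \<in> carrier E" "y \<in> carrier E" for x y
      using that group_hom.hom_nat_pow[OF lh that(1), of e] e(2)[OF lc[OF that(1)]] lc
      by (simp add: comm_eq wedge_one_left i1)
  qed
  also have "lower_central E (3 * 2 ^ n + 1) \<subseteq> lower_central E (Suc (Suc c))"
    by (rule E.gam_antimono) (use c(2) in simp)
  also have "\<dots> \<subseteq> {\<one>\<^bsub>E\<^esub>}"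
  proof
    fix x assume "x \<in> lower_central E (Suc (Suc c))"
    from this zero_less_Suc show "x \<in> {\<one>\<^bsub>E\<^esub>}"
    proof (induction rule: E.gam_induct)
      case (comm a h)
      \<comment> \<open>With weights as indices, \<open>lower_central G (Suc c)\<close> is
        \<open>lcs G c\<close>. So \<open>a\<close> lies in the kernel of \<open>l\<close>, and the
        class of \<open>E\<close> exceeds \<open>c\<close> by at most one.\<close>
      have "l a \<in> lower_central G (Suc c)" using group_hom.lower_central_hom[OF lh comm(1)] .
      then have "l a = \<one>" using c(1) by (simp add: lower_central_def)
      then show ?case using comm E.gam_carrier[OF comm(1)] lc by (simp add: comm_eq wedge_one_left i1)
    qed simp_all
  qed
  finally have "i (m [^]\<^bsub>\<Lambda>\<^esub> (e ^ n)) = i \<one>\<^bsub>\<Lambda>\<^esub>"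
    using group_hom.hom_nat_pow[OF ih m] i1 by simp
  then show ?thesis using i_inj m by (auto dest: inj_onD)
qed

end

section \<open>Exponents as divisors\<close>

lemma group_exponent_pow:
  assumes "group_exponent H \<noteq> 0" "x \<in> carrier H"
  shows "x [^]\<^bsub>H\<^esub> group_exponent H = \<one>\<^bsub>H\<^esub>"
proof -
  have ex: "\<exists>n::nat>0. \<forall>x\<in>carrier H. x [^]\<^bsub>H\<^esub> n = \<one>\<^bsub>H\<^esub>"
    using assms(1) by (auto simp: group_exponent_def split: if_splits)
  then show ?thesis using LeastI_ex[OF ex] assms(2) by (simp add: group_exponent_def)
qed

lemma (in group) group_exponent_dvd:
  assumes "N > 0" "\<And>x. x \<in> carrier G \<Longrightarrow> x [^] (N::nat) = \<one>"
  shows "group_exponent G dvd N"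
proof -
  let ?P = "\<lambda>n::nat. n > 0 \<and> (\<forall>x\<in>carrier G. x [^] n = \<one>)"
  have P: "?P N" using assms by simp
  then have "\<exists>n::nat>0. \<forall>x\<in>carrier G. x [^] n = \<one>" by blast
  then have q: "group_exponent G = (LEAST n. ?P n)" by (simp only: group_exponent_def if_True)
  have Pq: "?P (group_exponent G)" using LeastI[of ?P, OF P] unfolding q .
  let ?r = "N mod group_exponent G"
  have "x [^] ?r = \<one>" if x: "x \<in> carrier G" for x
  proof -
    have "x [^] N = x [^] (group_exponent G * (N div group_exponent G)) \<otimes> x [^] ?r"
      using x by (simp add: nat_pow_mult)
    moreover have "x [^] (group_exponent G * (N div group_exponent G)) = \<one>"
      by (rule pow_mod_exp[OF x]) (use Pq x in auto)
    ultimately show ?thesis using assms(2)[OF x] x by simp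
  qed
  moreover have "?r < group_exponent G" using Pq by simp
  ultimately have "?r = 0" using not_less_Least[of ?r ?P] q by auto
  then show ?thesis by (simp add: dvd_eq_mod_eq_0)
qed

theorem theorem5p3:
  fixes G :: "('a, 'b) monoid_scheme" and c :: nat
  assumes "group G"
    and "nilpotent_class G c"
    and "c > 2"
    and "odd (group_exponent G)"
  shows "group_exponent (ext_square G)
           dvd (group_exponent G) ^ nat \<lceil>log 2 ((real c + 1) / 3)\<rceil>
       \<and> group_exponent (schur_mult G)
           dvd (group_exponent G) ^ nat \<lceil>log 2 ((real c + 1) / 3)\<rceil>"
proof -
  interpret group G by (rule assms(1))
  define e where "e = group_exponent G"
  define n where "n = nat \<lceil>log 2 ((real c + 1) / 3)\<rceil>"
  \<comment> \<open>The value 0 stands for unbounded exponent and is even.\<close>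
  have e0: "e \<noteq> 0" using assms(4) unfolding e_def by (metis even_zero)
  \<comment> \<open>From \<open>c > 2\<close> it follows that \<open>n\<close> is at least 1, the
    base case of the iteration.\<close>
  have pos: "log 2 ((real c + 1) / 3) > 0" using assms(3) by simp
  have n: "n > 0" using pos by (simp add: n_def)
  have "c + 1 \<le> 3 * 2 ^ n"
  proof -
    have "log 2 ((real c + 1) / 3) \<le> real n" unfolding n_def by linarith
    then have "(real c + 1) / 3 \<le> 2 powr real n" by (subst (asm) log_le_iff) simp_all
    then have "real (c + 1) \<le> real (3 * 2 ^ n)" by (simp add: powr_realpow)
    then show ?thesis by linarith
  qed
  then have pow: "m [^]\<^bsub>ext_square G\<^esub> (e ^ n) = \<one>\<^bsub>ext_square G\<^esub>" if "m \<in> carrier (ext_square G)" for m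
    using wedge_square_pow[of e c n m] assms(2,4) group_exponent_pow[of G] e0 n that
    by (simp add: e_def nilpotent_class_def)
  interpret W: group "ext_square G" by (rule group_wedge)
  interpret S: group "schur_mult G"
    unfolding schur_mult_def
    by (rule subgroup.subgroup_is_group[OF group_hom.subgroup_kernel[OF group_hom_ext_comm_map] group_wedge])
  have "group_exponent (ext_square G) dvd e ^ n"
    by (rule W.group_exponent_dvd) (use e0 pow in simp_all)
  moreover have "group_exponent (schur_mult G) dvd e ^ n"
  proof (rule S.group_exponent_dvd)
    show "m [^]\<^bsub>schur_mult G\<^esub> (e ^ n) = \<one>\<^bsub>schur_mult G\<^esub>" if "m \<in> carrier (schur_mult G)" for m
      using pow[of m] that W.nat_pow_consistent[of m "e ^ n"] by (simp add: schur_mult_def kernel_def)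
  qed (use e0 in simp)
  ultimately show ?thesis unfolding e_def n_def by blast
qed

end
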